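(* Let $\mathcal{A}$ be an arbitrary (essentially small) idempotent complete additive category, and let $\mathcal{E}^{\max}$ be the maximal exact structure on $\mathcal{A}$. Then the lattice of exact structures on $\mathcal{A}$ is isomorphic to the lattice of Serre subcategories of the abelian category $\operatorname{eff}(\mathcal{E}^{\max})$.
   Context: All categories are essentially small. An exact structure (in the sense of Quillen) on an additive category $\mathcal{A}$ is a class $\mathcal{E}$ of kernel-cokernel pairs $A\xrightarrow{i}B\xrightarrow{p}C$ ($i$ is a kernel of $p$ and $p$ is a cokernel of $i$), called conflations ($i$ is then an inflation and $p$ a deflation), closed under isomorphism and such that: identities are inflations and deflations; inflations are closed under composition, and so are deflations; the push-out of an inflation along an arbitrary morphism exists and yields an inflation; the pull-back of a deflation along an arbitrary morphism exists and yields a deflation. Exact structures on $\mathcal{A}$ are ordered by inclusion of their classes of conflations; it is known that they form a bounded complete lattice, with minimal element the split exact structure $\mathcal{E}^{\mathrm{add}}$ and with a maximal element denoted $\mathcal{E}^{\max}$. $\operatorname{Mod}\mathcal{A}$ denotes the category of additive functors $\mathcal{A}^{\mathrm{op}}\to\mathbf{Ab}$ (right $\mathcal{A}$-modules). For a conflation $\delta: A\xrightarrow{f}B\xrightarrow{g}C$, its contravariant defect is $\delta^{\sharp}=\operatorname{Coker}(\operatorname{Hom}(-,B)\xrightarrow{\operatorname{Hom}(-,g)}\operatorname{Hom}(-,C))\in\operatorname{Mod}\mathcal{A}$. For an exact structure $\mathcal{E}$, $\operatorname{eff}\mathcal{E}$ is the full subcategory of $\operatorname{Mod}\mathcal{A}$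 of modules isomorphic to $\delta^\sharp$ for some conflation $\delta$ in $\mathcal{E}$ (equivalently, the finitely presented modules $M$ such that for each $W\in\mathcal{A}$ and $w\in M(W)$ there is a deflation $g:E\to W$ in $\mathcal{E}$ with $(Mg)(w)=0$). It is known to be closed under kernels, cokernels and extensions in $\operatorname{Mod}\mathcal{A}$, hence abelian. Serre subcategories are ordered by inclusion. *)

theory Defs
  imports "HOL-Algebra.Lattice" "HOL-Algebra.Coset"
begin

section \<open>Additive categories\<close>

text \<open>
  Categories have a set of objects and a set of morphisms, hence are small. Every morphism
  determines its domain and codomain, and \<open>Comp C g f\<close> is the composite \<open>g \<circ> f\<close>.
  Values of the operations outside the sets of objects and (composable, parallel) morphisms
  are irrelevant.
\<close>

record ('o, 'm) preadd_cat =
  Ob :: "'o set"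
  Mor :: "'m set"
  Dom :: "'m \<Rightarrow> 'o"
  Cod :: "'m \<Rightarrow> 'o"
  Id :: "'o \<Rightarrow> 'm"
  Comp :: "'m \<Rightarrow> 'm \<Rightarrow> 'm"
  Add :: "'m \<Rightarrow> 'm \<Rightarrow> 'm"
  Zero :: "'o \<Rightarrow> 'o \<Rightarrow> 'm"

definition Hom :: "('o, 'm) preadd_cat \<Rightarrow> 'o \<Rightarrow> 'o \<Rightarrow> 'm set" where
  "Hom C X Y = {f \<in> Mor C. Dom C f = X \<and> Cod C f = Y}"

definition hom_group :: "('o, 'm) preadd_cat \<Rightarrow> 'o \<Rightarrow> 'o \<Rightarrow> 'm monoid" where
  "hom_group C X Y = \<lparr>carrier = Hom C X Y, mult = Add C, one = Zero C X Y\<rparr>"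

locale category =
  fixes C :: "('o, 'm) preadd_cat"
  assumes Dom_in: "f \<in> Mor C \<Longrightarrow> Dom C f \<in> Ob C"
    and Cod_in: "f \<in> Mor C \<Longrightarrow> Cod C f \<in> Ob C"
    and Id_in: "X \<in> Ob C \<Longrightarrow> Id C X \<in> Hom C X X"
    and Comp_in: "f \<in> Hom C X Y \<Longrightarrow> g \<in> Hom C Y Z \<Longrightarrow> Comp C g f \<in> Hom C X Z"
    and Comp_assoc: "f \<in> Hom C W X \<Longrightarrow> g \<in> Hom C X Y \<Longrightarrow> h \<in> Hom C Y Z \<Longrightarrow>
      Comp C h (Comp C g f) = Comp C (Comp C h g) f"
    and Comp_Id: "f \<in> Hom C X Y \<Longrightarrow> Comp C f (Id C X) = f"
    and Id_Comp: "f \<in> Hom C X Y \<Longrightarrow> Comp C (Id C Y) f = f"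

locale preadditive_category = category C for C :: "('o, 'm) preadd_cat" +
  assumes Hom_comm_group: "X \<in> Ob C \<Longrightarrow> Y \<in> Ob C \<Longrightarrow> comm_group (hom_group C X Y)"
    and Comp_Add: "f \<in> Hom C X Y \<Longrightarrow> f' \<in> Hom C X Y \<Longrightarrow> g \<in> Hom C Y Z \<Longrightarrow>
      Comp C g (Add C f f') = Add C (Comp C g f) (Comp C g f')"
    and Add_Comp: "f \<in> Hom C X Y \<Longrightarrow> g \<in> Hom C Y Z \<Longrightarrow> g' \<in> Hom C Y Z \<Longrightarrow>
      Comp C (Add C g g') f = Add C (Comp C g f) (Comp C g' f)"

definition is_zero_object :: "('o, 'm) preadd_cat \<Rightarrow> 'o \<Rightarrow> bool" where
  "is_zero_object C Z \<longleftrightarrow> Z \<in> Ob C \<and>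
     (\<forall>X \<in> Ob C. (\<exists>!f. f \<in> Hom C X Z) \<and> (\<exists>!f. f \<in> Hom C Z X))"

definition is_biproduct ::
  "('o, 'm) preadd_cat \<Rightarrow> 'o \<Rightarrow> 'o \<Rightarrow> 'o \<Rightarrow> 'm \<Rightarrow> 'm \<Rightarrow> 'm \<Rightarrow> 'm \<Rightarrow> bool" where
  "is_biproduct C X Y B i j p q \<longleftrightarrow>
     i \<in> Hom C X B \<and> j \<in> Hom C Y B \<and> p \<in> Hom C B X \<and> q \<in> Hom C B Y \<and>
     Comp C p i = Id C X \<and> Comp C q j = Id C Y \<and>
     Comp C q i = Zero C X Y \<and> Comp C p j = Zero C Y X \<and>
     Add C (Comp C i p) (Comp C j q) = Id C B"

locale additive_category = preadditive_category C for C :: "('o, 'm) preadd_cat" +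
  assumes zero_object: "\<exists>Z. is_zero_object C Z"
    and biproducts: "X \<in> Ob C \<Longrightarrow> Y \<in> Ob C \<Longrightarrow> \<exists>B \<in> Ob C. \<exists>i j p q. is_biproduct C X Y B i j p q"

definition idempotent_complete :: "('o, 'm) preadd_cat \<Rightarrow> bool" where
  "idempotent_complete C \<longleftrightarrow>
     (\<forall>X \<in> Ob C. \<forall>e \<in> Hom C X X. Comp C e e = e \<longrightarrow>
        (\<exists>Y \<in> Ob C. \<exists>r \<in> Hom C X Y. \<exists>s \<in> Hom C Y X.
           Comp C s r = e \<and> Comp C r s = Id C Y))"

definition is_iso :: "('o, 'm) preadd_cat \<Rightarrow> 'm \<Rightarrow> bool" where
  "is_iso C f \<longleftrightarrow> f \<in> Mor C \<and>
     (\<exists>g \<in> Hom C (Cod C f) (Dom C f).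
        Comp C g f = Id C (Dom C f) \<and> Comp C f g = Id C (Cod C f))"

definition isomorphic :: "('o, 'm) preadd_cat \<Rightarrow> 'o \<Rightarrow> 'o \<Rightarrow> bool" where
  "isomorphic C X Y \<longleftrightarrow> (\<exists>f \<in> Hom C X Y. is_iso C f)"

definition full_subcategory :: "('o, 'm) preadd_cat \<Rightarrow> 'o set \<Rightarrow> ('o, 'm) preadd_cat" where
  "full_subcategory C S =
     C\<lparr>Ob := S, Mor := {f \<in> Mor C. Dom C f \<in> S \<and> Cod C f \<in> S}\<rparr>"


section \<open>Exact structures\<close>

definition is_kernel :: "('o, 'm) preadd_cat \<Rightarrow> 'm \<Rightarrow> 'm \<Rightarrow> bool" where
  "is_kernel C i p \<longleftrightarrow> i \<in> Mor C \<and> p \<in> Mor C \<and> Cod C i = Dom C p \<and>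
     Comp C p i = Zero C (Dom C i) (Cod C p) \<and>
     (\<forall>h \<in> Mor C. Cod C h = Dom C p \<and> Comp C p h = Zero C (Dom C h) (Cod C p) \<longrightarrow>
        (\<exists>!k. k \<in> Hom C (Dom C h) (Dom C i) \<and> Comp C i k = h))"

definition is_cokernel :: "('o, 'm) preadd_cat \<Rightarrow> 'm \<Rightarrow> 'm \<Rightarrow> bool" where
  "is_cokernel C p i \<longleftrightarrow> i \<in> Mor C \<and> p \<in> Mor C \<and> Cod C i = Dom C p \<and>
     Comp C p i = Zero C (Dom C i) (Cod C p) \<and>
     (\<forall>h \<in> Mor C. Dom C h = Cod C i \<and> Comp C h i = Zero C (Dom C i) (Cod C h) \<longrightarrow>
        (\<exists>!k. k \<in> Hom C (Cod C p) (Cod C h) \<and> Comp C k p = h))"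

definition kernel_cokernel_pair :: "('o, 'm) preadd_cat \<Rightarrow> 'm \<Rightarrow> 'm \<Rightarrow> bool" where
  "kernel_cokernel_pair C i p \<longleftrightarrow> is_kernel C i p \<and> is_cokernel C p i"

text \<open>
  In \<open>is_pushout C i f i' f'\<close> and \<open>is_pullback C p f p' f'\<close> the primed morphism \<open>i'\<close>
  (resp. \<open>p'\<close>) is parallel to \<open>i\<close> (resp. \<open>p\<close>) in the square:
  \<open>i' \<circ> f = f' \<circ> i\<close> and \<open>p \<circ> f' = f \<circ> p'\<close>.
\<close>

definition is_pushout :: "('o, 'm) preadd_cat \<Rightarrow> 'm \<Rightarrow> 'm \<Rightarrow> 'm \<Rightarrow> 'm \<Rightarrow> bool" where
  "is_pushout C i f i' f' \<longleftrightarrow>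
     i \<in> Mor C \<and> f \<in> Mor C \<and> i' \<in> Mor C \<and> f' \<in> Mor C \<and>
     Dom C i = Dom C f \<and> Dom C i' = Cod C f \<and> Dom C f' = Cod C i \<and> Cod C i' = Cod C f' \<and>
     Comp C i' f = Comp C f' i \<and>
     (\<forall>u \<in> Mor C. \<forall>v \<in> Mor C.
        Dom C u = Cod C f \<and> Dom C v = Cod C i \<and> Cod C u = Cod C v \<and> Comp C u f = Comp C v i \<longrightarrow>
        (\<exists>!k. k \<in> Hom C (Cod C i') (Cod C u) \<and> Comp C k i' = u \<and> Comp C k f' = v))"

definition is_pullback :: "('o, 'm) preadd_cat \<Rightarrow> 'm \<Rightarrow> 'm \<Rightarrow> 'm \<Rightarrow> 'm \<Rightarrow> bool" where
  "is_pullback C p f p' f' \<longleftrightarrow>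
     p \<in> Mor C \<and> f \<in> Mor C \<and> p' \<in> Mor C \<and> f' \<in> Mor C \<and>
     Cod C p = Cod C f \<and> Cod C p' = Dom C f \<and> Cod C f' = Dom C p \<and> Dom C p' = Dom C f' \<and>
     Comp C f p' = Comp C p f' \<and>
     (\<forall>u \<in> Mor C. \<forall>v \<in> Mor C.
        Cod C u = Dom C f \<and> Cod C v = Dom C p \<and> Dom C u = Dom C v \<and> Comp C f u = Comp C p v \<longrightarrow>
        (\<exists>!k. k \<in> Hom C (Dom C u) (Dom C p') \<and> Comp C p' k = u \<and> Comp C f' k = v))"

text \<open>
  A class of conflations is a set of pairs \<open>(i, p)\<close>; the three objects are recovered as
  \<open>Dom C i\<close>, \<open>Cod C i = Dom C p\<close> and \<open>Cod C p\<close>.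
\<close>

definition inflation :: "('m \<times> 'm) set \<Rightarrow> 'm \<Rightarrow> bool" where
  "inflation E i \<longleftrightarrow> (\<exists>p. (i, p) \<in> E)"

definition deflation :: "('m \<times> 'm) set \<Rightarrow> 'm \<Rightarrow> bool" where
  "deflation E p \<longleftrightarrow> (\<exists>i. (i, p) \<in> E)"

definition isomorphic_pairs :: "('o, 'm) preadd_cat \<Rightarrow> 'm \<times> 'm \<Rightarrow> 'm \<times> 'm \<Rightarrow> bool" where
  "isomorphic_pairs C = (\<lambda>(i, p) (i', p').
     \<exists>a \<in> Hom C (Dom C i) (Dom C i'). \<exists>b \<in> Hom C (Cod C i) (Cod C i').
     \<exists>c \<in> Hom C (Cod C p) (Cod C p').
       is_iso C a \<and> is_iso C b \<and> is_iso C c \<and>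
       Comp C b i = Comp C i' a \<and> Comp C c p = Comp C p' b)"

text \<open>
  Push-outs and pull-backs are unique up to isomorphism and \<open>E\<close> is closed under isomorphism,
  so it does not matter whether some or all push-outs of inflations are required to be inflations.
\<close>

definition exact_structure :: "('o, 'm) preadd_cat \<Rightarrow> ('m \<times> 'm) set \<Rightarrow> bool" where
  "exact_structure C E \<longleftrightarrow>
     (\<forall>(i, p) \<in> E. kernel_cokernel_pair C i p) \<and>
     (\<forall>\<delta> \<in> E. \<forall>i' p'. kernel_cokernel_pair C i' p' \<and> isomorphic_pairs C \<delta> (i', p') \<longrightarrow>
        (i', p') \<in> E) \<and>
     (\<forall>X \<in> Ob C. inflation E (Id C X) \<and> deflation E (Id C X)) \<and>
     (\<forall>i j. inflation E i \<and> inflation E j \<and> Cod C i = Dom C j \<longrightarrow> inflation E (Comp C j i)) \<and>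
     (\<forall>p q. deflation E p \<and> deflation E q \<and> Cod C p = Dom C q \<longrightarrow> deflation E (Comp C q p)) \<and>
     (\<forall>i f. inflation E i \<and> f \<in> Mor C \<and> Dom C f = Dom C i \<longrightarrow>
        (\<exists>i' f'. is_pushout C i f i' f' \<and> inflation E i')) \<and>
     (\<forall>p f. deflation E p \<and> f \<in> Mor C \<and> Cod C f = Cod C p \<longrightarrow>
        (\<exists>p' f'. is_pullback C p f p' f' \<and> deflation E p'))"

definition exact_structures :: "('o, 'm) preadd_cat \<Rightarrow> ('m \<times> 'm) set gorder" where
  "exact_structures C = \<lparr>carrier = {E. exact_structure C E}, eq = (=), le = (\<subseteq>)\<rparr>"


section \<open>Right modules over a category\<close>

text \<open>
  A right module is an additive functor from the opposite of \<open>C\<close> to abelian groups.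
  The groups are the (multiplicatively written) commutative groups of HOL-Algebra.
\<close>

record ('o, 'm, 'g) rmod =
  Grp :: "'o \<Rightarrow> 'g monoid"
  Act :: "'m \<Rightarrow> 'g \<Rightarrow> 'g"

definition right_module :: "('o, 'm) preadd_cat \<Rightarrow> ('o, 'm, 'g) rmod \<Rightarrow> bool" where
  "right_module C M \<longleftrightarrow>
     (\<forall>X \<in> Ob C. comm_group (Grp M X)) \<and>
     (\<forall>f \<in> Mor C. Act M f \<in> hom (Grp M (Cod C f)) (Grp M (Dom C f))) \<and>
     (\<forall>X \<in> Ob C. \<forall>x \<in> carrier (Grp M X). Act M (Id C X) x = x) \<and>
     (\<forall>f \<in> Mor C. \<forall>g \<in> Mor C. Cod C f = Dom C g \<longrightarrow>
        (\<forall>x \<in> carrier (Grp M (Cod C g)). Act M (Comp C g f) x = Act M f (Act M g x))) \<and>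
     (\<forall>f \<in> Mor C. \<forall>g \<in> Mor C. Dom C f = Dom C g \<and> Cod C f = Cod C g \<longrightarrow>
        (\<forall>x \<in> carrier (Grp M (Cod C f)).
           Act M (Add C f g) x = Act M f x \<otimes>\<^bsub>Grp M (Dom C f)\<^esub> Act M g x))"

text \<open>
  Natural transformations are extensional, so that equal ones are equal as functions. Morphisms
  of modules carry their domain and codomain.
\<close>

definition nat_trans ::
  "('o, 'm) preadd_cat \<Rightarrow> ('o, 'm, 'g) rmod \<Rightarrow> ('o, 'm, 'g) rmod \<Rightarrow> ('o \<Rightarrow> 'g \<Rightarrow> 'g) set" where
  "nat_trans C M N = {\<eta> \<in> extensional (Ob C).
     (\<forall>X \<in> Ob C. \<eta> X \<in> hom (Grp M X) (Grp N X) \<inter> extensional (carrier (Grp M X))) \<and>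
     (\<forall>f \<in> Mor C. \<forall>x \<in> carrier (Grp M (Cod C f)).
        \<eta> (Dom C f) (Act M f x) = Act N f (\<eta> (Cod C f) x))}"

type_synonym ('o, 'm, 'g) rmod_mor = "('o, 'm, 'g) rmod \<times> ('o \<Rightarrow> 'g \<Rightarrow> 'g) \<times> ('o, 'm, 'g) rmod"

definition ModCat ::
  "('o, 'm) preadd_cat \<Rightarrow> (('o, 'm, 'g) rmod, ('o, 'm, 'g) rmod_mor) preadd_cat" where
  "ModCat C = \<lparr>
     Ob = {M. right_module C M},
     Mor = {(M, \<eta>, N). right_module C M \<and> right_module C N \<and> \<eta> \<in> nat_trans C M N},
     Dom = (\<lambda>(M, \<eta>, N). M),
     Cod = (\<lambda>(M, \<eta>, N). N),
     Id = (\<lambda>M. (M, \<lambda>X \<in> Ob C. \<lambda>x \<in> carrier (Grp M X). x, M)),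
     Comp = (\<lambda>(N, \<theta>, P) (M, \<eta>, N').
       (M, \<lambda>X \<in> Ob C. \<lambda>x \<in> carrier (Grp M X). \<theta> X (\<eta> X x), P)),
     Add = (\<lambda>(M, \<eta>, N) (M', \<theta>, N').
       (M, \<lambda>X \<in> Ob C. \<lambda>x \<in> carrier (Grp M X). \<eta> X x \<otimes>\<^bsub>Grp N X\<^esub> \<theta> X x, N)),
     Zero = (\<lambda>M N. (M, \<lambda>X \<in> Ob C. \<lambda>x \<in> carrier (Grp M X). \<one>\<^bsub>Grp N X\<^esub>, N))\<rparr>"


section \<open>Defects and effaceable modules\<close>

definition hom_image :: "('o, 'm) preadd_cat \<Rightarrow> 'm \<Rightarrow> 'o \<Rightarrow> 'm set" where
  "hom_image C g X = Comp C g ` Hom C X (Dom C g)"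

text \<open>
  The value at \<open>X\<close> of the contravariant defect of a conflation \<open>(f, g)\<close> is the quotient of
  \<open>Hom(X, Cod g)\<close> by \<open>hom_image C g X\<close>, the image of \<open>Hom(X, g)\<close>. A morphism \<open>h\<close> sends the
  coset of \<open>u\<close> to that of \<open>u \<circ> h\<close>; the union below is over representatives \<open>u\<close> of the coset \<open>U\<close>,
  all of which give the same coset.
\<close>

definition defect ::
  "('o, 'm) preadd_cat \<Rightarrow> 'm \<times> 'm \<Rightarrow> ('o, 'm, 'm set) rmod" where
  "defect C = (\<lambda>(f, g). \<lparr>
     Grp = (\<lambda>X. hom_group C X (Cod C g) Mod hom_image C g X),
     Act = (\<lambda>h U. \<Union>u \<in> U.
       hom_image C g (Dom C h) #>\<^bsub>hom_group C (Dom C h) (Cod C g)\<^esub> Comp C u h)\<rparr>)"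

text \<open>
  Modules are taken with values in groups carried by subsets of \<open>'m set\<close>. This universe contains
  all defects, is closed under submodules and, up to isomorphism, under quotients; enlarging it
  would add no isomorphism classes to \<open>eff\<close>.
\<close>

definition eff :: "('o, 'm) preadd_cat \<Rightarrow> ('m \<times> 'm) set \<Rightarrow>
  (('o, 'm, 'm set) rmod, ('o, 'm, 'm set) rmod_mor) preadd_cat" where
  "eff C E = full_subcategory (ModCat C)
     {M. right_module C M \<and> (\<exists>\<delta> \<in> E. isomorphic (ModCat C) M (defect C \<delta>))}"


section \<open>Serre subcategories and lattice isomorphisms\<close>

text \<open>
  Full subcategories are given by their sets of objects. In an abelian category the short exact
  sequences are exactly the kernel-cokernel pairs. Closure under isomorphism follows, since for
  an isomorphism \<open>f: X \<rightarrow> Y\<close> the sequence \<open>0 \<rightarrow> X \<rightarrow> Y \<rightarrow> 0 \<rightarrow> 0\<close> is short exact.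
\<close>

definition serre_subcategory :: "('o, 'm) preadd_cat \<Rightarrow> 'o set \<Rightarrow> bool" where
  "serre_subcategory B S \<longleftrightarrow> S \<subseteq> Ob B \<and> S \<noteq> {} \<and>
     (\<forall>i p. kernel_cokernel_pair B i p \<longrightarrow>
        (Cod B i \<in> S \<longleftrightarrow> Dom B i \<in> S \<and> Cod B p \<in> S))"

definition serre_subcategories :: "('o, 'm) preadd_cat \<Rightarrow> 'o set gorder" where
  "serre_subcategories B = \<lparr>carrier = {S. serre_subcategory B S}, eq = (=), le = (\<subseteq>)\<rparr>"

definition isomorphic_lattices :: "'a gorder \<Rightarrow> 'b gorder \<Rightarrow> bool" where
  "isomorphic_lattices L M \<longleftrightarrow> lattice L \<and> lattice M \<and>
     (\<exists>\<phi>. bij_betw \<phi> (carrier L) (carrier M) \<and>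
        (\<forall>x \<in> carrier L. \<forall>y \<in> carrier L.
           \<phi> (x \<squnion>\<^bsub>L\<^esub> y) = \<phi> x \<squnion>\<^bsub>M\<^esub> \<phi> y \<and> \<phi> (x \<sqinter>\<^bsub>L\<^esub> y) = \<phi> x \<sqinter>\<^bsub>M\<^esub> \<phi> y))"

end

theory Submission
  imports Defs
begin

text \<open>
  The isomorphism sends an exact structure \<open>E\<close> to the class \<open>eff E\<close> of effaceable modules. The
  point is that the modules in \<open>eff Emax\<close> are those given by a deflation \<open>g: B \<rightarrow> C\<close> in the
  following way: the module is generated by an element \<open>c\<close> over \<open>C\<close> that is killed by exactly
  those \<open>h: X \<rightarrow> C\<close> which factor through \<open>g\<close> (the predicate \<open>presents\<close>). A morphism out of
  such a module is a choice of an element killed by \<open>g\<close>, so that everything about modules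
  becomes a statement about factorisations in the category.
  
  The map is an embedding of orders because \<open>E\<close> can be read off \<open>eff E\<close>. A module lies in \<open>eff E\<close>
  only if each of its elements is killed by an \<open>E\<close>-deflation. If the module of a conflation
  \<open>(f, g)\<close> has this property, then its generator is killed by an \<open>E\<close>-deflation, which thus has
  the form \<open>g \<circ> k\<close>, and Quillen's obscure axiom (\<open>deflation_of_comp\<close>) puts \<open>(f, g)\<close> into \<open>E\<close>. Being
  killed locally by \<open>E\<close>-deflations passes to submodules, quotients and extensions, hence \<open>eff E\<close> is
  a Serre subcategory (\<open>eff_serre\<close>). This uses that kernel-cokernel pairs in \<open>eff Emax\<close> are exact
  at every object (\<open>kcp_short_exact\<close>).
  
  The map is onto because a Serre subcategory \<open>S\<close> comes from the conflations whose defect lies in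
  \<open>S\<close>. To see that they form an exact structure, take a deflation \<open>g: B \<rightarrow> C\<close> and any
  \<open>v: X \<rightarrow> C\<close>. The element \<open>v\<close> generates a submodule of the defect of \<open>g\<close>; this submodule is the
  defect of the pull-back of \<open>g\<close> along \<open>v\<close>, and the quotient by it is the defect of
  \<open>[g, v]: B \<oplus> X \<rightarrow> C\<close>. So the defect of \<open>g\<close> lies in \<open>S\<close> if and only if the other two do
  (\<open>defect_in_step\<close>). From this single rule all axioms follow by choosing \<open>v\<close>.
  
  On the side of Serre subcategories arbitrary intersections exist, which gives a complete lattice,
  and an isomorphism of orders transports the lattice structure to the exact structures.
\<close>

section \<open>Calculating in a preadditive category\<close>

lemma Hom_iff [simp]: "f \<in> Hom C X Y \<longleftrightarrow> f \<in> Mor C \<and> Dom C f = X \<and> Cod C f = Y"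
  by (simp add: Hom_def)

declare (in category) Dom_in [simp] Cod_in [simp]

context category
begin

text \<open>
  Side conditions are equations between values of \<open>Dom\<close> and \<open>Cod\<close> instead of membership in sets
  \<open>Hom X Y\<close>: they have no variables besides the morphisms in question, and hence the simplifier can
  discharge them by rewriting.
\<close>

lemma comp_arr [simp]:
  assumes "f \<in> Mor C" "g \<in> Mor C" "Cod C f = Dom C g"
  shows "Comp C g f \<in> Mor C" "Dom C (Comp C g f) = Dom C f" "Cod C (Comp C g f) = Cod C g"
  using Comp_in[of f "Dom C f" "Cod C f" g "Cod C g"] assms by auto

lemma id_arr [simp]:
  assumes "X \<in> Ob C"
  shows "Id C X \<in> Mor C" "Dom C (Id C X) = X" "Cod C (Id C X) = X"
  using Id_in[OF assms] by auto

lemma comp_assoc [simp]: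
  assumes "f \<in> Mor C" "g \<in> Mor C" "h \<in> Mor C" "Cod C f = Dom C g" "Cod C g = Dom C h"
  shows "Comp C (Comp C h g) f = Comp C h (Comp C g f)"
  using Comp_assoc[of f "Dom C f" "Cod C f" g "Cod C g" h "Cod C h"] assms by auto

lemma comp_id [simp]: "f \<in> Mor C \<Longrightarrow> Dom C f = X \<Longrightarrow> Comp C f (Id C X) = f"
  using Comp_Id[of f X "Cod C f"] by auto

lemma id_comp [simp]: "f \<in> Mor C \<Longrightarrow> Cod C f = X \<Longrightarrow> Comp C (Id C X) f = f"
  using Id_Comp[of f "Dom C f" X] by auto

text \<open>
  Composites are kept associated to the right. The lemma applies an equation for \<open>g \<circ> f\<close>
  inside such a composite.
\<close>

lemma comp_reduce:
  assumes "Comp C g f = h" "k \<in> Mor C" "f \<in> Mor C" "g \<in> Mor C" "Cod C k = Dom C f" "Cod C f = Dom C g"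
  shows "Comp C g (Comp C f k) = Comp C h k"
  using assms by auto

lemma is_isoI:
  assumes "f \<in> Mor C" "g \<in> Mor C" "Dom C g = Cod C f" "Cod C g = Dom C f"
    "Comp C g f = Id C (Dom C f)" "Comp C f g = Id C (Cod C f)"
  shows "is_iso C f"
  using assms unfolding is_iso_def by auto

end

context preadditive_category
begin

lemma zero_arr [simp]:
  assumes "X \<in> Ob C" "Y \<in> Ob C"
  shows "Zero C X Y \<in> Mor C" "Dom C (Zero C X Y) = X" "Cod C (Zero C X Y) = Y"
proof -
  interpret comm_group "hom_group C X Y" by (rule Hom_comm_group[OF assms])
  from one_closed show "Zero C X Y \<in> Mor C" "Dom C (Zero C X Y) = X" "Cod C (Zero C X Y) = Y"
    by (auto simp: hom_group_def)
qed

lemma add_arr [simp]: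
  assumes "f \<in> Mor C" "g \<in> Mor C" "Dom C f = Dom C g" "Cod C f = Cod C g"
  shows "Add C f g \<in> Mor C" "Dom C (Add C f g) = Dom C g" "Cod C (Add C f g) = Cod C g"
proof -
  interpret comm_group "hom_group C (Dom C f) (Cod C f)" using assms by (intro Hom_comm_group) auto
  from m_closed[of f g] assms
  show "Add C f g \<in> Mor C" "Dom C (Add C f g) = Dom C g" "Cod C (Add C f g) = Cod C g"
    by (auto simp: hom_group_def)
qed

lemma add_assoc [simp]:
  assumes "f \<in> Mor C" "g \<in> Mor C" "h \<in> Mor C" "Dom C f = Dom C g" "Cod C f = Cod C g"
    "Dom C g = Dom C h" "Cod C g = Cod C h"
  shows "Add C (Add C f g) h = Add C f (Add C g h)"
proof -
  interpret comm_group "hom_group C (Dom C f) (Cod C f)" using assms by (intro Hom_comm_group) auto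
  from m_assoc[of f g h] assms show ?thesis by (auto simp: hom_group_def)
qed

lemma add_commute:
  assumes "f \<in> Mor C" "g \<in> Mor C" "Dom C f = Dom C g" "Cod C f = Cod C g"
  shows "Add C f g = Add C g f"
proof -
  interpret comm_group "hom_group C (Dom C f) (Cod C f)" using assms by (intro Hom_comm_group) auto
  from m_comm[of f g] assms show ?thesis by (auto simp: hom_group_def)
qed

lemma add_zero [simp]:
  assumes "f \<in> Mor C" "Dom C f = X" "Cod C f = Y"
  shows "Add C f (Zero C X Y) = f" "Add C (Zero C X Y) f = f"
proof -
  interpret comm_group "hom_group C X Y" using assms by (intro Hom_comm_group) auto
  from r_one[of f] l_one[of f] assms
  show "Add C f (Zero C X Y) = f" "Add C (Zero C X Y) f = f" by (auto simp: hom_group_def)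
qed

lemma add_left_cancel:
  assumes "Add C f g = Add C f h" "f \<in> Mor C" "g \<in> Mor C" "h \<in> Mor C" "Dom C f = Dom C g"
    "Cod C f = Cod C g" "Dom C f = Dom C h" "Cod C f = Cod C h"
  shows "g = h"
proof -
  interpret comm_group "hom_group C (Dom C f) (Cod C f)" using assms by (intro Hom_comm_group) auto
  have "Units (hom_group C (Dom C f) (Cod C f)) = carrier (hom_group C (Dom C f) (Cod C f))" by (rule Units_eq)
  with Units_l_cancel[of f g h] assms show ?thesis by (auto simp: hom_group_def)
qed

lemma ex_neg:
  assumes "f \<in> Mor C"
  shows "\<exists>f'. f' \<in> Mor C \<and> Dom C f' = Dom C f \<and> Cod C f' = Cod C f \<and>
    Add C f' f = Zero C (Dom C f) (Cod C f)"
proof -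
  interpret comm_group "hom_group C (Dom C f) (Cod C f)" using assms by (intro Hom_comm_group) auto
  from l_inv_ex[of f] assms show ?thesis by (auto simp: hom_group_def)
qed

definition neg :: "'m \<Rightarrow> 'm" where
  "neg f = (SOME f'. f' \<in> Mor C \<and> Dom C f' = Dom C f \<and> Cod C f' = Cod C f \<and>
    Add C f' f = Zero C (Dom C f) (Cod C f))"

lemma neg [simp]:
  assumes "f \<in> Mor C"
  shows "neg f \<in> Mor C" "Dom C (neg f) = Dom C f" "Cod C (neg f) = Cod C f"
    "Add C (neg f) f = Zero C (Dom C f) (Cod C f)" "Add C f (neg f) = Zero C (Dom C f) (Cod C f)"
proof -
  show *: "neg f \<in> Mor C" "Dom C (neg f) = Dom C f" "Cod C (neg f) = Cod C f"
    "Add C (neg f) f = Zero C (Dom C f) (Cod C f)"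
    using someI_ex[OF ex_neg[OF assms]] by (auto simp: neg_def)
  show "Add C f (neg f) = Zero C (Dom C f) (Cod C f)"
    using add_commute[of f "neg f"] * assms by simp
qed

lemma comp_add [simp]:
  assumes "f \<in> Mor C" "f' \<in> Mor C" "g \<in> Mor C" "Dom C f = Dom C f'" "Cod C f = Cod C f'"
    "Cod C f = Dom C g"
  shows "Comp C g (Add C f f') = Add C (Comp C g f) (Comp C g f')"
  using Comp_Add[of f "Dom C f" "Cod C f" f' g "Cod C g"] assms by auto

lemma add_comp [simp]:
  assumes "f \<in> Mor C" "g \<in> Mor C" "g' \<in> Mor C" "Dom C g = Dom C g'" "Cod C g = Cod C g'"
    "Cod C f = Dom C g"
  shows "Comp C (Add C g g') f = Add C (Comp C g f) (Comp C g' f)"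
  using Add_Comp[of f "Dom C f" "Cod C f" g "Cod C g" g'] assms by auto

lemma comp_zero [simp]:
  assumes "f \<in> Mor C" "Dom C f = Y" "X \<in> Ob C"
  shows "Comp C f (Zero C X Y) = Zero C X (Cod C f)"
proof (rule add_left_cancel)
  let ?z = "Comp C f (Zero C X Y)"
  have Y: "Y \<in> Ob C" using assms by auto
  show "Add C ?z ?z = Add C ?z (Zero C X (Cod C f))"
    using comp_add[of "Zero C X Y" "Zero C X Y" f] assms Y by simp
qed (use assms in auto)

lemma zero_comp [simp]:
  assumes "f \<in> Mor C" "Cod C f = X" "Y \<in> Ob C"
  shows "Comp C (Zero C X Y) f = Zero C (Dom C f) Y"
proof (rule add_left_cancel)
  let ?z = "Comp C (Zero C X Y) f"
  have X: "X \<in> Ob C" using assms by auto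
  show "Add C ?z ?z = Add C ?z (Zero C (Dom C f) Y)"
    using add_comp[of f "Zero C X Y" "Zero C X Y"] assms X by simp
qed (use assms in auto)

lemma comp_neg [simp]:
  assumes "f \<in> Mor C" "g \<in> Mor C" "Cod C f = Dom C g"
  shows "Comp C g (neg f) = neg (Comp C g f)"
proof (rule add_left_cancel)
  show "Add C (Comp C g f) (Comp C g (neg f)) = Add C (Comp C g f) (neg (Comp C g f))"
    using comp_add[of f "neg f" g] assms by simp
qed (use assms in auto)

lemma neg_comp [simp]:
  assumes "f \<in> Mor C" "g \<in> Mor C" "Cod C f = Dom C g"
  shows "Comp C (neg g) f = neg (Comp C g f)"
proof (rule add_left_cancel)
  show "Add C (Comp C g f) (Comp C (neg g) f) = Add C (Comp C g f) (neg (Comp C g f))"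
    using add_comp[of f g "neg g"] assms by simp
qed (use assms in auto)

lemma add_neg_cancel [simp]:
  assumes "f \<in> Mor C" "g \<in> Mor C" "Dom C f = Dom C g" "Cod C f = Cod C g"
  shows "Add C f (Add C (neg f) g) = g" "Add C (neg f) (Add C f g) = g"
  using add_assoc[of f "neg f" g] add_assoc[of "neg f" f g] assms by auto

section \<open>Universal properties\<close>

lemma is_kernelD:
  assumes "is_kernel C i p"
  shows "i \<in> Mor C" "p \<in> Mor C" "Cod C i = Dom C p" "Comp C p i = Zero C (Dom C i) (Cod C p)"
  using assms by (auto simp: is_kernel_def)

lemma kernel_lift:
  assumes "is_kernel C i p" "h \<in> Mor C" "Cod C h = Dom C p" "Comp C p h = Zero C (Dom C h) (Cod C p)"
  obtains k where "k \<in> Mor C" "Dom C k = Dom C h" "Cod C k = Dom C i" "Comp C i k = h"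
proof -
  have "\<forall>h \<in> Mor C. Cod C h = Dom C p \<and> Comp C p h = Zero C (Dom C h) (Cod C p) \<longrightarrow>
        (\<exists>!k. k \<in> Hom C (Dom C h) (Dom C i) \<and> Comp C i k = h)"
    using assms(1) unfolding is_kernel_def by blast
  from this[rule_format, of h] obtain k where "k \<in> Hom C (Dom C h) (Dom C i)" "Comp C i k = h"
    using assms by blast
  then show thesis using that by auto
qed

lemma kernel_mono:
  assumes "is_kernel C i p" "k \<in> Mor C" "k' \<in> Mor C" "Dom C k = Dom C k'" "Cod C k = Dom C i"
    "Cod C k' = Dom C i" "Comp C i k = Comp C i k'"
  shows "k = k'"
proof -
  note i = is_kernelD[OF assms(1)]
  have z: "Comp C p (Comp C i k) = Zero C (Dom C k) (Cod C p)"
    using comp_reduce[OF i(4), of k] i assms by simp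
  have "\<forall>h \<in> Mor C. Cod C h = Dom C p \<and> Comp C p h = Zero C (Dom C h) (Cod C p) \<longrightarrow>
        (\<exists>!k. k \<in> Hom C (Dom C h) (Dom C i) \<and> Comp C i k = h)"
    using assms(1) unfolding is_kernel_def by blast
  from this[rule_format, of "Comp C i k"]
  have "\<exists>!l. l \<in> Hom C (Dom C k) (Dom C i) \<and> Comp C i l = Comp C i k"
    using i assms z by auto
  then show ?thesis using assms by auto
qed

lemma is_kernelI:
  assumes "i \<in> Mor C" "p \<in> Mor C" "Cod C i = Dom C p" "Comp C p i = Zero C (Dom C i) (Cod C p)"
    and "\<And>h. h \<in> Mor C \<Longrightarrow> Cod C h = Dom C p \<Longrightarrow> Comp C p h = Zero C (Dom C h) (Cod C p) \<Longrightarrow>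
      \<exists>k. k \<in> Mor C \<and> Dom C k = Dom C h \<and> Cod C k = Dom C i \<and> Comp C i k = h"
    and "\<And>k k'. k \<in> Mor C \<Longrightarrow> k' \<in> Mor C \<Longrightarrow> Dom C k = Dom C k' \<Longrightarrow> Cod C k = Dom C i \<Longrightarrow>
      Cod C k' = Dom C i \<Longrightarrow> Comp C i k = Comp C i k' \<Longrightarrow> k = k'"
  shows "is_kernel C i p"
  unfolding is_kernel_def
proof (intro conjI ballI impI)
  fix h assume h: "h \<in> Mor C" "Cod C h = Dom C p \<and> Comp C p h = Zero C (Dom C h) (Cod C p)"
  then obtain k where "k \<in> Mor C \<and> Dom C k = Dom C h \<and> Cod C k = Dom C i \<and> Comp C i k = h"
    using assms(5) by blast
  then show "\<exists>!k. k \<in> Hom C (Dom C h) (Dom C i) \<and> Comp C i k = h"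
    by (intro ex1I[of _ k]) (auto intro: assms(6))
qed (use assms in auto)

lemma is_cokernelD:
  assumes "is_cokernel C p i"
  shows "i \<in> Mor C" "p \<in> Mor C" "Cod C i = Dom C p" "Comp C p i = Zero C (Dom C i) (Cod C p)"
  using assms by (auto simp: is_cokernel_def)

lemma cokernel_desc:
  assumes "is_cokernel C p i" "h \<in> Mor C" "Dom C h = Dom C p" "Comp C h i = Zero C (Dom C i) (Cod C h)"
  obtains k where "k \<in> Mor C" "Dom C k = Cod C p" "Cod C k = Cod C h" "Comp C k p = h"
proof -
  have "\<forall>h \<in> Mor C. Dom C h = Cod C i \<and> Comp C h i = Zero C (Dom C i) (Cod C h) \<longrightarrow>
        (\<exists>!k. k \<in> Hom C (Cod C p) (Cod C h) \<and> Comp C k p = h)"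
    using assms(1) unfolding is_cokernel_def by blast
  from this[rule_format, of h] obtain k where "k \<in> Hom C (Cod C p) (Cod C h)" "Comp C k p = h"
    using assms is_cokernelD[OF assms(1)] by auto
  then show thesis using that by auto
qed

lemma cokernel_epi:
  assumes "is_cokernel C p i" "k \<in> Mor C" "k' \<in> Mor C" "Cod C k = Cod C k'" "Dom C k = Cod C p"
    "Dom C k' = Cod C p" "Comp C k p = Comp C k' p"
  shows "k = k'"
proof -
  note i = is_cokernelD[OF assms(1)]
  have z: "Comp C (Comp C k p) i = Zero C (Dom C i) (Cod C k)"
    using i assms(2,5) by simp
  have "\<forall>h \<in> Mor C. Dom C h = Cod C i \<and> Comp C h i = Zero C (Dom C i) (Cod C h) \<longrightarrow>
        (\<exists>!k. k \<in> Hom C (Cod C p) (Cod C h) \<and> Comp C k p = h)"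
    using assms(1) unfolding is_cokernel_def by blast
  from this[rule_format, of "Comp C k p"]
  have "\<exists>!l. l \<in> Hom C (Cod C p) (Cod C k) \<and> Comp C l p = Comp C k p"
    using i assms z by auto
  then show ?thesis using assms by auto
qed

lemma is_cokernelI:
  assumes "i \<in> Mor C" "p \<in> Mor C" "Cod C i = Dom C p" "Comp C p i = Zero C (Dom C i) (Cod C p)"
    and "\<And>h. h \<in> Mor C \<Longrightarrow> Dom C h = Dom C p \<Longrightarrow> Comp C h i = Zero C (Dom C i) (Cod C h) \<Longrightarrow>
      \<exists>k. k \<in> Mor C \<and> Dom C k = Cod C p \<and> Cod C k = Cod C h \<and> Comp C k p = h"
    and "\<And>k k'. k \<in> Mor C \<Longrightarrow> k' \<in> Mor C \<Longrightarrow> Cod C k = Cod C k' \<Longrightarrow> Dom C k = Cod C p \<Longrightarrow>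
      Dom C k' = Cod C p \<Longrightarrow> Comp C k p = Comp C k' p \<Longrightarrow> k = k'"
  shows "is_cokernel C p i"
  unfolding is_cokernel_def
proof (intro conjI ballI impI)
  fix h assume h: "h \<in> Mor C" "Dom C h = Cod C i \<and> Comp C h i = Zero C (Dom C i) (Cod C h)"
  then obtain k where "k \<in> Mor C \<and> Dom C k = Cod C p \<and> Cod C k = Cod C h \<and> Comp C k p = h"
    using assms(3,5) by auto
  then show "\<exists>!k. k \<in> Hom C (Cod C p) (Cod C h) \<and> Comp C k p = h"
    by (intro ex1I[of _ k]) (auto intro: assms(6))
qed (use assms in auto)

lemma is_pullbackD:
  assumes "is_pullback C p f p' f'"
  shows "p \<in> Mor C" "f \<in> Mor C" "p' \<in> Mor C" "f' \<in> Mor C"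
     "Cod C p = Cod C f" "Cod C p' = Dom C f" "Cod C f' = Dom C p" "Dom C f' = Dom C p'"
     "Comp C f p' = Comp C p f'"
  using assms by (auto simp: is_pullback_def)

lemma pullback_lift:
  assumes "is_pullback C p f p' f'" "u \<in> Mor C" "v \<in> Mor C" "Cod C u = Dom C f" "Cod C v = Dom C p"
    "Dom C u = Dom C v" "Comp C f u = Comp C p v"
  obtains k where "k \<in> Mor C" "Dom C k = Dom C u" "Cod C k = Dom C p'" "Comp C p' k = u" "Comp C f' k = v"
proof -
  have "\<forall>u \<in> Mor C. \<forall>v \<in> Mor C.
        Cod C u = Dom C f \<and> Cod C v = Dom C p \<and> Dom C u = Dom C v \<and> Comp C f u = Comp C p v \<longrightarrow>
        (\<exists>!k. k \<in> Hom C (Dom C u) (Dom C p') \<and> Comp C p' k = u \<and> Comp C f' k = v)"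
    using assms(1) unfolding is_pullback_def by blast
  from this[rule_format, of u v] obtain k where
    "k \<in> Hom C (Dom C u) (Dom C p')" "Comp C p' k = u" "Comp C f' k = v"
    using assms by blast
  then show thesis using that by auto
qed

lemma pullback_eq:
  assumes "is_pullback C p f p' f'" "k \<in> Mor C" "k' \<in> Mor C" "Dom C k = Dom C k'" "Cod C k = Dom C p'"
    "Cod C k' = Dom C p'" "Comp C p' k = Comp C p' k'" "Comp C f' k = Comp C f' k'"
  shows "k = k'"
proof -
  note p = is_pullbackD[OF assms(1)]
  let ?u = "Comp C p' k" and ?v = "Comp C f' k"
  have z: "Comp C f ?u = Comp C p ?v"
    using comp_reduce[OF p(9), of k] p assms by simp
  have "\<forall>u \<in> Mor C. \<forall>v \<in> Mor C.
        Cod C u = Dom C f \<and> Cod C v = Dom C p \<and> Dom C u = Dom C v \<and> Comp C f u = Comp C p v \<longrightarrow>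
        (\<exists>!k. k \<in> Hom C (Dom C u) (Dom C p') \<and> Comp C p' k = u \<and> Comp C f' k = v)"
    using assms(1) unfolding is_pullback_def by blast
  from this[rule_format, of ?u ?v]
  have "\<exists>!l. l \<in> Hom C (Dom C ?u) (Dom C p') \<and> Comp C p' l = ?u \<and> Comp C f' l = ?v"
    using z p assms by auto
  then show ?thesis using assms p by auto
qed

lemma is_pullbackI:
  assumes "p \<in> Mor C" "f \<in> Mor C" "p' \<in> Mor C" "f' \<in> Mor C"
     "Cod C p = Cod C f" "Cod C p' = Dom C f" "Cod C f' = Dom C p" "Dom C f' = Dom C p'"
     "Comp C f p' = Comp C p f'"
    and "\<And>u v. u \<in> Mor C \<Longrightarrow> v \<in> Mor C \<Longrightarrow> Cod C u = Dom C f \<Longrightarrow> Cod C v = Dom C p \<Longrightarrow> Dom C u = Dom C v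
      \<Longrightarrow> Comp C f u = Comp C p v \<Longrightarrow>
      \<exists>k. k \<in> Mor C \<and> Dom C k = Dom C v \<and> Cod C k = Dom C p' \<and> Comp C p' k = u \<and> Comp C f' k = v"
    and "\<And>k k'. k \<in> Mor C \<Longrightarrow> k' \<in> Mor C \<Longrightarrow> Dom C k = Dom C k' \<Longrightarrow> Cod C k = Dom C p' \<Longrightarrow>
      Cod C k' = Dom C p' \<Longrightarrow> Comp C p' k = Comp C p' k' \<Longrightarrow> Comp C f' k = Comp C f' k' \<Longrightarrow> k = k'"
  shows "is_pullback C p f p' f'"
  unfolding is_pullback_def
proof (intro conjI ballI impI)
  fix u v assume uv: "u \<in> Mor C" "v \<in> Mor C"
    "Cod C u = Dom C f \<and> Cod C v = Dom C p \<and> Dom C u = Dom C v \<and> Comp C f u = Comp C p v"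
  then obtain k where "k \<in> Mor C \<and> Dom C k = Dom C v \<and> Cod C k = Dom C p' \<and> Comp C p' k = u \<and> Comp C f' k = v"
    using assms(10) by blast
  then show "\<exists>!k. k \<in> Hom C (Dom C u) (Dom C p') \<and> Comp C p' k = u \<and> Comp C f' k = v"
    using uv by (intro ex1I[of _ k]) (auto intro: assms(11))
qed (use assms in auto)

lemma is_pushoutD:
  assumes "is_pushout C i f i' f'"
  shows "i \<in> Mor C" "f \<in> Mor C" "i' \<in> Mor C" "f' \<in> Mor C"
     "Dom C i = Dom C f" "Dom C i' = Cod C f" "Dom C f' = Cod C i" "Cod C f' = Cod C i'"
     "Comp C i' f = Comp C f' i"
  using assms by (auto simp: is_pushout_def)

lemma pushout_desc:
  assumes "is_pushout C i f i' f'" "u \<in> Mor C" "v \<in> Mor C" "Dom C u = Cod C f" "Dom C v = Cod C i"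
    "Cod C u = Cod C v" "Comp C u f = Comp C v i"
  obtains k where "k \<in> Mor C" "Dom C k = Cod C i'" "Cod C k = Cod C u" "Comp C k i' = u" "Comp C k f' = v"
proof -
  have "\<forall>u \<in> Mor C. \<forall>v \<in> Mor C.
        Dom C u = Cod C f \<and> Dom C v = Cod C i \<and> Cod C u = Cod C v \<and> Comp C u f = Comp C v i \<longrightarrow>
        (\<exists>!k. k \<in> Hom C (Cod C i') (Cod C u) \<and> Comp C k i' = u \<and> Comp C k f' = v)"
    using assms(1) unfolding is_pushout_def by blast
  from this[rule_format, of u v] obtain k where
    "k \<in> Hom C (Cod C i') (Cod C u)" "Comp C k i' = u" "Comp C k f' = v"
    using assms by blast
  then show thesis using that by auto
qed

lemma pushout_eq:
  assumes "is_pushout C i f i' f'" "k \<in> Mor C" "k' \<in> Mor C" "Cod C k = Cod C k'" "Dom C k = Cod C i'"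
    "Dom C k' = Cod C i'" "Comp C k i' = Comp C k' i'" "Comp C k f' = Comp C k' f'"
  shows "k = k'"
proof -
  note p = is_pushoutD[OF assms(1)]
  let ?u = "Comp C k i'" and ?v = "Comp C k f'"
  have z: "Comp C ?u f = Comp C ?v i"
    using p assms(2,5) by simp
  have "\<forall>u \<in> Mor C. \<forall>v \<in> Mor C.
        Dom C u = Cod C f \<and> Dom C v = Cod C i \<and> Cod C u = Cod C v \<and> Comp C u f = Comp C v i \<longrightarrow>
        (\<exists>!k. k \<in> Hom C (Cod C i') (Cod C u) \<and> Comp C k i' = u \<and> Comp C k f' = v)"
    using assms(1) unfolding is_pushout_def by blast
  from this[rule_format, of ?u ?v]
  have "\<exists>!l. l \<in> Hom C (Cod C i') (Cod C ?u) \<and> Comp C l i' = ?u \<and> Comp C l f' = ?v"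
    using z p assms by auto
  then show ?thesis using assms p by auto
qed

lemma is_pushoutI:
  assumes "i \<in> Mor C" "f \<in> Mor C" "i' \<in> Mor C" "f' \<in> Mor C"
     "Dom C i = Dom C f" "Dom C i' = Cod C f" "Dom C f' = Cod C i" "Cod C f' = Cod C i'"
     "Comp C i' f = Comp C f' i"
    and "\<And>u v. u \<in> Mor C \<Longrightarrow> v \<in> Mor C \<Longrightarrow> Dom C u = Cod C f \<Longrightarrow> Dom C v = Cod C i \<Longrightarrow> Cod C u = Cod C v
      \<Longrightarrow> Comp C u f = Comp C v i \<Longrightarrow>
      \<exists>k. k \<in> Mor C \<and> Dom C k = Cod C i' \<and> Cod C k = Cod C v \<and> Comp C k i' = u \<and> Comp C k f' = v"
    and "\<And>k k'. k \<in> Mor C \<Longrightarrow> k' \<in> Mor C \<Longrightarrow> Cod C k = Cod C k' \<Longrightarrow> Dom C k = Cod C i' \<Longrightarrow>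
      Dom C k' = Cod C i' \<Longrightarrow> Comp C k i' = Comp C k' i' \<Longrightarrow> Comp C k f' = Comp C k' f' \<Longrightarrow> k = k'"
  shows "is_pushout C i f i' f'"
  unfolding is_pushout_def
proof (intro conjI ballI impI)
  fix u v assume uv: "u \<in> Mor C" "v \<in> Mor C"
    "Dom C u = Cod C f \<and> Dom C v = Cod C i \<and> Cod C u = Cod C v \<and> Comp C u f = Comp C v i"
  then obtain k where "k \<in> Mor C \<and> Dom C k = Cod C i' \<and> Cod C k = Cod C v \<and> Comp C k i' = u \<and> Comp C k f' = v"
    using assms(10) by blast
  then show "\<exists>!k. k \<in> Hom C (Cod C i') (Cod C u) \<and> Comp C k i' = u \<and> Comp C k f' = v"
    using uv by (intro ex1I[of _ k]) (auto intro: assms(11))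
qed (use assms in auto)

end

section \<open>Exact categories\<close>

text \<open>
  \<open>h\<close> factors through \<open>g\<close>, that is, \<open>h\<close> lies in the image of \<open>Hom(-, g)\<close>.
\<close>

definition factors :: "('o, 'm) preadd_cat \<Rightarrow> 'm \<Rightarrow> 'm \<Rightarrow> bool" where
  "factors C h g \<longleftrightarrow> (\<exists>k \<in> Hom C (Dom C h) (Dom C g). h = Comp C g k)"

lemma factorsE:
  assumes "factors C h g"
  obtains k where "k \<in> Mor C" "Dom C k = Dom C h" "Cod C k = Dom C g" "h = Comp C g k"
  using assms by (auto simp: factors_def)

lemma factorsI: "k \<in> Mor C \<Longrightarrow> Dom C k = Dom C h \<Longrightarrow> Cod C k = Dom C g \<Longrightarrow> h = Comp C g k \<Longrightarrow> factors C h g"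
  by (auto simp: factors_def)

lemma (in category) factors_comp:
  assumes "factors C h g" "a \<in> Mor C" "Cod C a = Dom C h" "g \<in> Mor C"
  shows "factors C (Comp C h a) g"
proof -
  obtain k where k: "k \<in> Mor C" "Dom C k = Dom C h" "Cod C k = Dom C g" "h = Comp C g k"
    using assms(1) by (rule factorsE)
  show ?thesis by (rule factorsI[of "Comp C k a"]) (use k assms in auto)
qed

lemma (in category) factors_trans:
  assumes "factors C f g" "factors C g h" "h \<in> Mor C"
  shows "factors C f h"
proof -
  obtain k where k: "k \<in> Mor C" "Dom C k = Dom C f" "Cod C k = Dom C g" "f = Comp C g k"
    using assms(1) by (rule factorsE)
  obtain l where l: "l \<in> Mor C" "Dom C l = Dom C g" "Cod C l = Dom C h" "g = Comp C h l"
    using assms(2) by (rule factorsE)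
  have "f = Comp C (Comp C h l) k" using k(4) l(4) by simp
  then have "f = Comp C h (Comp C l k)" using k(1,3) l(1-3) assms(3) by simp
  then show ?thesis using k(1-3) l(1-3) by (intro factorsI[of "Comp C l k"]) simp_all
qed

lemma (in category) factors_self:
  "g \<in> Mor C \<Longrightarrow> k \<in> Mor C \<Longrightarrow> Cod C k = Dom C g \<Longrightarrow> factors C (Comp C g k) g"
  by (rule factorsI[of k]) simp_all

context additive_category
begin

lemma biproductD:
  assumes "is_biproduct C X Y B i j p q"
  shows "i \<in> Mor C" "j \<in> Mor C" "p \<in> Mor C" "q \<in> Mor C"
    "Dom C i = X" "Dom C j = Y" "Dom C p = B" "Dom C q = B"
    "Cod C i = B" "Cod C j = B" "Cod C p = X" "Cod C q = Y"
    "Comp C p i = Id C X" "Comp C q j = Id C Y" "Comp C q i = Zero C X Y" "Comp C p j = Zero C Y X"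
    "Add C (Comp C i p) (Comp C j q) = Id C B"
  using assms by (auto simp: is_biproduct_def)

lemma biproduct_obj:
  assumes "is_biproduct C X Y B i j p q"
  shows "X \<in> Ob C" "Y \<in> Ob C" "B \<in> Ob C"
  using biproductD[OF assms] Dom_in by metis+

lemma biproduct_ext:
  assumes "is_biproduct C X Y B i j p q" "k \<in> Mor C" "Cod C k = B"
  shows "Add C (Comp C i (Comp C p k)) (Comp C j (Comp C q k)) = k"
proof -
  note b = biproductD[OF assms(1)]
  have "Comp C (Add C (Comp C i p) (Comp C j q)) k = Comp C (Id C B) k" by (simp only: b)
  then show ?thesis using b(1-12) assms(2,3) by simp
qed

lemma biproduct_eq:
  assumes "is_biproduct C X Y B i j p q" "k \<in> Mor C" "k' \<in> Mor C" "Cod C k = B" "Cod C k' = B"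
    "Comp C p k = Comp C p k'" "Comp C q k = Comp C q k'"
  shows "k = k'"
  using biproduct_ext[OF assms(1), of k] biproduct_ext[OF assms(1), of k'] assms(2-) by metis

lemma biproduct_swap:
  assumes "is_biproduct C X Y B i j p q"
  shows "is_biproduct C Y X B j i q p"
  using biproductD[OF assms] add_commute[of "Comp C i p" "Comp C j q"] by (auto simp: is_biproduct_def)

text \<open>
  This is the biproduct transported along the shear of \<open>X \<oplus> Y\<close> with matrix \<open>(1, k; 0, 1)\<close>. Replacing the
  structure maps of a biproduct takes the place of composing with automorphisms of \<open>B\<close>.
\<close>

lemma biproduct_twist:
  assumes b: "is_biproduct C X Y B i j p q" and k: "k \<in> Mor C" "Dom C k = Y" "Cod C k = X"
  shows "is_biproduct C X Y B i (Add C j (neg (Comp C i k))) (Add C p (Comp C k q)) q"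
proof -
  note b = biproductD[OF b] biproduct_obj[OF b]
  have 1: "Comp C p (Comp C i k) = k" "Comp C q (Comp C i k) = Zero C Y Y"
    using comp_reduce[OF b(13), of k] comp_reduce[OF b(15), of k] b k by simp_all
  have 2: "Comp C (Add C j (neg (Comp C i k))) q = Add C (Comp C j q) (neg (Comp C i (Comp C k q)))"
    using b(1-12) k by simp
  have "Add C (Comp C i (Add C p (Comp C k q))) (Comp C (Add C j (neg (Comp C i k))) q) =
    Add C (Add C (Comp C i p) (Comp C i (Comp C k q))) (Add C (neg (Comp C i (Comp C k q))) (Comp C j q))"
    unfolding 2 using b(1-12) k add_commute[of "Comp C j q" "neg (Comp C i (Comp C k q))"] by simp
  also have "\<dots> = Id C B"
    using b k by simp
  finally have 3: "Add C (Comp C i (Add C p (Comp C k q))) (Comp C (Add C j (neg (Comp C i k))) q) = Id C B" .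
  have z: "neg (Zero C Y Y) = Zero C Y Y"
    using neg(4)[of "Zero C Y Y"] b by simp
  show ?thesis
    unfolding is_biproduct_def using b k 1 3 z by simp
qed

lemma iso_id: "X \<in> Ob C \<Longrightarrow> is_iso C (Id C X)"
  by (rule is_isoI[of _ "Id C X"]) simp_all

end

locale exact_category = additive_category C for C :: "('o, 'm) preadd_cat" +
  fixes E :: "('m \<times> 'm) set"
  assumes exact: "exact_structure C E"
begin

lemma kcp: "(i, p) \<in> E \<Longrightarrow> kernel_cokernel_pair C i p"
  using exact by (auto simp: exact_structure_def)

lemma iso_closed:
  assumes "(i, p) \<in> E" "kernel_cokernel_pair C i' p'" "isomorphic_pairs C (i, p) (i', p')"
  shows "(i', p') \<in> E"
proof -
  have "\<forall>\<delta> \<in> E. \<forall>i' p'. kernel_cokernel_pair C i' p' \<and> isomorphic_pairs C \<delta> (i', p') \<longrightarrow> (i', p') \<in> E"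
    using exact unfolding exact_structure_def by (elim conjE)
  then show ?thesis using assms by blast
qed

lemma id_inflation: "X \<in> Ob C \<Longrightarrow> inflation E (Id C X)"
  and id_deflation: "X \<in> Ob C \<Longrightarrow> deflation E (Id C X)"
  using exact unfolding exact_structure_def by simp_all

lemma inflation_comp:
  "inflation E i \<Longrightarrow> inflation E j \<Longrightarrow> Cod C i = Dom C j \<Longrightarrow> inflation E (Comp C j i)"
  and deflation_comp:
  "deflation E p \<Longrightarrow> deflation E q \<Longrightarrow> Cod C p = Dom C q \<Longrightarrow> deflation E (Comp C q p)"
  using exact unfolding exact_structure_def by simp_all

lemma pushout_ex:
  "inflation E i \<Longrightarrow> f \<in> Mor C \<Longrightarrow> Dom C f = Dom C i \<Longrightarrow> \<exists>i' f'. is_pushout C i f i' f' \<and> inflation E i'"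
  and pullback_ex:
  "deflation E p \<Longrightarrow> f \<in> Mor C \<Longrightarrow> Cod C f = Cod C p \<Longrightarrow> \<exists>p' f'. is_pullback C p f p' f' \<and> deflation E p'"
  using exact unfolding exact_structure_def by simp_all

lemma conflation_kernel: "(i, p) \<in> E \<Longrightarrow> is_kernel C i p"
  and conflation_cokernel: "(i, p) \<in> E \<Longrightarrow> is_cokernel C p i"
  using kcp by (auto simp: kernel_cokernel_pair_def)

lemma deflation_arr: "deflation E p \<Longrightarrow> p \<in> Mor C"
  unfolding deflation_def using conflation_kernel is_kernelD(2) by blast

lemma conflation_iso_cod:
  assumes E: "(i, p) \<in> E" and p': "is_cokernel C p' i"
  shows "(i, p') \<in> E"
proof -
  note k = conflation_kernel[OF E] and c = conflation_cokernel[OF E]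
  note kd = is_kernelD[OF k] and cd = is_cokernelD[OF p']
  obtain a where a: "a \<in> Mor C" "Dom C a = Cod C p" "Cod C a = Cod C p'" "Comp C a p = p'"
    using cokernel_desc[OF c, of p'] cd kd by auto
  obtain b where b: "b \<in> Mor C" "Dom C b = Cod C p'" "Cod C b = Cod C p" "Comp C b p' = p"
    using cokernel_desc[OF p', of p] cd kd by auto
  have ba: "Comp C b a = Id C (Cod C p)"
    by (rule cokernel_epi[OF c]) (use a b kd in auto)
  have ab: "Comp C a b = Id C (Cod C p')"
    by (rule cokernel_epi[OF p']) (use a b cd in auto)
  have "is_kernel C i p'"
  proof (rule is_kernelI)
    fix h assume h: "h \<in> Mor C" "Cod C h = Dom C p'" "Comp C p' h = Zero C (Dom C h) (Cod C p')"
    have "Comp C p h = Zero C (Dom C h) (Cod C p)"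
      using comp_reduce[OF b(4), of h] b h cd by simp
    then show "\<exists>k. k \<in> Mor C \<and> Dom C k = Dom C h \<and> Cod C k = Dom C i \<and> Comp C i k = h"
      using kernel_lift[OF k, of h] h cd kd by metis
  qed (use cd in \<open>auto intro: kernel_mono[OF k]\<close>)
  moreover have "is_iso C a" by (rule is_isoI[of a b]) (use a b ab ba in simp_all)
  then have "isomorphic_pairs C (i, p) (i, p')"
    unfolding isomorphic_pairs_def prod.case
    using a kd cd
    by (intro bexI[of _ "Id C (Dom C i)"] bexI[of _ "Id C (Cod C i)"] bexI[of _ a] conjI iso_id) simp_all
  ultimately show ?thesis
    using iso_closed[OF E] p' by (auto simp: kernel_cokernel_pair_def)
qed

lemma conflation_iso_mid:
  assumes E: "(i, p) \<in> E" and a: "a \<in> Mor C" "Cod C a = Dom C p"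
    and b: "b \<in> Mor C" "Dom C b = Dom C p" "Cod C b = Dom C a"
    and ab: "Comp C a b = Id C (Dom C p)" and ba: "Comp C b a = Id C (Dom C a)"
  shows "(Comp C b i, Comp C p a) \<in> E"
proof -
  note k = conflation_kernel[OF E] and c = conflation_cokernel[OF E]
  note kd = is_kernelD[OF k]
  have aba: "Comp C a (Comp C b h) = h" if "h \<in> Mor C" "Cod C h = Dom C p" for h
    using comp_reduce[OF ab, of h] that a b by simp
  have bab: "Comp C b (Comp C a h) = h" if "h \<in> Mor C" "Cod C h = Dom C a" for h
    using comp_reduce[OF ba, of h] that a b by simp
  have "is_kernel C (Comp C b i) (Comp C p a)"
  proof (rule is_kernelI)
    fix h assume h: "h \<in> Mor C" "Cod C h = Dom C (Comp C p a)"
      "Comp C (Comp C p a) h = Zero C (Dom C h) (Cod C (Comp C p a))"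
    have "Comp C p (Comp C a h) = Zero C (Dom C h) (Cod C p)" using h a kd by simp
    then obtain l where l: "l \<in> Mor C" "Dom C l = Dom C h" "Cod C l = Dom C i" "Comp C i l = Comp C a h"
      using kernel_lift[OF k, of "Comp C a h"] h a kd by auto
    then have "Comp C (Comp C b i) l = h" using bab[of h] h a b kd by simp
    then show "\<exists>k. k \<in> Mor C \<and> Dom C k = Dom C h \<and> Cod C k = Dom C (Comp C b i) \<and> Comp C (Comp C b i) k = h"
      using l kd b by auto
  next
    fix l l' assume l: "l \<in> Mor C" "l' \<in> Mor C" "Dom C l = Dom C l'" "Cod C l = Dom C (Comp C b i)"
      "Cod C l' = Dom C (Comp C b i)" "Comp C (Comp C b i) l = Comp C (Comp C b i) l'"
    then have "Comp C a (Comp C b (Comp C i l)) = Comp C a (Comp C b (Comp C i l'))"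
      using kd b by simp
    then have "Comp C i l = Comp C i l'" using aba l kd b by simp
    then show "l = l'" using kernel_mono[OF k] l kd b by simp
  qed (use kd a b aba in auto)
  moreover have "is_cokernel C (Comp C p a) (Comp C b i)"
  proof (rule is_cokernelI)
    fix h assume h: "h \<in> Mor C" "Dom C h = Dom C (Comp C p a)"
      "Comp C h (Comp C b i) = Zero C (Dom C (Comp C b i)) (Cod C h)"
    have "Comp C (Comp C h b) i = Zero C (Dom C i) (Cod C h)" using h a b kd by simp
    then obtain l where l: "l \<in> Mor C" "Dom C l = Cod C p" "Cod C l = Cod C h" "Comp C l p = Comp C h b"
      using cokernel_desc[OF c, of "Comp C h b"] h a b kd by auto
    have "Comp C l (Comp C p a) = h"
      using comp_reduce[OF l(4), of a] h a b kd l ba by simp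
    then show "\<exists>k. k \<in> Mor C \<and> Dom C k = Cod C (Comp C p a) \<and> Cod C k = Cod C h \<and> Comp C k (Comp C p a) = h"
      using l kd a by auto
  next
    fix l l' assume l: "l \<in> Mor C" "l' \<in> Mor C" "Cod C l = Cod C l'" "Dom C l = Cod C (Comp C p a)"
      "Dom C l' = Cod C (Comp C p a)" "Comp C l (Comp C p a) = Comp C l' (Comp C p a)"
    have "Comp C (Comp C m (Comp C p a)) b = Comp C m p" if "m \<in> Mor C" "Dom C m = Cod C p" for m
      using that ab kd a b by simp
    from this[of l] this[of l'] have "Comp C l p = Comp C l' p" using l kd a by simp
    then show "l = l'" using cokernel_epi[OF c] l kd a by simp
  qed (use kd a b aba in auto)
  moreover have "is_iso C b" by (rule is_isoI[of b a]) (use a b ab ba in simp_all)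
  then have "isomorphic_pairs C (i, p) (Comp C b i, Comp C p a)"
    unfolding isomorphic_pairs_def prod.case
    using a b ab ba kd
    by (intro bexI[of _ "Id C (Dom C i)"] bexI[of _ b] bexI[of _ "Id C (Cod C p)"] conjI iso_id) simp_all
  ultimately show ?thesis
    using iso_closed[OF E] by (auto simp: kernel_cokernel_pair_def)
qed

lemma deflation_pullback:
  assumes pb: "is_pullback C p f p' f'" and p: "deflation E p"
  shows "deflation E p'"
proof -
  note d = is_pullbackD[OF pb]
  obtain p2 f2 where pb2: "is_pullback C p f p2 f2" and p2: "deflation E p2"
    using pullback_ex[OF p d(2)] d by auto
  note d2 = is_pullbackD[OF pb2]
  obtain a where a: "a \<in> Mor C" "Dom C a = Dom C p'" "Cod C a = Dom C p2" "Comp C p2 a = p'" "Comp C f2 a = f'"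
    using pullback_lift[OF pb2 d(3,4)] d d2 by auto
  obtain b where b: "b \<in> Mor C" "Dom C b = Dom C p2" "Cod C b = Dom C p'" "Comp C p' b = p2" "Comp C f' b = f2"
    using pullback_lift[OF pb d2(3,4)] d d2 by auto
  have ab: "Comp C a b = Id C (Dom C p2)"
    by (rule pullback_eq[OF pb2]) (use a b d d2 comp_reduce[OF a(4), of b] comp_reduce[OF a(5), of b] in auto)
  have ba: "Comp C b a = Id C (Dom C p')"
    by (rule pullback_eq[OF pb]) (use a b d d2 comp_reduce[OF b(4), of a] comp_reduce[OF b(5), of a] in auto)
  obtain i where "(i, p2) \<in> E" using p2 by (auto simp: deflation_def)
  from conflation_iso_mid[OF this, of a b] show ?thesis
    using a b ab ba by (auto simp: deflation_def)
qed

lemma inflation_pushout: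
  assumes po: "is_pushout C i f i' f'" and i: "inflation E i"
  shows "inflation E i'"
proof -
  note d = is_pushoutD[OF po]
  obtain i2 f2 where po2: "is_pushout C i f i2 f2" and i2: "inflation E i2"
    using pushout_ex[OF i d(2)] d by auto
  note d2 = is_pushoutD[OF po2]
  obtain a where a: "a \<in> Mor C" "Dom C a = Cod C i2" "Cod C a = Cod C i'" "Comp C a i2 = i'" "Comp C a f2 = f'"
    using pushout_desc[OF po2 d(3,4)] d d2 by auto
  obtain b where b: "b \<in> Mor C" "Dom C b = Cod C i'" "Cod C b = Cod C i2" "Comp C b i' = i2" "Comp C b f' = f2"
    using pushout_desc[OF po d2(3,4)] d d2 by auto
  have ba: "Comp C b a = Id C (Cod C i2)"
    by (rule pushout_eq[OF po2]) (use a b d d2 in auto)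
  have ab: "Comp C a b = Id C (Cod C i')"
    by (rule pushout_eq[OF po]) (use a b d d2 in auto)
  obtain p where p: "(i2, p) \<in> E" using i2 by (auto simp: inflation_def)
  from conflation_iso_mid[OF this, of b a] show ?thesis
    using a b ab ba is_kernelD[OF conflation_kernel[OF p]] by (auto simp: inflation_def)
qed

text \<open>
  The projection \<open>X \<oplus> Y \<rightarrow> X\<close> is the pull-back along \<open>X \<rightarrow> 0\<close> of \<open>Y \<rightarrow> 0\<close>, which is a deflation as
  the cokernel of the inflation \<open>Id Y\<close>.
\<close>

lemma biproduct_deflation:
  assumes "is_biproduct C X Y B i j p q"
  shows "deflation E p"
proof -
  note b = biproductD[OF assms] biproduct_obj[OF assms]
  obtain z where z: "(Id C Y, z) \<in> E" using id_inflation b by (auto simp: inflation_def)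
  note zd = is_kernelD[OF conflation_kernel[OF z]]
  have z0: "z = Zero C Y (Cod C z)" using zd b by simp
  \<comment> \<open>The codomain of the cokernel \<open>z\<close> of \<open>Id Y\<close> serves as the zero object.\<close>
  have "is_pullback C z (Zero C X (Cod C z)) p q"
  proof (rule is_pullbackI)
    show "Comp C (Zero C X (Cod C z)) p = Comp C z q"
    proof -
      have "Comp C z q = Comp C (Zero C Y (Cod C z)) q" by (simp only: z0[symmetric])
      also have "\<dots> = Comp C (Zero C X (Cod C z)) p" using zd(2) b(1-12,18-20) by simp
      finally show ?thesis ..
    qed
  next
    fix u v assume uv: "u \<in> Mor C" "v \<in> Mor C" "Cod C u = Dom C (Zero C X (Cod C z))" "Cod C v = Dom C z"
      "Dom C u = Dom C v"
    then have uv: "u \<in> Mor C" "v \<in> Mor C" "Cod C u = X" "Cod C v = Y" "Dom C u = Dom C v"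
      using zd b by simp_all
    have 1: "Comp C p (Comp C i u) = u" "Comp C q (Comp C i u) = Zero C (Dom C v) Y"
      using comp_reduce[OF b(13), of u] comp_reduce[OF b(15), of u] b uv by simp_all
    have 2: "Comp C q (Comp C j v) = v" "Comp C p (Comp C j v) = Zero C (Dom C v) X"
      using comp_reduce[OF b(14), of v] comp_reduce[OF b(16), of v] b uv by simp_all
    show "\<exists>k. k \<in> Mor C \<and> Dom C k = Dom C v \<and> Cod C k = Dom C p \<and> Comp C p k = u \<and> Comp C q k = v"
      by (rule exI[of _ "Add C (Comp C i u) (Comp C j v)"]) (use uv b 1 2 in simp)
  next
    fix k k' assume k: "k \<in> Mor C" "k' \<in> Mor C" "Dom C k = Dom C k'" "Cod C k = Dom C p" "Cod C k' = Dom C p"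
      "Comp C p k = Comp C p k'" "Comp C q k = Comp C q k'"
    then show "k = k'" using biproduct_eq[OF assms, of k k'] b(7) by metis
  qed (use zd b in auto)
  moreover have "deflation E z" using z by (auto simp: deflation_def)
  ultimately show ?thesis by (rule deflation_pullback)
qed

text \<open>
  The morphism \<open>[g, v]\<close> is \<open>g \<oplus> 1\<close>, a pull-back of \<open>g\<close>, followed by \<open>[1, v]\<close>, which is a projection of
  a twisted biproduct.
\<close>

lemma copair_deflation:
  assumes g: "deflation E g" and v: "v \<in> Mor C" "Cod C v = Cod C g"
    and bs: "is_biproduct C (Dom C g) (Dom C v) S i j p q"
  shows "deflation E (Add C (Comp C g p) (Comp C v q))"
proof -
  note b = biproductD[OF bs] biproduct_obj[OF bs]
  note g' = deflation_arr[OF g]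
  obtain T i' j' p' q' where bt: "is_biproduct C (Cod C g) (Dom C v) T i' j' p' q'"
    using biproducts[of "Cod C g" "Dom C v"] g' v by auto
  note c = biproductD[OF bt] biproduct_obj[OF bt]
  define m where "m = Add C (Comp C i' (Comp C g p)) (Comp C j' q)"
  have m: "m \<in> Mor C" "Dom C m = S" "Cod C m = T" using b c g' by (auto simp: m_def)
  have pi: "Comp C p' (Comp C i' h) = h" "Comp C q' (Comp C i' h) = Zero C (Dom C h) (Dom C v)"
    if "h \<in> Mor C" "Cod C h = Cod C g" for h
    using comp_reduce[OF c(13), of h] comp_reduce[OF c(15), of h] c that v by simp_all
  have pj: "Comp C q' (Comp C j' h) = h" "Comp C p' (Comp C j' h) = Zero C (Dom C h) (Cod C g)"
    if "h \<in> Mor C" "Cod C h = Dom C v" for h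
    using comp_reduce[OF c(14), of h] comp_reduce[OF c(16), of h] c that g' by simp_all
  have pm: "Comp C p' m = Comp C g p" "Comp C q' m = q"
    using pi pj b c g' v by (simp_all add: m_def)
  \<comment> \<open>\<open>m\<close> is \<open>g \<oplus> 1: B \<oplus> X \<rightarrow> C \<oplus> X\<close>.\<close>
  have "is_pullback C g p' m p"
  proof (rule is_pullbackI)
    fix u w assume uw: "u \<in> Mor C" "w \<in> Mor C" "Cod C u = Dom C p'" "Cod C w = Dom C g" "Dom C u = Dom C w"
      "Comp C p' u = Comp C g w"
    have 1: "Comp C p (Comp C i w) = w" "Comp C q (Comp C i w) = Zero C (Dom C w) (Dom C v)"
      using comp_reduce[OF b(13), of w] comp_reduce[OF b(15), of w] b v uw by simp_all
    have 2: "Comp C q (Comp C j (Comp C q' u)) = Comp C q' u"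
      "Comp C p (Comp C j (Comp C q' u)) = Zero C (Dom C w) (Dom C g)"
      using comp_reduce[OF b(14), of "Comp C q' u"] comp_reduce[OF b(16), of "Comp C q' u"] b c uw g' by simp_all
    let ?k = "Add C (Comp C i w) (Comp C j (Comp C q' u))"
    have pk: "Comp C p ?k = w" "Comp C q ?k = Comp C q' u" using 1 2 b c uw v g' by simp_all
    have k: "?k \<in> Mor C" "Dom C ?k = Dom C w" "Cod C ?k = S" using b c uw by simp_all
    have "Comp C m ?k = Add C (Comp C i' (Comp C g (Comp C p ?k))) (Comp C j' (Comp C q ?k))"
      unfolding m_def using k b(1-12) c(1-12) g' by (simp del: comp_add)
    also have "\<dots> = u" unfolding pk using biproduct_ext[OF bt, of u] uw c by simp
    finally have "Comp C m ?k = u" .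
    then show "\<exists>k. k \<in> Mor C \<and> Dom C k = Dom C w \<and> Cod C k = Dom C m \<and> Comp C m k = u \<and> Comp C p k = w"
      using k pk m by (intro exI[of _ ?k]) simp
  next
    fix k k' assume k: "k \<in> Mor C" "k' \<in> Mor C" "Dom C k = Dom C k'" "Cod C k = Dom C m" "Cod C k' = Dom C m"
      "Comp C m k = Comp C m k'" "Comp C p k = Comp C p k'"
    have "Comp C q k = Comp C q k'"
      using k comp_reduce[OF pm(2), of k] comp_reduce[OF pm(2), of k'] m c by simp
    then show "k = k'" using k biproduct_eq[OF bs, of k k'] m by metis
  qed (use m b c pm g' in auto)
  then have dm: "deflation E m" using deflation_pullback g by blast
  have "deflation E (Add C p' (Comp C v q'))"
    using biproduct_deflation[OF biproduct_twist[OF bt, of v]] v by simp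
  from deflation_comp[OF dm this] show ?thesis using m c v pm by simp
qed

lemma copair_deflation_ex:
  assumes g: "deflation E g" and v: "v \<in> Mor C" "Cod C v = Cod C g"
  obtains w where "deflation E w" "Cod C w = Cod C g" "factors C g w" "factors C v w"
    "\<And>h. h \<in> Mor C \<Longrightarrow> factors C h w \<Longrightarrow> \<exists>a b. a \<in> Mor C \<and> b \<in> Mor C \<and> Cod C a = Dom C g \<and> Cod C b = Dom C v \<and>
       Dom C a = Dom C h \<and> Dom C b = Dom C h \<and> h = Add C (Comp C g a) (Comp C v b)"
proof -
  note g' = deflation_arr[OF g]
  obtain S i j p q where bs: "is_biproduct C (Dom C g) (Dom C v) S i j p q"
    using biproducts[of "Dom C g" "Dom C v"] g' v by auto
  note b = biproductD[OF bs] biproduct_obj[OF bs]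
  let ?w = "Add C (Comp C g p) (Comp C v q)"
  have w: "?w \<in> Mor C" "Dom C ?w = S" "Cod C ?w = Cod C g" using b g' v by simp_all
  show thesis
  proof (rule that[of ?w])
    show "deflation E ?w" by (rule copair_deflation[OF g v bs])
    show "Cod C ?w = Cod C g" by fact
    have wi: "Comp C ?w i = g" and wj: "Comp C ?w j = v" using b g' v by simp_all
    show "factors C g ?w"
      by (rule factorsI[OF b(1) b(5) _ wi[symmetric]]) (simp only: b(9) w(2))
    show "factors C v ?w"
      by (rule factorsI[OF b(2) b(6) _ wj[symmetric]]) (simp only: b(10) w(2))
    fix h assume h: "h \<in> Mor C" "factors C h ?w"
    then obtain k where k: "k \<in> Mor C" "Dom C k = Dom C h" "Cod C k = S" "h = Comp C ?w k"
      using w by (auto simp: factors_def)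
    then show "\<exists>a b. a \<in> Mor C \<and> b \<in> Mor C \<and> Cod C a = Dom C g \<and> Cod C b = Dom C v \<and>
       Dom C a = Dom C h \<and> Dom C b = Dom C h \<and> h = Add C (Comp C g a) (Comp C v b)"
      using b g' v by (intro exI[of _ "Comp C p k"] exI[of _ "Comp C q k"]) simp
  qed
qed

text \<open>
  Quillen's obscure axiom. By \<open>copair_deflation\<close> the morphism \<open>[g, g \<circ> k]\<close> on \<open>B \<oplus> Y\<close> is a deflation, and after
  a shear this is \<open>g \<circ> p\<close> for the projection \<open>p: B \<oplus> Y \<rightarrow> B\<close>. Then \<open>f\<close> is the push-out of the
  kernel \<open>\<kappa>\<close> of \<open>g \<circ> p\<close> along the induced morphism \<open>\<pi>\<close> from the domain of \<open>\<kappa>\<close> to that of \<open>f\<close>, and so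
  it is an inflation.
\<close>

lemma deflation_of_comp:
  assumes fg: "kernel_cokernel_pair C f g"
    and k: "k \<in> Mor C" "Cod C k = Dom C g" and h: "deflation E (Comp C g k)"
  shows "(f, g) \<in> E"
proof -
  have ker: "is_kernel C f g" and coker: "is_cokernel C g f"
    using fg by (auto simp: kernel_cokernel_pair_def)
  note d = is_kernelD[OF ker]
  obtain S j i q p where bs: "is_biproduct C (Dom C k) (Dom C g) S j i q p"
    using biproducts[of "Dom C k" "Dom C g"] d k by auto
  note b' = biproductD[OF biproduct_swap[OF bs]] biproduct_obj[OF biproduct_swap[OF bs]]
  note b = b'
  \<comment> \<open>The shear by \<open>-k\<close> cancels the summand \<open>g \<circ> k\<close>.\<close>
  obtain j' p' where tw: "is_biproduct C (Dom C g) (Dom C k) S i j' p' q"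
     and p': "p' = Add C p (neg (Comp C k q))"
    using biproduct_twist[OF biproduct_swap[OF bs], of "neg k"] k b by auto
  have "deflation E (Add C (Comp C (Comp C g k) q) (Comp C g p'))"
    using copair_deflation[OF h, of g S j' i q p'] biproduct_swap[OF tw] d k by simp
  also have "Comp C g p' = Add C (neg (Comp C g (Comp C k q))) (Comp C g p)"
    using p' d b k add_commute[of "Comp C g p" "neg (Comp C g (Comp C k q))"] by simp
  finally have gp: "deflation E (Comp C g p)" using d b k by simp
  then obtain \<kappa> where E: "(\<kappa>, Comp C g p) \<in> E" by (auto simp: deflation_def)
  note K = conflation_kernel[OF E]
  note kd = is_kernelD[OF K]
  have kd': "\<kappa> \<in> Mor C" "Cod C \<kappa> = S" "Comp C g (Comp C p \<kappa>) = Zero C (Dom C \<kappa>) (Cod C g)"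
    using kd d b by auto
  obtain \<pi> where \<pi>: "\<pi> \<in> Mor C" "Dom C \<pi> = Dom C \<kappa>" "Cod C \<pi> = Dom C f" "Comp C f \<pi> = Comp C p \<kappa>"
    using kernel_lift[OF ker, of "Comp C p \<kappa>"] kd' d b by auto
  have "is_pushout C \<kappa> \<pi> f p"
  proof (rule is_pushoutI)
    fix u w assume uw: "u \<in> Mor C" "w \<in> Mor C" "Dom C u = Cod C \<pi>" "Dom C w = Cod C \<kappa>" "Cod C u = Cod C w"
      "Comp C u \<pi> = Comp C w \<kappa>"
    \<comment> \<open>The induced morphism is \<open>w \<circ> i\<close>. It works because \<open>j\<close> and \<open>i \<circ> f\<close> both lift to the kernel \<open>\<kappa>\<close>
      and \<open>\<pi>\<close> sends the lifts to \<open>0\<close> and to the identity.\<close>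
    obtain y where y: "y \<in> Mor C" "Dom C y = Dom C k" "Cod C y = Dom C \<kappa>" "Comp C \<kappa> y = j"
      using kernel_lift[OF K, of j] b d by auto
    have "Comp C f (Comp C \<pi> y) = Comp C f (Zero C (Dom C k) (Dom C f))"
      using comp_reduce[OF \<pi>(4), of y] \<pi> y d kd' b by simp
    then have py: "Comp C \<pi> y = Zero C (Dom C k) (Dom C f)"
      using kernel_mono[OF ker, of "Comp C \<pi> y"] \<pi> y d b k by simp
    have wj: "Comp C w j = Zero C (Dom C k) (Cod C w)"
    proof -
      have "Comp C w j = Comp C (Comp C u \<pi>) y"
        using y(1,3) uw(2,4) kd' unfolding uw(6) y(4)[symmetric] by simp
      also have "\<dots> = Zero C (Dom C k) (Cod C w)" using y(1,3) uw(1-5) \<pi>(1-3) py k d by simp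
      finally show ?thesis .
    qed
    have "Comp C (Comp C g p) (Comp C i f) = Zero C (Dom C f) (Cod C g)"
      using comp_reduce[OF b(13), of f] d b by simp
    then obtain z where z: "z \<in> Mor C" "Dom C z = Dom C f" "Cod C z = Dom C \<kappa>" "Comp C \<kappa> z = Comp C i f"
      using kernel_lift[OF K, of "Comp C i f"] b d by auto
    have "Comp C f (Comp C \<pi> z) = Comp C f (Id C (Dom C f))"
      using comp_reduce[OF \<pi>(4), of z] comp_reduce[OF b(13), of f] \<pi> z d kd' b by simp
    then have pz: "Comp C \<pi> z = Id C (Dom C f)"
      using kernel_mono[OF ker, of "Comp C \<pi> z"] \<pi> z d by simp
    have 1: "Comp C (Comp C w i) f = u"
    proof -
      have "Comp C (Comp C w i) f = Comp C w (Comp C \<kappa> z)" using uw(1-5) z(4) kd' d b by simp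
      also have "\<dots> = Comp C (Comp C u \<pi>) z" using z(1,3) uw(2,4) kd' unfolding uw(6) by simp
      also have "\<dots> = u" using z(1,3) uw(1-5) \<pi>(1-3) pz d by simp
      finally show ?thesis .
    qed
    have "Comp C w (Add C (Comp C i p) (Comp C j q)) = w" using uw b kd' by simp
    then have 2: "Comp C (Comp C w i) p = w"
      using uw b(1-12) kd' comp_reduce[OF wj, of q] k d by simp
    show "\<exists>l. l \<in> Mor C \<and> Dom C l = Cod C f \<and> Cod C l = Cod C w \<and> Comp C l f = u \<and> Comp C l p = w"
      using 1 2 uw b d kd' by (intro exI[of _ "Comp C w i"]) simp
  next
    fix l l' assume l: "l \<in> Mor C" "l' \<in> Mor C" "Cod C l = Cod C l'" "Dom C l = Cod C f" "Dom C l' = Cod C f"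
      "Comp C l p = Comp C l' p"
    have "Comp C (Comp C m p) i = m" if "m \<in> Mor C" "Dom C m = Cod C f" for m
      using that b d by simp
    from this[OF l(1,4)] this[OF l(2,5)] show "l = l'" unfolding l(6) by (rule trans[OF sym])
  qed (use d \<pi> kd' b in auto)
  moreover have "inflation E \<kappa>" using E by (auto simp: inflation_def)
  ultimately have "inflation E f" by (rule inflation_pushout)
  then obtain g' where "(f, g') \<in> E" by (auto simp: inflation_def)
  then show ?thesis using coker by (rule conflation_iso_cod)
qed

end

section \<open>Modules over a preadditive category\<close>

lemma ModCat_simps [simp]:
  "Ob (ModCat C) = {M. right_module C M}"
  "(M, \<eta>, N) \<in> Mor (ModCat C) \<longleftrightarrow> right_module C M \<and> right_module C N \<and> \<eta> \<in> nat_trans C M N"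
  "Dom (ModCat C) (M, \<eta>, N) = M"
  "Cod (ModCat C) (M, \<eta>, N) = N"
  "Comp (ModCat C) (N, \<theta>, P) (M, \<eta>, N') = (M, \<lambda>X \<in> Ob C. \<lambda>x \<in> carrier (Grp M X). \<theta> X (\<eta> X x), P)"
  "Zero (ModCat C) M N = (M, \<lambda>X \<in> Ob C. \<lambda>x \<in> carrier (Grp M X). \<one>\<^bsub>Grp N X\<^esub>, N)"
  "Id (ModCat C) M = (M, \<lambda>X \<in> Ob C. \<lambda>x \<in> carrier (Grp M X). x, M)"
  by (simp_all add: ModCat_def)

context preadditive_category
begin

lemma module_group: "right_module C M \<Longrightarrow> X \<in> Ob C \<Longrightarrow> comm_group (Grp M X)"
  by (simp add: right_module_def)

lemma module_one [simp]: "right_module C M \<Longrightarrow> X \<in> Ob C \<Longrightarrow> \<one>\<^bsub>Grp M X\<^esub> \<in> carrier (Grp M X)"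
  by (drule (1) module_group) (simp add: comm_group_def group_def monoid.one_closed)

lemma module_mult [simp]:
  "right_module C M \<Longrightarrow> X \<in> Ob C \<Longrightarrow> x \<in> carrier (Grp M X) \<Longrightarrow> y \<in> carrier (Grp M X) \<Longrightarrow>
    x \<otimes>\<^bsub>Grp M X\<^esub> y \<in> carrier (Grp M X)"
  by (drule (1) module_group) (simp add: comm_group_def group_def monoid.m_closed)

lemma module_mult_one [simp]:
  assumes "right_module C M" "X \<in> Ob C" "x \<in> carrier (Grp M X)"
  shows "x \<otimes>\<^bsub>Grp M X\<^esub> \<one>\<^bsub>Grp M X\<^esub> = x" "\<one>\<^bsub>Grp M X\<^esub> \<otimes>\<^bsub>Grp M X\<^esub> x = x"
proof -
  interpret comm_group "Grp M X" by (rule module_group[OF assms(1,2)])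
  show "x \<otimes>\<^bsub>Grp M X\<^esub> \<one>\<^bsub>Grp M X\<^esub> = x" "\<one>\<^bsub>Grp M X\<^esub> \<otimes>\<^bsub>Grp M X\<^esub> x = x" using assms(3) by simp_all
qed

lemma module_left_cancel:
  assumes "right_module C M" "X \<in> Ob C" "x \<in> carrier (Grp M X)" "y \<in> carrier (Grp M X)"
    "z \<in> carrier (Grp M X)" "x \<otimes>\<^bsub>Grp M X\<^esub> y = x \<otimes>\<^bsub>Grp M X\<^esub> z"
  shows "y = z"
proof -
  interpret comm_group "Grp M X" by (rule module_group[OF assms(1,2)])
  show ?thesis using assms(3-6) Units_l_cancel[of x y z] Units_eq by simp
qed

lemma act_closed [simp]:
  assumes "right_module C M" "f \<in> Mor C" "Dom C f = X" "x \<in> carrier (Grp M (Cod C f))"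
  shows "Act M f x \<in> carrier (Grp M X)"
  using assms by (auto simp: right_module_def hom_def Pi_def)

lemma act_mult [simp]:
  assumes "right_module C M" "f \<in> Mor C" "Cod C f = X" "x \<in> carrier (Grp M X)" "y \<in> carrier (Grp M X)"
  shows "Act M f (x \<otimes>\<^bsub>Grp M X\<^esub> y) = Act M f x \<otimes>\<^bsub>Grp M (Dom C f)\<^esub> Act M f y"
  using assms by (auto simp: right_module_def hom_def)

lemma act_id [simp]:
  "right_module C M \<Longrightarrow> X \<in> Ob C \<Longrightarrow> x \<in> carrier (Grp M X) \<Longrightarrow> Act M (Id C X) x = x"
  by (simp add: right_module_def)

lemma act_comp [simp]:
  assumes "right_module C M" "f \<in> Mor C" "g \<in> Mor C" "Cod C f = Dom C g" "x \<in> carrier (Grp M (Cod C g))"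
  shows "Act M (Comp C g f) x = Act M f (Act M g x)"
  using assms by (simp add: right_module_def)

lemma act_add [simp]:
  assumes "right_module C M" "f \<in> Mor C" "g \<in> Mor C" "Dom C f = Dom C g" "Cod C f = Cod C g"
    "x \<in> carrier (Grp M (Cod C g))"
  shows "Act M (Add C f g) x = Act M f x \<otimes>\<^bsub>Grp M (Dom C f)\<^esub> Act M g x"
  using assms unfolding right_module_def by metis

lemma act_one [simp]:
  assumes "right_module C M" "f \<in> Mor C" "Cod C f = X"
  shows "Act M f \<one>\<^bsub>Grp M X\<^esub> = \<one>\<^bsub>Grp M (Dom C f)\<^esub>"
proof -
  have X: "X \<in> Ob C" using assms Cod_in by blast
  have "Act M f (\<one>\<^bsub>Grp M X\<^esub> \<otimes>\<^bsub>Grp M X\<^esub> \<one>\<^bsub>Grp M X\<^esub>) =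
      Act M f \<one>\<^bsub>Grp M X\<^esub> \<otimes>\<^bsub>Grp M (Dom C f)\<^esub> Act M f \<one>\<^bsub>Grp M X\<^esub>"
    using assms X by (intro act_mult) simp_all
  then have "Act M f \<one>\<^bsub>Grp M X\<^esub> \<otimes>\<^bsub>Grp M (Dom C f)\<^esub> Act M f \<one>\<^bsub>Grp M X\<^esub> =
      Act M f \<one>\<^bsub>Grp M X\<^esub> \<otimes>\<^bsub>Grp M (Dom C f)\<^esub> \<one>\<^bsub>Grp M (Dom C f)\<^esub>"
    using assms X by simp
  then show ?thesis
    by (rule module_left_cancel[OF assms(1), rotated 4]) (use assms X in simp_all)
qed

lemma act_zero [simp]:
  assumes M: "right_module C M" and X: "X \<in> Ob C" "Y \<in> Ob C" and x: "x \<in> carrier (Grp M Y)"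
  shows "Act M (Zero C X Y) x = \<one>\<^bsub>Grp M X\<^esub>"
proof (rule module_left_cancel[OF M X(1)])
  let ?z = "Act M (Zero C X Y) x"
  show "?z \<otimes>\<^bsub>Grp M X\<^esub> ?z = ?z \<otimes>\<^bsub>Grp M X\<^esub> \<one>\<^bsub>Grp M X\<^esub>"
    using act_add[OF M, of "Zero C X Y" "Zero C X Y" x] assms by simp
qed (use assms in simp_all)

lemma mod_morD:
  assumes "(M, \<eta>, N) \<in> Mor (ModCat C)"
  shows "right_module C M" "right_module C N"
    "\<And>X x. X \<in> Ob C \<Longrightarrow> x \<in> carrier (Grp M X) \<Longrightarrow> \<eta> X x \<in> carrier (Grp N X)"
    "\<And>X x y. X \<in> Ob C \<Longrightarrow> x \<in> carrier (Grp M X) \<Longrightarrow> y \<in> carrier (Grp M X) \<Longrightarrow>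
       \<eta> X (x \<otimes>\<^bsub>Grp M X\<^esub> y) = \<eta> X x \<otimes>\<^bsub>Grp N X\<^esub> \<eta> X y"
    "\<And>f x. f \<in> Mor C \<Longrightarrow> x \<in> carrier (Grp M (Cod C f)) \<Longrightarrow>
       \<eta> (Dom C f) (Act M f x) = Act N f (\<eta> (Cod C f) x)"
  using assms by (auto simp: nat_trans_def hom_def Pi_def)

lemma mod_mor_one:
  assumes \<eta>: "(M, \<eta>, N) \<in> Mor (ModCat C)" and X: "X \<in> Ob C"
  shows "\<eta> X \<one>\<^bsub>Grp M X\<^esub> = \<one>\<^bsub>Grp N X\<^esub>"
  using mod_morD(5)[OF \<eta>, of "Zero C X X" "\<one>\<^bsub>Grp M X\<^esub>"] mod_morD(1,2)[OF \<eta>]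
    mod_morD(3)[OF \<eta> X, of "\<one>\<^bsub>Grp M X\<^esub>"] X by simp

lemma mod_mor_eqI:
  assumes "(M, \<eta>, N) \<in> Mor (ModCat C)" "(M, \<theta>, N) \<in> Mor (ModCat C)"
    and "\<And>X x. X \<in> Ob C \<Longrightarrow> x \<in> carrier (Grp M X) \<Longrightarrow> \<eta> X x = \<theta> X x"
  shows "\<eta> = \<theta>"
proof (rule extensionalityI[of _ "Ob C"])
  show "\<eta> \<in> extensional (Ob C)" "\<theta> \<in> extensional (Ob C)" using assms by (auto simp: nat_trans_def)
  fix X assume X: "X \<in> Ob C"
  show "\<eta> X = \<theta> X"
    by (rule extensionalityI[of _ "carrier (Grp M X)"]) (use assms X in \<open>auto simp: nat_trans_def\<close>)
qed

lemma mod_morI: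
  assumes "right_module C M" "right_module C N"
    "\<And>X x. X \<in> Ob C \<Longrightarrow> x \<in> carrier (Grp M X) \<Longrightarrow> \<eta> X x \<in> carrier (Grp N X)"
    "\<And>X x y. X \<in> Ob C \<Longrightarrow> x \<in> carrier (Grp M X) \<Longrightarrow> y \<in> carrier (Grp M X) \<Longrightarrow>
       \<eta> X (x \<otimes>\<^bsub>Grp M X\<^esub> y) = \<eta> X x \<otimes>\<^bsub>Grp N X\<^esub> \<eta> X y"
    "\<And>f x. f \<in> Mor C \<Longrightarrow> x \<in> carrier (Grp M (Cod C f)) \<Longrightarrow>
       \<eta> (Dom C f) (Act M f x) = Act N f (\<eta> (Cod C f) x)"
  shows "(M, \<lambda>X \<in> Ob C. \<lambda>x \<in> carrier (Grp M X). \<eta> X x, N) \<in> Mor (ModCat C)"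
  using assms by (auto simp: nat_trans_def hom_def Pi_def)

lemma mod_mor_comp:
  assumes \<eta>: "(M, \<eta>, N) \<in> Mor (ModCat C)" and \<theta>: "(N, \<theta>, P) \<in> Mor (ModCat C)"
  shows "(M, \<lambda>X \<in> Ob C. \<lambda>x \<in> carrier (Grp M X). \<theta> X (\<eta> X x), P) \<in> Mor (ModCat C)"
  by (rule mod_morI) (simp_all add: mod_morD[OF \<eta>] mod_morD[OF \<theta>])

lemma mod_mor_id: "right_module C M \<Longrightarrow> (M, \<lambda>X \<in> Ob C. \<lambda>x \<in> carrier (Grp M X). x, M) \<in> Mor (ModCat C)"
  by (rule mod_morI) simp_all

lemma mod_mor_zero:
  "right_module C M \<Longrightarrow> right_module C N \<Longrightarrow>
    (M, \<lambda>X \<in> Ob C. \<lambda>x \<in> carrier (Grp M X). \<one>\<^bsub>Grp N X\<^esub>, N) \<in> Mor (ModCat C)"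
  by (rule mod_morI) simp_all

end

section \<open>Modules given by a generator and its annihilator\<close>

text \<open>
  \<open>M\<close> is isomorphic to the cokernel of \<open>Hom(-, g)\<close>, by an isomorphism under which \<open>c\<close> corresponds to
  the class of the identity. Working with the element \<open>c\<close> avoids computing with cosets, and lets
  the same module be presented by several morphisms.
\<close>

definition presents :: "('o, 'm) preadd_cat \<Rightarrow> 'm \<Rightarrow> ('o, 'm, 'g) rmod \<Rightarrow> 'g \<Rightarrow> bool" where
  "presents C g M c \<longleftrightarrow> right_module C M \<and> g \<in> Mor C \<and> c \<in> carrier (Grp M (Cod C g)) \<and>
     (\<forall>X \<in> Ob C. \<forall>x \<in> carrier (Grp M X). \<exists>h \<in> Hom C X (Cod C g). x = Act M h c) \<and>
     (\<forall>h \<in> Mor C. Cod C h = Cod C g \<longrightarrow> (Act M h c = \<one>\<^bsub>Grp M (Dom C h)\<^esub> \<longleftrightarrow> factors C h g))"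

context preadditive_category
begin

lemma presentsD:
  assumes "presents C g M c"
  shows "right_module C M" "g \<in> Mor C" "c \<in> carrier (Grp M (Cod C g))"
    and "h \<in> Mor C \<Longrightarrow> Cod C h = Cod C g \<Longrightarrow> Act M h c = \<one>\<^bsub>Grp M (Dom C h)\<^esub> \<longleftrightarrow> factors C h g"
  using assms by (auto simp: presents_def)

lemma presents_elem:
  assumes "presents C g M c" "X \<in> Ob C" "x \<in> carrier (Grp M X)"
  obtains h where "h \<in> Mor C" "Dom C h = X" "Cod C h = Cod C g" "x = Act M h c"
proof -
  have "\<forall>X \<in> Ob C. \<forall>x \<in> carrier (Grp M X). \<exists>h \<in> Hom C X (Cod C g). x = Act M h c"
    using assms(1) unfolding presents_def by blast
  then obtain h where "h \<in> Hom C X (Cod C g)" "x = Act M h c" using assms(2,3) by blast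
  then show thesis using that by auto
qed

lemma presents_relation:
  assumes "presents C g M c"
  shows "Act M g c = \<one>\<^bsub>Grp M (Dom C g)\<^esub>"
  using presentsD(4)[OF assms, of g] presentsD(2)[OF assms] factors_self[of g "Id C (Dom C g)"] by simp

lemma presents_mor_ext:
  assumes p: "presents C g M c" and \<eta>: "(M, \<eta>, N) \<in> Mor (ModCat C)" and \<theta>: "(M, \<theta>, N) \<in> Mor (ModCat C)"
    and eq: "\<eta> (Cod C g) c = \<theta> (Cod C g) c"
  shows "\<eta> = \<theta>"
proof (rule mod_mor_eqI[OF \<eta> \<theta>])
  fix X x assume x: "X \<in> Ob C" "x \<in> carrier (Grp M X)"
  obtain h where h: "h \<in> Mor C" "Dom C h = X" "Cod C h = Cod C g" "x = Act M h c"
    using presents_elem[OF p x] by metis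
  have "\<eta> (Dom C h) (Act M h c) = \<theta> (Dom C h) (Act M h c)"
    using mod_morD(5)[OF \<eta> h(1)] mod_morD(5)[OF \<theta> h(1)] eq presentsD(3)[OF p] h(3) by simp
  then show "\<eta> X x = \<theta> X x" using h by simp
qed

text \<open>
  If \<open>h\<close> and \<open>h'\<close> agree on \<open>c\<close>, their difference kills \<open>c\<close>, hence factors through \<open>g\<close> and kills every
  element that \<open>g\<close> kills.
\<close>

lemma presents_act_eq:
  assumes p: "presents C g M c" and N: "right_module C N" "n \<in> carrier (Grp N (Cod C g))"
    "Act N g n = \<one>\<^bsub>Grp N (Dom C g)\<^esub>"
    and h: "h \<in> Mor C" "Cod C h = Cod C g" and h': "h' \<in> Mor C" "Cod C h' = Cod C g" "Dom C h' = Dom C h"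
    and eq: "Act M h c = Act M h' c"
  shows "Act N h n = Act N h' n"
proof -
  note M = presentsD(1-3)[OF p]
  have "Act M (Add C (neg h') h) c = Act M (neg h') c \<otimes>\<^bsub>Grp M (Dom C h)\<^esub> Act M h' c"
    using M h h' by (simp add: eq)
  also have "\<dots> = Act M (Add C (neg h') h') c" using M h' act_add[of M "neg h'" h' c] by simp
  also have "\<dots> = \<one>\<^bsub>Grp M (Dom C h)\<^esub>" using M h' h by simp
  finally have "factors C (Add C (neg h') h) g"
    using presentsD(4)[OF p, of "Add C (neg h') h"] h h' by simp
  moreover have "Dom C (Add C (neg h') h) = Dom C h" using h h' by simp
  ultimately obtain k where k: "k \<in> Mor C" "Dom C k = Dom C h" "Cod C k = Dom C g"
    "Add C (neg h') h = Comp C g k"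
    using factorsE by metis
  have "h = Add C h' (Add C (neg h') h)" using h h' by simp
  also have "\<dots> = Add C h' (Comp C g k)" by (simp only: k(4))
  finally have "Act N h n = Act N (Add C h' (Comp C g k)) n" by (rule arg_cong)
  also have "\<dots> = Act N h' n \<otimes>\<^bsub>Grp N (Dom C h)\<^esub> Act N k (Act N g n)"
    using h h' k(1-3) M N(1,2) by simp
  also have "\<dots> = Act N h' n" using N h h' k(1-3) by simp
  finally show ?thesis .
qed

text \<open>
  The universal property of the presentation: the morphism sends \<open>h\<close> acting on \<open>c\<close> to \<open>h\<close> acting on
  \<open>n\<close>, and \<open>presents_act_eq\<close> says that this is well defined.
\<close>

lemma presents_mor_ex:
  assumes p: "presents C g M c" and N: "right_module C N" "n \<in> carrier (Grp N (Cod C g))"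
    "Act N g n = \<one>\<^bsub>Grp N (Dom C g)\<^esub>"
  obtains \<eta> where "(M, \<eta>, N) \<in> Mor (ModCat C)" "\<eta> (Cod C g) c = n"
    "\<And>h. h \<in> Mor C \<Longrightarrow> Cod C h = Cod C g \<Longrightarrow> \<eta> (Dom C h) (Act M h c) = Act N h n"
proof -
  note M = presentsD(1-3)[OF p]
  define \<eta> where "\<eta> X x = Act N (SOME h. h \<in> Mor C \<and> Dom C h = X \<and> Cod C h = Cod C g \<and> x = Act M h c) n" for X x
  have \<eta>: "\<eta> (Dom C h) (Act M h c) = Act N h n" if h: "h \<in> Mor C" "Cod C h = Cod C g" for h
  proof -
    have "\<exists>h'. h' \<in> Mor C \<and> Dom C h' = Dom C h \<and> Cod C h' = Cod C g \<and> Act M h c = Act M h' c"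
      using h by blast
    note k = someI_ex[OF this]
    show ?thesis
      unfolding \<eta>_def by (rule presents_act_eq[OF p N h, symmetric]) (use k in blast)+
  qed
  have elem: "\<exists>h. h \<in> Mor C \<and> Dom C h = X \<and> Cod C h = Cod C g \<and> x = Act M h c"
    if "X \<in> Ob C" "x \<in> carrier (Grp M X)" for X x
    using presents_elem[OF p that] by metis
  have mor: "(M, \<lambda>X \<in> Ob C. \<lambda>x \<in> carrier (Grp M X). \<eta> X x, N) \<in> Mor (ModCat C)"
  proof (rule mod_morI)
    fix X x assume x: "X \<in> Ob C" "x \<in> carrier (Grp M X)"
    then obtain h where h: "h \<in> Mor C" "Dom C h = X" "Cod C h = Cod C g" "x = Act M h c" using elem by blast
    then show "\<eta> X x \<in> carrier (Grp N X)" using \<eta>[of h] N by auto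
    fix y assume y: "y \<in> carrier (Grp M X)"
    then obtain k where k: "k \<in> Mor C" "Dom C k = X" "Cod C k = Cod C g" "y = Act M k c" using elem x by blast
    have "x \<otimes>\<^bsub>Grp M X\<^esub> y = Act M (Add C h k) c" using h k M by simp
    then have "\<eta> X (x \<otimes>\<^bsub>Grp M X\<^esub> y) = Act N (Add C h k) n" using \<eta>[of "Add C h k"] h k by simp
    also have "\<dots> = \<eta> X x \<otimes>\<^bsub>Grp N X\<^esub> \<eta> X y" using h k N \<eta>[of h] \<eta>[of k] by simp
    finally show "\<eta> X (x \<otimes>\<^bsub>Grp M X\<^esub> y) = \<eta> X x \<otimes>\<^bsub>Grp N X\<^esub> \<eta> X y" .
  next
    fix f x assume f: "f \<in> Mor C" "x \<in> carrier (Grp M (Cod C f))"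
    then obtain h where h: "h \<in> Mor C" "Dom C h = Cod C f" "Cod C h = Cod C g" "x = Act M h c"
      using elem Cod_in by blast
    have "Act M f x = Act M (Comp C h f) c" using h f M by simp
    then have "\<eta> (Dom C f) (Act M f x) = Act N (Comp C h f) n" using \<eta>[of "Comp C h f"] h f by simp
    also have "\<dots> = Act N f (\<eta> (Cod C f) x)" using h f N \<eta>[of h] by simp
    finally show "\<eta> (Dom C f) (Act M f x) = Act N f (\<eta> (Cod C f) x)" .
  qed (use M N in simp_all)
  show thesis
  proof (rule that[OF mor])
    show "(\<lambda>X \<in> Ob C. \<lambda>x \<in> carrier (Grp M X). \<eta> X x) (Cod C g) c = n"
      using \<eta>[of "Id C (Cod C g)"] M N by simp
    fix h assume h: "h \<in> Mor C" "Cod C h = Cod C g"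
    then show "(\<lambda>X \<in> Ob C. \<lambda>x \<in> carrier (Grp M X). \<eta> X x) (Dom C h) (Act M h c) = Act N h n"
      using \<eta>[of h] M by simp
  qed
qed

lemma presents_isomorphic:
  assumes p: "presents C g M c" and q: "presents C g N d"
  shows "isomorphic (ModCat C) M N"
proof -
  note M = presentsD[OF p] and N = presentsD[OF q]
  obtain \<eta> where \<eta>: "(M, \<eta>, N) \<in> Mor (ModCat C)" "\<eta> (Cod C g) c = d"
    using presents_mor_ex[OF p N(1,3) presents_relation[OF q]] by metis
  obtain \<theta> where \<theta>: "(N, \<theta>, M) \<in> Mor (ModCat C)" "\<theta> (Cod C g) d = c"
    using presents_mor_ex[OF q M(1,3) presents_relation[OF p]] by metis
  have 1: "(\<lambda>X \<in> Ob C. \<lambda>x \<in> carrier (Grp M X). \<theta> X (\<eta> X x)) = (\<lambda>X \<in> Ob C. \<lambda>x \<in> carrier (Grp M X). x)"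
    by (rule presents_mor_ext[OF p mod_mor_comp[OF \<eta>(1) \<theta>(1)] mod_mor_id[OF M(1)]]) (use M \<eta> \<theta> in simp)
  have 2: "(\<lambda>X \<in> Ob C. \<lambda>x \<in> carrier (Grp N X). \<eta> X (\<theta> X x)) = (\<lambda>X \<in> Ob C. \<lambda>x \<in> carrier (Grp N X). x)"
    by (rule presents_mor_ext[OF q mod_mor_comp[OF \<theta>(1) \<eta>(1)] mod_mor_id[OF N(1)]]) (use N \<eta> \<theta> in simp)
  show ?thesis
    unfolding isomorphic_def is_iso_def using \<eta> \<theta> 1 2
    by (intro bexI[of _ "(M, \<eta>, N)"] conjI bexI[of _ "(N, \<theta>, M)"]) simp_all
qed

lemma presents_transport:
  assumes p: "presents C g D c" and iso: "isomorphic (ModCat C) M D"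
  shows "\<exists>m. presents C g M m"
proof -
  obtain \<psi> \<phi> where \<psi>: "(M, \<psi>, D) \<in> Mor (ModCat C)" and \<phi>: "(D, \<phi>, M) \<in> Mor (ModCat C)"
    and 1: "(\<lambda>X \<in> Ob C. \<lambda>x \<in> carrier (Grp M X). \<phi> X (\<psi> X x)) = (\<lambda>X \<in> Ob C. \<lambda>x \<in> carrier (Grp M X). x)"
    and 2: "(\<lambda>X \<in> Ob C. \<lambda>x \<in> carrier (Grp D X). \<psi> X (\<phi> X x)) = (\<lambda>X \<in> Ob C. \<lambda>x \<in> carrier (Grp D X). x)"
    using iso unfolding isomorphic_def is_iso_def by (auto simp del: ModCat_simps(2) simp: Hom_def)
  have \<phi>\<psi>: "\<phi> X (\<psi> X x) = x" if "X \<in> Ob C" "x \<in> carrier (Grp M X)" for X x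
    using fun_cong[OF fun_cong[OF 1], of X x] that by simp
  have \<psi>\<phi>: "\<psi> X (\<phi> X x) = x" if "X \<in> Ob C" "x \<in> carrier (Grp D X)" for X x
    using fun_cong[OF fun_cong[OF 2], of X x] that by simp
  note D = presentsD[OF p] and \<psi>' = mod_morD[OF \<psi>] and \<phi>' = mod_morD[OF \<phi>]
  let ?m = "\<phi> (Cod C g) c"
  have act: "Act M h ?m = \<phi> (Dom C h) (Act D h c)" if "h \<in> Mor C" "Cod C h = Cod C g" for h
    using \<phi>'(5)[of h c] that D(3) by simp
  have "presents C g M ?m"
    unfolding presents_def
  proof (intro conjI ballI impI)
    show "right_module C M" "g \<in> Mor C" "?m \<in> carrier (Grp M (Cod C g))" using D \<phi>' by simp_all
    fix X x assume x: "X \<in> Ob C" "x \<in> carrier (Grp M X)"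
    obtain h where h: "h \<in> Mor C" "Dom C h = X" "Cod C h = Cod C g" "\<psi> X x = Act D h c"
      using presents_elem[OF p x(1) \<psi>'(3)[OF x]] by metis
    then have "x = Act M h ?m" using act[of h] \<phi>\<psi>[OF x] by simp
    then show "\<exists>h \<in> Hom C X (Cod C g). x = Act M h ?m" using h by auto
  next
    fix h assume h: "h \<in> Mor C" "Cod C h = Cod C g"
    have "Act M h ?m = \<one>\<^bsub>Grp M (Dom C h)\<^esub> \<longleftrightarrow> Act D h c = \<one>\<^bsub>Grp D (Dom C h)\<^esub>"
      using act[OF h] mod_mor_one[OF \<phi>, of "Dom C h"] mod_mor_one[OF \<psi>, of "Dom C h"]
        \<psi>\<phi>[of "Dom C h" "Act D h c"] h D by (metis Dom_in act_closed)
    then show "Act M h ?m = \<one>\<^bsub>Grp M (Dom C h)\<^esub> \<longleftrightarrow> factors C h g" using D(4)[OF h] by simp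
  qed
  then show ?thesis ..
qed

end

section \<open>Defects\<close>

context preadditive_category
begin

lemma hom_image_subgroup:
  assumes g: "g \<in> Mor C" and X: "X \<in> Ob C"
  shows "subgroup (hom_image C g X) (hom_group C X (Cod C g))"
proof -
  interpret G: comm_group "hom_group C X (Cod C g)" using g X by (intro Hom_comm_group) simp_all
  show ?thesis
  proof (rule G.subgroupI)
    show "hom_image C g X \<subseteq> carrier (hom_group C X (Cod C g))"
      using g by (auto simp: hom_image_def hom_group_def)
    have "Comp C g (Zero C X (Dom C g)) \<in> hom_image C g X"
      unfolding hom_image_def by (rule imageI) (use g X in simp)
    then show "hom_image C g X \<noteq> {}" by blast
  next
    fix a assume "a \<in> hom_image C g X"
    then obtain k where k: "k \<in> Mor C" "Dom C k = X" "Cod C k = Dom C g" "a = Comp C g k"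
      by (auto simp: hom_image_def)
    have "inv\<^bsub>hom_group C X (Cod C g)\<^esub> a = neg a"
      by (rule G.inv_equality) (use k g in \<open>simp_all add: hom_group_def\<close>)
    also have "neg a = Comp C g (neg k)" using k g by simp
    finally show "inv\<^bsub>hom_group C X (Cod C g)\<^esub> a \<in> hom_image C g X"
      using k g unfolding hom_image_def by (intro image_eqI[of _ _ "neg k"]) simp_all
  next
    fix a b assume "a \<in> hom_image C g X" "b \<in> hom_image C g X"
    then obtain k l where k: "k \<in> Mor C" "Dom C k = X" "Cod C k = Dom C g" "a = Comp C g k"
      and l: "l \<in> Mor C" "Dom C l = X" "Cod C l = Dom C g" "b = Comp C g l"
      by (auto simp: hom_image_def)
    then show "a \<otimes>\<^bsub>hom_group C X (Cod C g)\<^esub> b \<in> hom_image C g X"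
      using g unfolding hom_image_def by (intro image_eqI[of _ _ "Add C k l"]) (simp_all add: hom_group_def)
  qed
qed

definition defect_class :: "'m \<Rightarrow> 'm \<Rightarrow> 'm set" where
  "defect_class g u = hom_image C g (Dom C u) #>\<^bsub>hom_group C (Dom C u) (Cod C g)\<^esub> u"

lemma defect_class_eq_iff:
  assumes g: "g \<in> Mor C" and u: "u \<in> Mor C" "Cod C u = Cod C g" and v: "v \<in> Mor C" "Cod C v = Cod C g"
    "Dom C u = Dom C v"
  shows "defect_class g u = defect_class g v \<longleftrightarrow> (\<exists>k \<in> Hom C (Dom C v) (Dom C g). u = Add C (Comp C g k) v)"
proof -
  interpret G: comm_group "hom_group C (Dom C v) (Cod C g)" using g v by (intro Hom_comm_group) simp_all
  have H: "subgroup (hom_image C g (Dom C v)) (hom_group C (Dom C v) (Cod C g))"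
    by (rule hom_image_subgroup) (use g v in simp_all)
  have "defect_class g u = defect_class g v \<longleftrightarrow> u \<in> defect_class g v"
    using G.repr_independence[OF _ _ H, of u v] G.rcos_self[OF _ H, of u] u v
    by (auto simp: defect_class_def hom_group_def)
  also have "\<dots> \<longleftrightarrow> (\<exists>k \<in> Hom C (Dom C v) (Dom C g). u = Add C (Comp C g k) v)"
    by (auto simp: defect_class_def r_coset_def hom_image_def hom_group_def)
  finally show ?thesis .
qed

lemma defect_carrier:
  "carrier (Grp (defect C (f, g)) X) = defect_class g ` Hom C X (Cod C g)"
  by (auto simp: defect_def carrier_FactGroup defect_class_def hom_group_def intro!: image_eqI)

lemma defect_one:
  assumes g: "g \<in> Mor C" and X: "X \<in> Ob C"
  shows "\<one>\<^bsub>Grp (defect C (f, g)) X\<^esub> = defect_class g (Zero C X (Cod C g))"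
proof -
  interpret G: comm_group "hom_group C X (Cod C g)" using g X by (intro Hom_comm_group) simp_all
  have "hom_image C g X #>\<^bsub>hom_group C X (Cod C g)\<^esub> \<one>\<^bsub>hom_group C X (Cod C g)\<^esub> = hom_image C g X"
    using subgroup.subset[OF hom_image_subgroup[OF g X]] by (rule G.coset_mult_one)
  moreover have "\<one>\<^bsub>hom_group C X (Cod C g)\<^esub> = Zero C X (Cod C g)" by (simp add: hom_group_def)
  ultimately show ?thesis using g X by (simp add: defect_def defect_class_def)
qed

lemma defect_mult:
  assumes g: "g \<in> Mor C" and u: "u \<in> Mor C" "Cod C u = Cod C g" and v: "v \<in> Mor C" "Cod C v = Cod C g"
    "Dom C u = X" "Dom C v = X"
  shows "defect_class g u \<otimes>\<^bsub>Grp (defect C (f, g)) X\<^esub> defect_class g v = defect_class g (Add C u v)"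
proof -
  have X: "X \<in> Ob C" using v(1,4) Dom_in[of v] by simp
  interpret G: comm_group "hom_group C X (Cod C g)" using g X by (intro Hom_comm_group) simp_all
  have "hom_image C g X \<lhd> hom_group C X (Cod C g)"
    by (rule G.subgroup_imp_normal[OF hom_image_subgroup[OF g X]])
  from normal.rcos_sum[OF this, of u v] show ?thesis
    using assms by (simp add: defect_def defect_class_def) (simp add: hom_group_def)
qed

lemma defect_act:
  assumes g: "g \<in> Mor C" and u: "u \<in> Mor C" "Cod C u = Cod C g" and h: "h \<in> Mor C" "Cod C h = Dom C u"
  shows "Act (defect C (f, g)) h (defect_class g u) = defect_class g (Comp C u h)"
proof -
  have *: "hom_image C g (Dom C h) #>\<^bsub>hom_group C (Dom C h) (Cod C g)\<^esub> Comp C u' h = defect_class g (Comp C u h)"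
    if "u' \<in> defect_class g u" for u'
  proof -
    obtain k where k: "k \<in> Mor C" "Dom C k = Dom C u" "Cod C k = Dom C g" "u' = Add C (Comp C g k) u"
      using \<open>u' \<in> defect_class g u\<close> by (auto simp: defect_class_def r_coset_def hom_image_def hom_group_def)
    have "defect_class g (Comp C u' h) = defect_class g (Comp C u h)"
      using k g u h by (subst defect_class_eq_iff) (auto intro!: bexI[of _ "Comp C k h"])
    then show ?thesis using k g u h by (simp add: defect_class_def)
  qed
  have "u \<in> defect_class g u"
    using defect_class_eq_iff[OF g u u] unfolding defect_class_def r_coset_def hom_image_def hom_group_def
    using g u by (auto intro!: exI[of _ "Comp C g (Zero C (Dom C u) (Dom C g))"] bexI[of _ "Zero C (Dom C u) (Dom C g)"])
  then show ?thesis using * by (auto simp: defect_def)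
qed

lemma defect_right_module:
  assumes g: "g \<in> Mor C"
  shows "right_module C (defect C (f, g))"
  unfolding right_module_def
proof (intro conjI ballI impI)
  fix X assume X: "X \<in> Ob C"
  interpret G: comm_group "hom_group C X (Cod C g)" using g X by (intro Hom_comm_group) simp_all
  show "comm_group (Grp (defect C (f, g)) X)"
    using G.abelian_FactGroup[OF hom_image_subgroup[OF g X]] by (simp add: defect_def)
qed (use g in \<open>auto simp: defect_carrier defect_act defect_mult hom_def\<close>)

lemma defect_presents:
  assumes g: "g \<in> Mor C"
  shows "presents C g (defect C (f, g)) (defect_class g (Id C (Cod C g)))"
  unfolding presents_def
proof (intro conjI ballI impI)
  fix h assume h: "h \<in> Mor C" "Cod C h = Cod C g"
  have "factors C h g \<longleftrightarrow> (\<exists>k \<in> Hom C (Dom C h) (Dom C g). h = Add C (Comp C g k) (Zero C (Dom C h) (Cod C g)))"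
    using g h by (auto simp: factors_def)
  then show "Act (defect C (f, g)) h (defect_class g (Id C (Cod C g))) = \<one>\<^bsub>Grp (defect C (f, g)) (Dom C h)\<^esub> \<longleftrightarrow> factors C h g"
    using g h by (simp add: defect_act defect_one defect_class_eq_iff)
qed (use g in \<open>auto simp: defect_right_module defect_carrier defect_act\<close>)

end

lemma (in exact_category) eff_iff:
  "M \<in> Ob (eff C E) \<longleftrightarrow> (\<exists>g c. deflation E g \<and> presents C g M c)"
proof
  assume "M \<in> Ob (eff C E)"
  then obtain f g where fg: "(f, g) \<in> E" and iso: "isomorphic (ModCat C) M (defect C (f, g))"
    by (auto simp: eff_def full_subcategory_def)
  have g: "deflation E g" using fg by (auto simp: deflation_def)
  then show "\<exists>g c. deflation E g \<and> presents C g M c"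
    using presents_transport[OF defect_presents[OF deflation_arr[OF g]] iso] by blast
next
  assume "\<exists>g c. deflation E g \<and> presents C g M c"
  then obtain f g c where fg: "(f, g) \<in> E" and p: "presents C g M c" by (auto simp: deflation_def)
  have "isomorphic (ModCat C) M (defect C (f, g))"
    by (rule presents_isomorphic[OF p defect_presents]) (rule presentsD(2)[OF p])
  then show "M \<in> Ob (eff C E)"
    using fg presentsD(1)[OF p] by (auto simp: eff_def full_subcategory_def)
qed

section \<open>Short exact sequences of effaceable modules\<close>

context preadditive_category
begin

text \<open>
  Two elements identified by \<open>\<theta>\<close> differ by an element of its kernel. With the identity as \<open>\<kappa>\<close>
  this becomes the criterion for injectivity below.
\<close>

lemma mod_mor_kernel_le:
  assumes \<theta>: "(M, \<theta>, N) \<in> Mor (ModCat C)" and \<kappa>: "(M, \<kappa>, K) \<in> Mor (ModCat C)"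
    and X: "X \<in> Ob C" and le: "\<And>z. z \<in> carrier (Grp M X) \<Longrightarrow> \<theta> X z = \<one>\<^bsub>Grp N X\<^esub> \<Longrightarrow> \<kappa> X z = \<one>\<^bsub>Grp K X\<^esub>"
    and x: "x \<in> carrier (Grp M X)" and y: "y \<in> carrier (Grp M X)" and eq: "\<theta> X x = \<theta> X y"
  shows "\<kappa> X x = \<kappa> X y"
proof -
  note t = mod_morD[OF \<theta>] and k = mod_morD[OF \<kappa>]
  interpret M: comm_group "Grp M X" by (rule module_group[OF t(1) X])
  interpret N: comm_group "Grp N X" by (rule module_group[OF t(2) X])
  let ?y = "inv\<^bsub>Grp M X\<^esub> y"
  have "\<theta> X (x \<otimes>\<^bsub>Grp M X\<^esub> ?y) = \<theta> X (y \<otimes>\<^bsub>Grp M X\<^esub> ?y)"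
    using t(4)[OF X x, of ?y] t(4)[OF X y, of ?y] y eq by simp
  also have "\<dots> = \<one>\<^bsub>Grp N X\<^esub>" using mod_mor_one[OF \<theta> X] y by simp
  finally have 1: "\<kappa> X (x \<otimes>\<^bsub>Grp M X\<^esub> ?y) = \<one>\<^bsub>Grp K X\<^esub>" using le x y by simp
  have "x = (x \<otimes>\<^bsub>Grp M X\<^esub> ?y) \<otimes>\<^bsub>Grp M X\<^esub> y" using x y by (simp add: M.m_assoc)
  then have "\<kappa> X x = \<kappa> X ((x \<otimes>\<^bsub>Grp M X\<^esub> ?y) \<otimes>\<^bsub>Grp M X\<^esub> y)" by (rule arg_cong)
  also have "\<dots> = \<kappa> X (x \<otimes>\<^bsub>Grp M X\<^esub> ?y) \<otimes>\<^bsub>Grp K X\<^esub> \<kappa> X y"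
    by (rule k(4)[OF X]) (use x y in simp_all)
  also have "\<dots> = \<kappa> X y" using k X y by (simp add: 1)
  finally show ?thesis .
qed

lemma mod_mor_injI:
  assumes \<theta>: "(M, \<theta>, N) \<in> Mor (ModCat C)"
    and X: "X \<in> Ob C" and ker: "\<And>z. z \<in> carrier (Grp M X) \<Longrightarrow> \<theta> X z = \<one>\<^bsub>Grp N X\<^esub> \<Longrightarrow> z = \<one>\<^bsub>Grp M X\<^esub>"
    and x: "x \<in> carrier (Grp M X)" and y: "y \<in> carrier (Grp M X)" and eq: "\<theta> X x = \<theta> X y"
  shows "x = y"
  using mod_mor_kernel_le[OF \<theta> mod_mor_id[OF mod_morD(1)[OF \<theta>]] X _ x y eq] ker X x y by simp

text \<open>
  Exactness at every object of the category, as opposed to the categorical notion of a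
  kernel-cokernel pair in a subcategory of modules.
\<close>

definition short_exact ::
  "('o, 'm, 'g) rmod \<Rightarrow> ('o \<Rightarrow> 'g \<Rightarrow> 'g) \<Rightarrow> ('o, 'm, 'g) rmod \<Rightarrow> ('o \<Rightarrow> 'g \<Rightarrow> 'g) \<Rightarrow> ('o, 'm, 'g) rmod \<Rightarrow> bool" where
  "short_exact L \<eta> M \<theta> Q \<longleftrightarrow> (L, \<eta>, M) \<in> Mor (ModCat C) \<and> (M, \<theta>, Q) \<in> Mor (ModCat C) \<and>
     (\<forall>X \<in> Ob C. \<forall>x \<in> carrier (Grp L X). \<eta> X x = \<one>\<^bsub>Grp M X\<^esub> \<longrightarrow> x = \<one>\<^bsub>Grp L X\<^esub>) \<and>
     (\<forall>X \<in> Ob C. \<forall>y \<in> carrier (Grp M X). \<theta> X y = \<one>\<^bsub>Grp Q X\<^esub> \<longleftrightarrow> (\<exists>x \<in> carrier (Grp L X). y = \<eta> X x)) \<and>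
     (\<forall>X \<in> Ob C. \<forall>z \<in> carrier (Grp Q X). \<exists>y \<in> carrier (Grp M X). z = \<theta> X y)"

lemma short_exactD:
  assumes "short_exact L \<eta> M \<theta> Q"
  shows "(L, \<eta>, M) \<in> Mor (ModCat C)" "(M, \<theta>, Q) \<in> Mor (ModCat C)"
    "\<And>X x. X \<in> Ob C \<Longrightarrow> x \<in> carrier (Grp L X) \<Longrightarrow> \<eta> X x = \<one>\<^bsub>Grp M X\<^esub> \<Longrightarrow> x = \<one>\<^bsub>Grp L X\<^esub>"
    "\<And>X y. X \<in> Ob C \<Longrightarrow> y \<in> carrier (Grp M X) \<Longrightarrow>
       \<theta> X y = \<one>\<^bsub>Grp Q X\<^esub> \<longleftrightarrow> (\<exists>x \<in> carrier (Grp L X). y = \<eta> X x)"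
    "\<And>X z. X \<in> Ob C \<Longrightarrow> z \<in> carrier (Grp Q X) \<Longrightarrow> \<exists>y \<in> carrier (Grp M X). z = \<theta> X y"
  using assms unfolding short_exact_def by blast+

text \<open>
  The defect of a pull-back of \<open>g\<close> along \<open>v\<close> is the submodule generated by the class of \<open>v\<close>: by the
  universal property of the pull-back, \<open>v \<circ> h\<close> factors through \<open>g\<close> if and only if \<open>h\<close> factors
  through \<open>p\<close>.
\<close>

lemma presents_pullback_mor:
  assumes p: "presents C g M c" and pb: "is_pullback C g v p v'" and q: "presents C p L l"
  obtains \<eta> where "(L, \<eta>, M) \<in> Mor (ModCat C)"
    "\<And>h. h \<in> Mor C \<Longrightarrow> Cod C h = Dom C v \<Longrightarrow> \<eta> (Dom C h) (Act L h l) = Act M (Comp C v h) c"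
    "\<And>X y. X \<in> Ob C \<Longrightarrow> y \<in> carrier (Grp L X) \<Longrightarrow> \<eta> X y = \<one>\<^bsub>Grp M X\<^esub> \<Longrightarrow> y = \<one>\<^bsub>Grp L X\<^esub>"
proof -
  note M = presentsD[OF p] and L = presentsD[OF q] and d = is_pullbackD[OF pb]
  let ?x = "Act M v c"
  have xx: "?x \<in> carrier (Grp M (Cod C p))" using M(1-3) d by simp
  have x: "Act M h ?x = Act M (Comp C v h) c" if "h \<in> Mor C" "Cod C h = Dom C v" for h
    using that M(1-3) d by simp
  have "factors C (Comp C v p) g"
    by (rule factorsI[of v']) (use d in simp_all)
  then have "Act M p ?x = \<one>\<^bsub>Grp M (Dom C p)\<^esub>"
    using x[of p] M(4)[of "Comp C v p"] d by simp
  then obtain \<eta> where \<eta>: "(L, \<eta>, M) \<in> Mor (ModCat C)"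
    "\<And>h. h \<in> Mor C \<Longrightarrow> Cod C h = Cod C p \<Longrightarrow> \<eta> (Dom C h) (Act L h l) = Act M h ?x"
    using presents_mor_ex[OF q M(1) xx] by metis
  show thesis
  proof (rule that[OF \<eta>(1)])
    fix h assume "h \<in> Mor C" "Cod C h = Dom C v"
    then show "\<eta> (Dom C h) (Act L h l) = Act M (Comp C v h) c"
      using \<eta>(2)[of h] x[of h] d by simp
  next
    fix X y assume X: "X \<in> Ob C" and y: "y \<in> carrier (Grp L X)" and 1: "\<eta> X y = \<one>\<^bsub>Grp M X\<^esub>"
    obtain h where h: "h \<in> Mor C" "Dom C h = X" "Cod C h = Cod C p" "y = Act L h l"
      using presents_elem[OF q X y] by metis
    have "Act M (Comp C v h) c = \<one>\<^bsub>Grp M X\<^esub>" using \<eta>(2)[of h] x[of h] h 1 d by simp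
    then have "factors C (Comp C v h) g" using M(4)[of "Comp C v h"] h d by simp
    then obtain k where k: "k \<in> Mor C" "Dom C k = Dom C (Comp C v h)" "Cod C k = Dom C g" "Comp C v h = Comp C g k"
      by (rule factorsE)
    have "Dom C k = Dom C h" using k(2) h d by simp
    then obtain m where "m \<in> Mor C" "Dom C m = Dom C h" "Cod C m = Dom C p" "Comp C p m = h"
      using pullback_lift[OF pb h(1) k(1)] h k d by metis
    then have "factors C h p" by (intro factorsI[of m]) simp_all
    then show "y = \<one>\<^bsub>Grp L X\<^esub>" using L(4)[of h] h by simp
  qed
qed

lemma presents_quotient_mor:
  assumes p: "presents C g M c" and q: "presents C w Q d" and w: "Cod C w = Cod C g" "factors C g w"
  obtains \<theta> where "(M, \<theta>, Q) \<in> Mor (ModCat C)"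
    "\<And>h. h \<in> Mor C \<Longrightarrow> Cod C h = Cod C g \<Longrightarrow> \<theta> (Dom C h) (Act M h c) = Act Q h d"
proof -
  note M = presentsD[OF p] and Q = presentsD[OF q]
  have "Act Q g d = \<one>\<^bsub>Grp Q (Dom C g)\<^esub>" using Q(4)[of g] M w by simp
  then show thesis using presents_mor_ex[OF p Q(1), of d] Q w that by metis
qed

text \<open>
  The submodule generated by the class of \<open>v\<close> and the quotient by it. The assumptions on \<open>w\<close> say
  that a morphism factors through \<open>w\<close> if and only if it is a sum of one that factors through
  \<open>g\<close> and one that factors through \<open>v\<close>, as is the case for \<open>w = [g, v]\<close>.
\<close>

lemma pullback_copair_exact:
  assumes p: "presents C g M c" and pb: "is_pullback C g v p v'" and q: "presents C p L l"
    and r: "presents C w Q d" and w: "Cod C w = Cod C g" "factors C g w" "factors C v w"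
    and sum: "\<And>h. h \<in> Mor C \<Longrightarrow> factors C h w \<Longrightarrow> \<exists>a b. a \<in> Mor C \<and> b \<in> Mor C \<and> Cod C a = Dom C g \<and>
       Cod C b = Dom C v \<and> Dom C a = Dom C h \<and> Dom C b = Dom C h \<and> h = Add C (Comp C g a) (Comp C v b)"
  shows "\<exists>\<eta> \<theta>. short_exact L \<eta> M \<theta> Q"
proof -
  note M = presentsD[OF p] and L = presentsD[OF q] and Q = presentsD[OF r] and pd = is_pullbackD[OF pb]
  obtain \<eta> where \<eta>: "(L, \<eta>, M) \<in> Mor (ModCat C)"
    "\<And>h. h \<in> Mor C \<Longrightarrow> Cod C h = Dom C v \<Longrightarrow> \<eta> (Dom C h) (Act L h l) = Act M (Comp C v h) c"
    "\<And>X y. X \<in> Ob C \<Longrightarrow> y \<in> carrier (Grp L X) \<Longrightarrow> \<eta> X y = \<one>\<^bsub>Grp M X\<^esub> \<Longrightarrow> y = \<one>\<^bsub>Grp L X\<^esub>"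
    using presents_pullback_mor[OF p pb q] by metis
  obtain \<theta> where \<theta>: "(M, \<theta>, Q) \<in> Mor (ModCat C)"
    "\<And>h. h \<in> Mor C \<Longrightarrow> Cod C h = Cod C g \<Longrightarrow> \<theta> (Dom C h) (Act M h c) = Act Q h d"
    using presents_quotient_mor[OF p r w(1,2)] by metis
  have "short_exact L \<eta> M \<theta> Q"
    unfolding short_exact_def
  proof (intro conjI ballI impI iffI)
    fix X y assume X: "X \<in> Ob C" and y: "y \<in> carrier (Grp M X)" and 1: "\<theta> X y = \<one>\<^bsub>Grp Q X\<^esub>"
    obtain h where h: "h \<in> Mor C" "Dom C h = X" "Cod C h = Cod C g" "y = Act M h c"
      using presents_elem[OF p X y] by metis
    have "factors C h w" using 1 \<theta>(2)[of h] Q(4)[of h] h w by simp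
    then obtain a b where ab: "a \<in> Mor C" "b \<in> Mor C" "Cod C a = Dom C g"
       "Cod C b = Dom C v" "Dom C a = Dom C h" "Dom C b = Dom C h" "h = Add C (Comp C g a) (Comp C v b)"
      using sum[OF h(1)] by blast
    have "y = Act M (Add C (Comp C g a) (Comp C v b)) c" using h(4) by (simp only: ab(7)[symmetric])
    also have "\<dots> = Act M (Comp C v b) c"
      using ab(1-6) M(1-3) h(1-3) pd presents_relation[OF p] X by simp
    also have "\<dots> = \<eta> X (Act L b l)" using \<eta>(2)[of b] ab(1-6) h(2) by simp
    finally show "\<exists>x \<in> carrier (Grp L X). y = \<eta> X x"
      by (rule bexI) (use L(1,3) pd ab(1-6) h(2) in simp)
  next
    fix X y assume X: "X \<in> Ob C" and y: "y \<in> carrier (Grp M X)" and "\<exists>x \<in> carrier (Grp L X). y = \<eta> X x"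
    then obtain x where x: "x \<in> carrier (Grp L X)" "y = \<eta> X x" by blast
    obtain b where b: "b \<in> Mor C" "Dom C b = X" "Cod C b = Cod C p" "x = Act L b l"
      using presents_elem[OF q X x(1)] by metis
    have "factors C (Comp C v b) w" by (rule factors_comp[OF w(3)]) (use b pd Q in simp_all)
    moreover have "\<theta> X y = Act Q (Comp C v b) d"
      using x \<eta>(2)[of b] \<theta>(2)[of "Comp C v b"] b pd by simp
    ultimately show "\<theta> X y = \<one>\<^bsub>Grp Q X\<^esub>" using Q(4)[of "Comp C v b"] b pd w by simp
  next
    fix X z assume X: "X \<in> Ob C" and z: "z \<in> carrier (Grp Q X)"
    obtain h where h: "h \<in> Mor C" "Dom C h = X" "Cod C h = Cod C w" "z = Act Q h d"
      using presents_elem[OF r X z] by metis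
    show "\<exists>y \<in> carrier (Grp M X). z = \<theta> X y"
      by (rule bexI[of _ "Act M h c"]) (use h \<theta>(2)[of h] w M in simp_all)
  qed (use \<eta> \<theta> in auto)
  then show ?thesis by blast
qed

end

context exact_category
begin

lemma eff_simps [simp]:
  "(M, \<eta>, N) \<in> Mor (eff C E) \<longleftrightarrow> (M, \<eta>, N) \<in> Mor (ModCat C) \<and> M \<in> Ob (eff C E) \<and> N \<in> Ob (eff C E)"
  "Dom (eff C E) = Dom (ModCat C)" "Cod (eff C E) = Cod (ModCat C)" "Comp (eff C E) = Comp (ModCat C)"
  "Zero (eff C E) = Zero (ModCat C)"
  by (simp_all add: eff_def full_subcategory_def del: ModCat_simps(2))

text \<open>
  All objects have a single generator, hence both factorisations are constructed, and compared, by
  their values on a generator.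
\<close>

lemma short_exact_kcp:
  assumes s: "short_exact L \<eta> M \<theta> Q" and ob: "L \<in> Ob (eff C E)" "M \<in> Ob (eff C E)" "Q \<in> Ob (eff C E)"
  shows "kernel_cokernel_pair (eff C E) (L, \<eta>, M) (M, \<theta>, Q)"
proof -
  note s = short_exactD[OF s]
  note \<eta> = mod_morD[OF s(1)] and \<theta> = mod_morD[OF s(2)]
  have zero: "Comp (ModCat C) (M, \<theta>, Q) (L, \<eta>, M) = Zero (ModCat C) L Q"
    using s(4) \<eta>(3) by (auto simp: restrict_def fun_eq_iff)
  have inj: "x = y" if "X \<in> Ob C" "x \<in> carrier (Grp L X)" "y \<in> carrier (Grp L X)" "\<eta> X x = \<eta> X y" for X x y
    using mod_mor_injI[OF s(1) that(1) s(3)[OF that(1)] that(2-4)] .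
  have "is_kernel (eff C E) (L, \<eta>, M) (M, \<theta>, Q)"
    unfolding is_kernel_def
  proof (intro conjI ballI impI)
    fix h assume h: "h \<in> Mor (eff C E)" "Cod (eff C E) h = Dom (eff C E) (M, \<theta>, Q) \<and>
      Comp (eff C E) (M, \<theta>, Q) h = Zero (eff C E) (Dom (eff C E) h) (Cod (eff C E) (M, \<theta>, Q))"
    obtain K \<kappa> where hK: "h = (K, \<kappa>, M)" using h by (cases h) simp
    have \<kappa>: "(K, \<kappa>, M) \<in> Mor (ModCat C)" and K: "K \<in> Ob (eff C E)"
      using h unfolding hK by (simp_all del: ModCat_simps(2))
    have 0: "(\<lambda>X \<in> Ob C. \<lambda>x \<in> carrier (Grp K X). \<theta> X (\<kappa> X x)) =
        (\<lambda>X \<in> Ob C. \<lambda>x \<in> carrier (Grp K X). \<one>\<^bsub>Grp Q X\<^esub>)"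
      using h unfolding hK by simp
    have \<theta>\<kappa>: "\<theta> X (\<kappa> X x) = \<one>\<^bsub>Grp Q X\<^esub>" if "X \<in> Ob C" "x \<in> carrier (Grp K X)" for X x
      using fun_cong[OF fun_cong[OF 0], of X x] that by simp
    obtain g k where p: "presents C g K k" using K eff_iff by blast
    note P = presentsD[OF p] and \<kappa>' = mod_morD[OF \<kappa>]
    obtain l where l: "l \<in> carrier (Grp L (Cod C g))" "\<kappa> (Cod C g) k = \<eta> (Cod C g) l"
      using \<theta>\<kappa>[of "Cod C g" k] s(4)[of "Cod C g" "\<kappa> (Cod C g) k"] P(2,3) \<kappa>'(3) by auto
    have "\<eta> (Dom C g) (Act L g l) = Act M g (\<kappa> (Cod C g) k)" using \<eta>(5)[OF P(2) l(1)] l(2) by simp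
    also have "\<dots> = \<one>\<^bsub>Grp M (Dom C g)\<^esub>"
      using \<kappa>'(5)[OF P(2,3)] presents_relation[OF p] mod_mor_one[OF \<kappa>, of "Dom C g"] P(2) by simp
    finally have "Act L g l = \<one>\<^bsub>Grp L (Dom C g)\<^esub>" using s(3) \<eta>(1) P(2) l(1) by simp
    then obtain \<rho> where \<rho>: "(K, \<rho>, L) \<in> Mor (ModCat C)" "\<rho> (Cod C g) k = l"
      using presents_mor_ex[OF p \<eta>(1) l(1)] by metis
    have ex: "(\<lambda>X \<in> Ob C. \<lambda>x \<in> carrier (Grp K X). \<eta> X (\<rho> X x)) = \<kappa>"
      by (rule presents_mor_ext[OF p mod_mor_comp[OF \<rho>(1) s(1)] \<kappa>]) (use P l \<rho> in simp)
    have uniq: "\<rho>' = \<rho>" if "(K, \<rho>', L) \<in> Mor (ModCat C)"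
      "(\<lambda>X \<in> Ob C. \<lambda>x \<in> carrier (Grp K X). \<eta> X (\<rho>' X x)) = \<kappa>" for \<rho>'
    proof (rule presents_mor_ext[OF p that(1) \<rho>(1)])
      have "\<eta> (Cod C g) (\<rho>' (Cod C g) k) = \<kappa> (Cod C g) k"
        using fun_cong[OF fun_cong[OF that(2)], of "Cod C g" k] P by simp
      then show "\<rho>' (Cod C g) k = \<rho> (Cod C g) k"
        using inj[of "Cod C g" "\<rho>' (Cod C g) k" l] mod_morD(3)[OF that(1)] l P \<rho>(2) by simp
    qed
    show "\<exists>!k. k \<in> Hom (eff C E) (Dom (eff C E) h) (Dom (eff C E) (L, \<eta>, M)) \<and>
        Comp (eff C E) (L, \<eta>, M) k = h"
    proof (rule ex1I[of _ "(K, \<rho>, L)"])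
      show "(K, \<rho>, L) \<in> Hom (eff C E) (Dom (eff C E) h) (Dom (eff C E) (L, \<eta>, M)) \<and>
        Comp (eff C E) (L, \<eta>, M) (K, \<rho>, L) = h"
        using \<rho>(1) K ob ex by (simp add: hK del: ModCat_simps(2))
      fix k assume k: "k \<in> Hom (eff C E) (Dom (eff C E) h) (Dom (eff C E) (L, \<eta>, M)) \<and>
        Comp (eff C E) (L, \<eta>, M) k = h"
      obtain K' \<rho>' L' where k': "k = (K', \<rho>', L')" by (cases k)
      show "k = (K, \<rho>, L)"
      proof -
        have "K' = K" "L' = L" using k unfolding k' hK by (simp_all del: ModCat_simps(2))
        then show ?thesis using k uniq[of \<rho>'] unfolding k' hK by (simp del: ModCat_simps(2))
      qed
    qed
  qed (use s ob zero in \<open>simp_all del: ModCat_simps(2,5,6)\<close>)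
  moreover have "is_cokernel (eff C E) (M, \<theta>, Q) (L, \<eta>, M)"
    unfolding is_cokernel_def
  proof (intro conjI ballI impI)
    fix h assume h: "h \<in> Mor (eff C E)" "Dom (eff C E) h = Cod (eff C E) (L, \<eta>, M) \<and>
      Comp (eff C E) h (L, \<eta>, M) = Zero (eff C E) (Dom (eff C E) (L, \<eta>, M)) (Cod (eff C E) h)"
    obtain K \<kappa> where hK: "h = (M, \<kappa>, K)" using h by (cases h) simp
    have \<kappa>: "(M, \<kappa>, K) \<in> Mor (ModCat C)" and K: "K \<in> Ob (eff C E)"
      using h unfolding hK by (simp_all del: ModCat_simps(2))
    note \<kappa>' = mod_morD[OF \<kappa>]
    have 0: "(\<lambda>X \<in> Ob C. \<lambda>x \<in> carrier (Grp L X). \<kappa> X (\<eta> X x)) =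
        (\<lambda>X \<in> Ob C. \<lambda>x \<in> carrier (Grp L X). \<one>\<^bsub>Grp K X\<^esub>)"
      using h unfolding hK by simp
    have \<kappa>\<eta>: "\<kappa> X (\<eta> X x) = \<one>\<^bsub>Grp K X\<^esub>" if "X \<in> Ob C" "x \<in> carrier (Grp L X)" for X x
      using fun_cong[OF fun_cong[OF 0], of X x] that by simp
    have ker: "\<kappa> X z = \<one>\<^bsub>Grp K X\<^esub>" if "X \<in> Ob C" "z \<in> carrier (Grp M X)" "\<theta> X z = \<one>\<^bsub>Grp Q X\<^esub>" for X z
      using s(4)[OF that(1,2)] that(1,3) \<kappa>\<eta> by auto
    obtain g c where p: "presents C g Q c" using ob eff_iff by blast
    note P = presentsD[OF p]
    obtain m where m: "m \<in> carrier (Grp M (Cod C g))" "c = \<theta> (Cod C g) m"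
      using s(5)[of "Cod C g" c] P by auto
    let ?n = "\<kappa> (Cod C g) m"
    have "\<theta> (Dom C g) (Act M g m) = \<one>\<^bsub>Grp Q (Dom C g)\<^esub>"
      using \<theta>(5)[OF P(2) m(1)] m(2) presents_relation[OF p] by simp
    then have "Act K g ?n = \<one>\<^bsub>Grp K (Dom C g)\<^esub>"
      using ker[of "Dom C g" "Act M g m"] \<kappa>'(5)[OF P(2) m(1)] P(2) m(1) \<theta>(1) by simp
    then obtain \<rho> where \<rho>: "(Q, \<rho>, K) \<in> Mor (ModCat C)" "\<rho> (Cod C g) c = ?n"
      "\<And>h. h \<in> Mor C \<Longrightarrow> Cod C h = Cod C g \<Longrightarrow> \<rho> (Dom C h) (Act Q h c) = Act K h ?n"
      using presents_mor_ex[OF p \<kappa>'(2), of ?n] \<kappa>'(3)[OF _ m(1)] P(2) by (metis Cod_in)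
    have ex: "(\<lambda>X \<in> Ob C. \<lambda>x \<in> carrier (Grp M X). \<rho> X (\<theta> X x)) = \<kappa>"
    proof (rule mod_mor_eqI[OF mod_mor_comp[OF s(2) \<rho>(1)] \<kappa>])
      fix X y assume X: "X \<in> Ob C" and y: "y \<in> carrier (Grp M X)"
      obtain h where h: "h \<in> Mor C" "Dom C h = X" "Cod C h = Cod C g" "\<theta> X y = Act Q h c"
        using presents_elem[OF p X \<theta>(3)[OF X y]] by metis
      have "\<theta> X y = \<theta> X (Act M h m)" using \<theta>(5)[of h m] h m by simp
      then have "\<kappa> X y = \<kappa> X (Act M h m)"
        using mod_mor_kernel_le[OF s(2) \<kappa> X ker[OF X] y, of "Act M h m"] h m \<theta>(1) by simp
      also have "\<dots> = \<rho> X (\<theta> X y)" using \<kappa>'(5)[of h m] \<rho>(3)[of h] h m by simp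
      finally show "(\<lambda>X \<in> Ob C. \<lambda>x \<in> carrier (Grp M X). \<rho> X (\<theta> X x)) X y = \<kappa> X y" using X y by simp
    qed
    have uniq: "\<rho>' = \<rho>" if "(Q, \<rho>', K) \<in> Mor (ModCat C)"
      "(\<lambda>X \<in> Ob C. \<lambda>x \<in> carrier (Grp M X). \<rho>' X (\<theta> X x)) = \<kappa>" for \<rho>'
    proof (rule presents_mor_ext[OF p that(1) \<rho>(1)])
      show "\<rho>' (Cod C g) c = \<rho> (Cod C g) c"
        using fun_cong[OF fun_cong[OF that(2)], of "Cod C g" m] P m \<rho>(2) by simp
    qed
    show "\<exists>!k. k \<in> Hom (eff C E) (Cod (eff C E) (M, \<theta>, Q)) (Cod (eff C E) h) \<and>
        Comp (eff C E) k (M, \<theta>, Q) = h"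
    proof (rule ex1I[of _ "(Q, \<rho>, K)"])
      show "(Q, \<rho>, K) \<in> Hom (eff C E) (Cod (eff C E) (M, \<theta>, Q)) (Cod (eff C E) h) \<and>
        Comp (eff C E) (Q, \<rho>, K) (M, \<theta>, Q) = h"
        using \<rho>(1) K ob ex by (simp add: hK del: ModCat_simps(2))
      fix k assume k: "k \<in> Hom (eff C E) (Cod (eff C E) (M, \<theta>, Q)) (Cod (eff C E) h) \<and>
        Comp (eff C E) k (M, \<theta>, Q) = h"
      obtain Q' \<rho>' K' where k': "k = (Q', \<rho>', K')" by (cases k)
      show "k = (Q, \<rho>, K)"
      proof -
        have "Q' = Q" "K' = K" using k unfolding k' hK by (simp_all del: ModCat_simps(2))
        then show ?thesis using k uniq[of \<rho>'] unfolding k' hK by (simp del: ModCat_simps(2))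
      qed
    qed
  qed (use s ob zero in \<open>simp_all del: ModCat_simps(2,5,6)\<close>)
  ultimately show ?thesis by (simp add: kernel_cokernel_pair_def)
qed

text \<open>
  Submodules generated by one element of an effaceable module are effaceable. They serve as test
  objects in place of the representable modules, which are not effaceable in general.
\<close>

lemma eff_cyclic:
  assumes M: "M \<in> Ob (eff C E)" and X: "X \<in> Ob C" and x: "x \<in> carrier (Grp M X)"
  obtains p L l \<eta> where "presents C p L l" "L \<in> Ob (eff C E)" "Cod C p = X" "(L, \<eta>, M) \<in> Mor (ModCat C)" "\<eta> X l = x"
proof -
  obtain g c where g: "deflation E g" and m: "presents C g M c" using M eff_iff by blast
  obtain v where v: "v \<in> Mor C" "Dom C v = X" "Cod C v = Cod C g" "x = Act M v c"
    using presents_elem[OF m X x] by metis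
  obtain p v' where pb: "is_pullback C g v p v'" and p: "deflation E p" using pullback_ex[OF g v(1,3)] by blast
  note L = defect_presents[OF deflation_arr[OF p], of undefined]
  have "defect C (undefined, p) \<in> Ob (eff C E)" using eff_iff p L by blast
  moreover obtain \<eta> where \<eta>: "(defect C (undefined, p), \<eta>, M) \<in> Mor (ModCat C)"
    "\<And>h. h \<in> Mor C \<Longrightarrow> Cod C h = Dom C v \<Longrightarrow>
      \<eta> (Dom C h) (Act (defect C (undefined, p)) h (defect_class p (Id C (Cod C p)))) = Act M (Comp C v h) c"
    using presents_pullback_mor[OF m pb L] by metis
  moreover have cod: "Cod C p = X" using is_pullbackD(6)[OF pb] v(2) by simp
  moreover have "\<eta> X (defect_class p (Id C (Cod C p))) = x"
    using \<eta>(2)[of "Id C X"] v X cod presentsD(1)[OF L] presentsD(3)[OF L, unfolded cod] by simp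
  ultimately show thesis using that[OF L] by blast
qed

text \<open>
  An element in the kernel of \<open>\<eta>\<close> or of \<open>\<theta>\<close> is the value at a generator of a morphism from an
  effaceable module, to which the universal property of the kernel applies. For the surjectivity
  of \<open>\<theta>\<close> the test object is the quotient of \<open>Q\<close> by the image of \<open>\<theta>\<close>, which is the defect of a
  morphism \<open>[g2, u]\<close> and so is effaceable.
\<close>

lemma kcp_short_exact:
  assumes "kernel_cokernel_pair (eff C E) i p"
  obtains L \<eta> M \<theta> Q where "i = (L, \<eta>, M)" "p = (M, \<theta>, Q)" "short_exact L \<eta> M \<theta> Q"
    "L \<in> Ob (eff C E)" "M \<in> Ob (eff C E)" "Q \<in> Ob (eff C E)"
proof -
  have ker: "is_kernel (eff C E) i p" and coker: "is_cokernel (eff C E) p i"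
    using assms by (auto simp: kernel_cokernel_pair_def)
  obtain L \<eta> M where i: "i = (L, \<eta>, M)" by (cases i)
  obtain \<theta> Q where p: "p = (M, \<theta>, Q)"
    using ker unfolding is_kernel_def i by (cases p) simp
  have ob: "L \<in> Ob (eff C E)" "M \<in> Ob (eff C E)" "Q \<in> Ob (eff C E)"
    and mor: "(L, \<eta>, M) \<in> Mor (ModCat C)" "(M, \<theta>, Q) \<in> Mor (ModCat C)"
    and zero: "Comp (ModCat C) (M, \<theta>, Q) (L, \<eta>, M) = Zero (ModCat C) L Q"
    using ker unfolding is_kernel_def i p by (auto simp del: ModCat_simps(2,5,6))
  note \<eta> = mod_morD[OF mor(1)] and \<theta> = mod_morD[OF mor(2)]
  have 0: "(\<lambda>X \<in> Ob C. \<lambda>x \<in> carrier (Grp L X). \<theta> X (\<eta> X x)) =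
        (\<lambda>X \<in> Ob C. \<lambda>x \<in> carrier (Grp L X). \<one>\<^bsub>Grp Q X\<^esub>)"
    using zero by simp
  have \<theta>\<eta>: "\<theta> X (\<eta> X x) = \<one>\<^bsub>Grp Q X\<^esub>" if "X \<in> Ob C" "x \<in> carrier (Grp L X)" for X x
    using fun_cong[OF fun_cong[OF 0], of X x] that by simp
  have lift: "\<exists>!k. k \<in> Hom (eff C E) K L \<and> Comp (ModCat C) (L, \<eta>, M) k = (K, \<kappa>, M)"
    if "K \<in> Ob (eff C E)" "(K, \<kappa>, M) \<in> Mor (ModCat C)" "\<And>X x. X \<in> Ob C \<Longrightarrow> x \<in> carrier (Grp K X) \<Longrightarrow> \<theta> X (\<kappa> X x) = \<one>\<^bsub>Grp Q X\<^esub>"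
    for K \<kappa>
  proof -
    have "\<forall>h \<in> Mor (eff C E). Cod (eff C E) h = Dom (eff C E) p \<and>
        Comp (eff C E) p h = Zero (eff C E) (Dom (eff C E) h) (Cod (eff C E) p) \<longrightarrow>
        (\<exists>!k. k \<in> Hom (eff C E) (Dom (eff C E) h) (Dom (eff C E) i) \<and> Comp (eff C E) i k = h)"
      using ker unfolding is_kernel_def by blast
    from this[rule_format, of "(K, \<kappa>, M)"] show ?thesis
      unfolding i p using that ob by (simp del: ModCat_simps(2) Hom_iff cong: restrict_cong)
  qed
  have "short_exact L \<eta> M \<theta> Q"
    unfolding short_exact_def
  proof (intro conjI ballI impI iffI)
    fix X x assume X: "X \<in> Ob C" and x: "x \<in> carrier (Grp L X)" and 1: "\<eta> X x = \<one>\<^bsub>Grp M X\<^esub>"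
    obtain q K k \<rho> where q: "presents C q K k" "K \<in> Ob (eff C E)" "Cod C q = X"
      and \<rho>: "(K, \<rho>, L) \<in> Mor (ModCat C)" "\<rho> X k = x"
      using eff_cyclic[OF ob(1) X x] by metis
    note K = presentsD[OF q(1)]
    note z = mod_mor_zero[OF K(1) \<eta>(2)] and z' = mod_mor_zero[OF K(1) \<eta>(1)]
    let ?z = "\<lambda>X \<in> Ob C. \<lambda>x \<in> carrier (Grp K X). \<one>\<^bsub>Grp M X\<^esub>"
    let ?z' = "\<lambda>X \<in> Ob C. \<lambda>x \<in> carrier (Grp K X). \<one>\<^bsub>Grp L X\<^esub>"
    have uniq: "\<exists>!k. k \<in> Hom (eff C E) K L \<and> Comp (ModCat C) (L, \<eta>, M) k = (K, ?z, M)"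
      by (rule lift[OF q(2) z]) (use mod_mor_one[OF mor(2)] in simp)
    have c1: "Comp (ModCat C) (L, \<eta>, M) (K, \<rho>, L) = (K, ?z, M)"
      using presents_mor_ext[OF q(1) mod_mor_comp[OF \<rho>(1) mor(1)] z] q(3) K(3) X \<rho>(2) 1 by simp
    have c2: "Comp (ModCat C) (L, \<eta>, M) (K, ?z', L) = (K, ?z, M)"
      using mod_mor_one[OF mor(1)] by (simp cong: restrict_cong)
    have "(K, \<rho>, L) \<in> Hom (eff C E) K L" "(K, ?z', L) \<in> Hom (eff C E) K L"
      using \<rho>(1) z' q(2) ob by (simp_all del: ModCat_simps(2))
    then have "(K, \<rho>, L) = (K, ?z', L)"
      using uniq c1 c2 by blast
    then show "x = \<one>\<^bsub>Grp L X\<^esub>" using \<rho>(2) K(3) q(3) X by auto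
  next
    fix X y assume X: "X \<in> Ob C" and y: "y \<in> carrier (Grp M X)" and 1: "\<theta> X y = \<one>\<^bsub>Grp Q X\<^esub>"
    obtain q K k \<rho> where q: "presents C q K k" "K \<in> Ob (eff C E)" "Cod C q = X"
      and \<rho>: "(K, \<rho>, M) \<in> Mor (ModCat C)" "\<rho> X k = y"
      using eff_cyclic[OF ob(2) X y] by metis
    note K = presentsD[OF q(1)]
    have 2: "(\<lambda>X \<in> Ob C. \<lambda>x \<in> carrier (Grp K X). \<theta> X (\<rho> X x)) = (\<lambda>X \<in> Ob C. \<lambda>x \<in> carrier (Grp K X). \<one>\<^bsub>Grp Q X\<^esub>)"
      by (rule presents_mor_ext[OF q(1) mod_mor_comp[OF \<rho>(1) mor(2)] mod_mor_zero[OF K(1) \<theta>(2)]])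
        (use q(3) X K(3) \<rho>(2) 1 in simp)
    have "\<theta> Y (\<rho> Y x) = \<one>\<^bsub>Grp Q Y\<^esub>" if "Y \<in> Ob C" "x \<in> carrier (Grp K Y)" for Y x
      using fun_cong[OF fun_cong[OF 2], of Y x] that by simp
    from lift[OF q(2) \<rho>(1) this] obtain k' where k': "k' \<in> Hom (eff C E) K L"
      "Comp (ModCat C) (L, \<eta>, M) k' = (K, \<rho>, M)" by blast
    obtain \<sigma> where \<sigma>: "k' = (K, \<sigma>, L)" "(K, \<sigma>, L) \<in> Mor (ModCat C)"
    proof -
      obtain K' \<sigma> L' where "k' = (K', \<sigma>, L')" by (cases k')
      moreover from this have "K' = K" "L' = L" using k'(1) by (simp_all del: ModCat_simps(2))
      ultimately show thesis using k'(1) that[of \<sigma>] by (simp del: ModCat_simps(2))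
    qed
    have "(\<lambda>X \<in> Ob C. \<lambda>x \<in> carrier (Grp K X). \<eta> X (\<sigma> X x)) = \<rho>" using k'(2) \<sigma>(1) by simp
    from fun_cong[OF fun_cong[OF this], of X k] have "\<eta> X (\<sigma> X k) = y" using X K(3) q(3) \<rho>(2) by simp
    then show "\<exists>x \<in> carrier (Grp L X). y = \<eta> X x"
      using mod_morD(3)[OF \<sigma>(2) X] K(3) q(3) by auto
  next
    fix X z assume X: "X \<in> Ob C" and z: "z \<in> carrier (Grp Q X)"
    obtain g c where m: "presents C g M c" using ob eff_iff by blast
    obtain g2 c2 where g2: "deflation E g2" and q: "presents C g2 Q c2" using ob eff_iff by blast
    note M = presentsD[OF m] and Q = presentsD[OF q]
    let ?d = "\<theta> (Cod C g) c"
    have d: "?d \<in> carrier (Grp Q (Cod C g))" using \<theta>(3) M by simp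
    obtain u where u: "u \<in> Mor C" "Dom C u = Cod C g" "Cod C u = Cod C g2" "?d = Act Q u c2"
      using presents_elem[OF q _ d] M(2) by (metis Cod_in)
    \<comment> \<open>The image of \<open>\<theta>\<close> is generated by \<open>\<theta>\<close> of the generator of \<open>M\<close>, which is represented by \<open>u\<close>.
      The quotient by it vanishes, so that the identity factors through \<open>w = [g2, u]\<close>.\<close>
    obtain w where w: "deflation E w" "Cod C w = Cod C g2" "factors C g2 w" "factors C u w"
      "\<And>h. h \<in> Mor C \<Longrightarrow> factors C h w \<Longrightarrow> \<exists>a b. a \<in> Mor C \<and> b \<in> Mor C \<and> Cod C a = Dom C g2 \<and>
        Cod C b = Dom C u \<and> Dom C a = Dom C h \<and> Dom C b = Dom C h \<and> h = Add C (Comp C g2 a) (Comp C u b)"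
      using copair_deflation_ex[OF g2 u(1,3)] by metis
    let ?K = "defect C (undefined, w)" and ?k = "defect_class w (Id C (Cod C w))"
    note k = defect_presents[OF deflation_arr[OF w(1)], of undefined]
    note K = presentsD[OF k]
    have Kob: "?K \<in> Ob (eff C E)" using eff_iff w(1) k by blast
    obtain \<rho> where \<rho>: "(Q, \<rho>, ?K) \<in> Mor (ModCat C)"
      "\<And>h. h \<in> Mor C \<Longrightarrow> Cod C h = Cod C g2 \<Longrightarrow> \<rho> (Dom C h) (Act Q h c2) = Act ?K h ?k"
      using presents_quotient_mor[OF q k w(2,3)] by metis
    let ?z = "\<lambda>X \<in> Ob C. \<lambda>x \<in> carrier (Grp Q X). \<one>\<^bsub>Grp ?K X\<^esub>"
    note z = mod_mor_zero[OF Q(1) K(1)]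
    have "\<rho> (Cod C g) ?d = \<one>\<^bsub>Grp ?K (Cod C g)\<^esub>"
      using \<rho>(2)[OF u(1,3)] K(4)[OF u(1)] u w(2,4) by simp
    then have "(\<lambda>X \<in> Ob C. \<lambda>x \<in> carrier (Grp M X). \<rho> X (\<theta> X x)) =
        (\<lambda>X \<in> Ob C. \<lambda>x \<in> carrier (Grp M X). ?z X (\<theta> X x))"
      by (intro presents_mor_ext[OF m mod_mor_comp[OF mor(2) \<rho>(1)] mod_mor_comp[OF mor(2) z]])
        (use M d in simp)
    then have c1: "Comp (ModCat C) (Q, \<rho>, ?K) p = Comp (ModCat C) (Q, ?z, ?K) p" by (simp add: p)
    have uniq: "\<exists>!k. k \<in> Hom (eff C E) Q ?K \<and> Comp (ModCat C) k p = Comp (ModCat C) (Q, ?z, ?K) p"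
    proof -
      let ?h = "(M, \<lambda>X \<in> Ob C. \<lambda>x \<in> carrier (Grp M X). \<one>\<^bsub>Grp ?K X\<^esub>, ?K)"
      have "\<forall>h \<in> Mor (eff C E). Dom (eff C E) h = Cod (eff C E) i \<and>
        Comp (eff C E) h i = Zero (eff C E) (Dom (eff C E) i) (Cod (eff C E) h) \<longrightarrow>
        (\<exists>!k. k \<in> Hom (eff C E) (Cod (eff C E) p) (Cod (eff C E) h) \<and> Comp (eff C E) k p = h)"
        using coker unfolding is_cokernel_def by blast
      from this[rule_format, of ?h]
      have "\<exists>!k. k \<in> Hom (eff C E) Q ?K \<and> Comp (ModCat C) k p = ?h"
        using mod_mor_zero[OF \<theta>(1) K(1)] ob Kob \<eta>(3) unfolding i p
        by (simp del: ModCat_simps(2) Hom_iff cong: restrict_cong)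
      moreover have "Comp (ModCat C) (Q, ?z, ?K) p = ?h"
        using \<theta>(3) by (simp add: p cong: restrict_cong)
      ultimately show ?thesis by (simp only:)
    qed
    have "(Q, \<rho>, ?K) \<in> Hom (eff C E) Q ?K" "(Q, ?z, ?K) \<in> Hom (eff C E) Q ?K"
      using \<rho>(1) z Kob ob by (simp_all del: ModCat_simps(2))
    then have "(Q, \<rho>, ?K) = (Q, ?z, ?K)"
      using uniq c1 by blast
    then have "\<rho> (Cod C g2) c2 = \<one>\<^bsub>Grp ?K (Cod C g2)\<^esub>" using Q by simp
    then have "Act ?K (Id C (Cod C g2)) ?k = \<one>\<^bsub>Grp ?K (Cod C g2)\<^esub>"
      using \<rho>(2)[of "Id C (Cod C g2)"] Q by simp
    then have "factors C (Id C (Cod C g2)) w" using K(4)[of "Id C (Cod C g2)"] w(2) Q(2) by simp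
    then obtain a b where ab: "a \<in> Mor C" "b \<in> Mor C" "Cod C a = Dom C g2" "Cod C b = Dom C u"
      "Dom C a = Cod C g2" "Dom C b = Cod C g2" "Id C (Cod C g2) = Add C (Comp C g2 a) (Comp C u b)"
      using w(5)[of "Id C (Cod C g2)"] Q(2) by auto
    obtain h where h: "h \<in> Mor C" "Dom C h = X" "Cod C h = Cod C g2" "z = Act Q h c2"
      using presents_elem[OF q X \<open>z \<in> carrier (Grp Q X)\<close>] by metis
    have "c2 = Act Q (Id C (Cod C g2)) c2" using Q by simp
    also have "\<dots> = Act Q (Comp C u b) c2"
      unfolding ab(7) using ab(1-6) u Q(1-3) presents_relation[OF q] by simp
    also have "\<dots> = Act Q b (\<theta> (Cod C g) c)" using ab(1-6) u Q(1-3) by simp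
    finally have "z = Act Q h (Act Q b (\<theta> (Cod C g) c))" using h(4) by (rule back_subst[of "\<lambda>t. z = Act Q h t", rotated])
    also have "\<dots> = \<theta> X (Act M h (Act M b c))"
      using \<theta>(5)[of b c] \<theta>(5)[of h "Act M b c"] h(1-3) ab(1-6) u(1-3) M(1-3) by simp
    finally show "\<exists>y \<in> carrier (Grp M X). z = \<theta> X y"
      by (rule bexI) (use h(1-3) ab(1-6) u(1-3) M(1-3) in simp)
  next
    fix X y assume "X \<in> Ob C" "y \<in> carrier (Grp M X)" "\<exists>x \<in> carrier (Grp L X). y = \<eta> X x"
    then show "\<theta> X y = \<one>\<^bsub>Grp Q X\<^esub>" using \<theta>\<eta> by auto
  qed (use mor in simp_all)
  then show thesis using that i p ob by blast
qed

end

section \<open>Exact structures and Serre subcategories\<close>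

context exact_category
begin

text \<open>
  If \<open>h\<close> represents \<open>x\<close>, the pull-back along \<open>h\<close> of a deflation presenting \<open>M\<close> kills \<open>x\<close>.
\<close>

lemma effaceable:
  assumes M: "M \<in> Ob (eff C E)" and X: "X \<in> Ob C" and x: "x \<in> carrier (Grp M X)"
  obtains p where "deflation E p" "Cod C p = X" "Act M p x = \<one>\<^bsub>Grp M (Dom C p)\<^esub>"
proof -
  obtain g c where g: "deflation E g" and m: "presents C g M c" using M eff_iff by blast
  note m' = presentsD[OF m]
  obtain h where h: "h \<in> Mor C" "Dom C h = X" "Cod C h = Cod C g" "x = Act M h c"
    using presents_elem[OF m X x] by metis
  obtain p h' where pb: "is_pullback C g h p h'" and p: "deflation E p" using pullback_ex[OF g h(1,3)] by blast
  note d = is_pullbackD[OF pb]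
  have "factors C (Comp C h p) g" by (rule factorsI[of h']) (use d in simp_all)
  then have "Act M (Comp C h p) c = \<one>\<^bsub>Grp M (Dom C p)\<^esub>" using m'(4)[of "Comp C h p"] d(3,6) h(1-3) by simp
  then have "Act M p x = \<one>\<^bsub>Grp M (Dom C p)\<^esub>" unfolding h(4) using h(1-3) d(3,6) m'(1-3) by simp
  then show thesis using that[OF p] d(6) h(2) by simp
qed

text \<open>
  A deflation \<open>p\<close> that kills the generator factors through \<open>g\<close>, so that the obscure axiom applies.
\<close>

lemma conflation_if_effaced:
  assumes fg: "kernel_cokernel_pair C f g" and m: "presents C g M c"
    and p: "deflation E p" "Cod C p = Cod C g" "Act M p c = \<one>\<^bsub>Grp M (Dom C p)\<^esub>"
  shows "(f, g) \<in> E"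
proof -
  have "factors C p g" using presentsD(4)[OF m] deflation_arr[OF p(1)] p by simp
  then obtain k where "k \<in> Mor C" "Dom C k = Dom C p" "Cod C k = Dom C g" "p = Comp C g k"
    by (rule factorsE)
  then show ?thesis using deflation_of_comp[OF fg] p(1) by blast
qed

lemma conflation_if_presents_eff:
  assumes fg: "kernel_cokernel_pair C f g" and m: "presents C g M c" and M: "M \<in> Ob (eff C E)"
  shows "(f, g) \<in> E"
proof -
  note m' = presentsD[OF m]
  obtain p where "deflation E p" "Cod C p = Cod C g" "Act M p c = \<one>\<^bsub>Grp M (Dom C p)\<^esub>"
    using effaceable[OF M, of "Cod C g" c] m' by auto
  then show ?thesis by (rule conflation_if_effaced[OF fg m])
qed

lemma eff_mono:
  assumes "E' \<subseteq> E"
  shows "Ob (eff C E') \<subseteq> Ob (eff C E)"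
  using assms by (auto simp: eff_def full_subcategory_def)

text \<open>
  Inside \<open>eff E\<close>, the modules in \<open>eff E'\<close> are those all of whose elements are killed by
  \<open>E'\<close>-deflations: in the presentation by an \<open>E\<close>-deflation it suffices to look at the
  generator. This condition is inherited by submodules and quotients, and by extensions since
  \<open>E'\<close>-deflations compose.
\<close>

lemma eff_serre:
  assumes E': "exact_structure C E'" and le: "E' \<subseteq> E"
  shows "serre_subcategory (eff C E) (Ob (eff C E'))"
proof -
  interpret S: exact_category C E' by unfold_locales (rule E')
  have iff: "M \<in> Ob (eff C E') \<longleftrightarrow>
      (\<forall>X \<in> Ob C. \<forall>x \<in> carrier (Grp M X). \<exists>p. deflation E' p \<and> Cod C p = X \<and> Act M p x = \<one>\<^bsub>Grp M (Dom C p)\<^esub>)"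
    if M: "M \<in> Ob (eff C E)" for M
  proof
    assume "M \<in> Ob (eff C E')"
    then show "\<forall>X \<in> Ob C. \<forall>x \<in> carrier (Grp M X). \<exists>p. deflation E' p \<and> Cod C p = X \<and> Act M p x = \<one>\<^bsub>Grp M (Dom C p)\<^esub>"
      by (meson S.effaceable)
  next
    assume *: "\<forall>X \<in> Ob C. \<forall>x \<in> carrier (Grp M X). \<exists>p. deflation E' p \<and> Cod C p = X \<and> Act M p x = \<one>\<^bsub>Grp M (Dom C p)\<^esub>"
    obtain g c where g: "deflation E g" and m: "presents C g M c" using M eff_iff by blast
    obtain f where f: "(f, g) \<in> E" using g by (auto simp: deflation_def)
    obtain p where p: "deflation E' p" "Cod C p = Cod C g" "Act M p c = \<one>\<^bsub>Grp M (Dom C p)\<^esub>"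
      using * presentsD(2,3)[OF m] Cod_in by meson
    have "(f, g) \<in> E'" by (rule S.conflation_if_effaced[OF kcp[OF f] m p])
    then show "M \<in> Ob (eff C E')" using S.eff_iff m by (auto simp: deflation_def)
  qed
  show ?thesis
    unfolding serre_subcategory_def
  proof (intro conjI allI impI)
    show "Ob (eff C E') \<subseteq> Ob (eff C E)" by (rule eff_mono[OF le])
    obtain Z where "Z \<in> Ob C" using zero_object by (auto simp: is_zero_object_def)
    from S.id_deflation[OF this] show "Ob (eff C E') \<noteq> {}"
      using S.eff_iff defect_presents[OF S.deflation_arr] by blast
  next
    fix i p assume "kernel_cokernel_pair (eff C E) i p"
    then obtain L \<eta> M \<theta> Q where ip: "i = (L, \<eta>, M)" "p = (M, \<theta>, Q)" and s: "short_exact L \<eta> M \<theta> Q"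
      and ob: "L \<in> Ob (eff C E)" "M \<in> Ob (eff C E)" "Q \<in> Ob (eff C E)"
      using kcp_short_exact by metis
    note s = short_exactD[OF s]
    note \<eta> = mod_morD[OF s(1)] and \<theta> = mod_morD[OF s(2)]
    have "M \<in> Ob (eff C E') \<longleftrightarrow> L \<in> Ob (eff C E') \<and> Q \<in> Ob (eff C E')"
    proof (intro iffI conjI)
      assume M: "M \<in> Ob (eff C E')"
      show "L \<in> Ob (eff C E')"
        unfolding iff[OF ob(1)]
      proof (intro ballI)
        fix X x assume x: "X \<in> Ob C" "x \<in> carrier (Grp L X)"
        obtain p where p: "deflation E' p" "Cod C p = X" "Act M p (\<eta> X x) = \<one>\<^bsub>Grp M (Dom C p)\<^esub>"
          using S.effaceable[OF M x(1) \<eta>(3)[OF x]] by metis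
        have "Act L p x = \<one>\<^bsub>Grp L (Dom C p)\<^esub>"
          using s(3)[of "Dom C p" "Act L p x"] \<eta>(5)[of p x] p x \<eta>(1) S.deflation_arr[OF p(1)] by simp
        then show "\<exists>p. deflation E' p \<and> Cod C p = X \<and> Act L p x = \<one>\<^bsub>Grp L (Dom C p)\<^esub>" using p by blast
      qed
      show "Q \<in> Ob (eff C E')"
        unfolding iff[OF ob(3)]
      proof (intro ballI)
        fix X z assume z: "X \<in> Ob C" "z \<in> carrier (Grp Q X)"
        obtain y where y: "y \<in> carrier (Grp M X)" "z = \<theta> X y" using s(5)[OF z] by blast
        obtain p where p: "deflation E' p" "Cod C p = X" "Act M p y = \<one>\<^bsub>Grp M (Dom C p)\<^esub>"
          using S.effaceable[OF M z(1) y(1)] by metis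
        have "Act Q p z = \<one>\<^bsub>Grp Q (Dom C p)\<^esub>"
          using mod_mor_one[OF s(2), of "Dom C p"] \<theta>(5)[of p y] p y S.deflation_arr[OF p(1)] by simp
        then show "\<exists>p. deflation E' p \<and> Cod C p = X \<and> Act Q p z = \<one>\<^bsub>Grp Q (Dom C p)\<^esub>" using p by blast
      qed
    next
      assume LQ: "L \<in> Ob (eff C E') \<and> Q \<in> Ob (eff C E')"
      show "M \<in> Ob (eff C E')"
        unfolding iff[OF ob(2)]
      proof (intro ballI)
        fix X y assume y: "X \<in> Ob C" "y \<in> carrier (Grp M X)"
        obtain p where p: "deflation E' p" "Cod C p = X" "Act Q p (\<theta> X y) = \<one>\<^bsub>Grp Q (Dom C p)\<^esub>"
          using S.effaceable[OF conjunct2[OF LQ] y(1) \<theta>(3)[OF y]] by metis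
        note p' = S.deflation_arr[OF p(1)]
        have py: "Act M p y \<in> carrier (Grp M (Dom C p))" using p p' y \<theta>(1) by simp
        have "\<theta> (Dom C p) (Act M p y) = \<one>\<^bsub>Grp Q (Dom C p)\<^esub>" using \<theta>(5)[OF p', of y] p y by simp
        then obtain x where x: "x \<in> carrier (Grp L (Dom C p))" "Act M p y = \<eta> (Dom C p) x"
          using s(4)[OF _ py] p' by auto
        obtain q where q: "deflation E' q" "Cod C q = Dom C p" "Act L q x = \<one>\<^bsub>Grp L (Dom C q)\<^esub>"
          using S.effaceable[OF conjunct1[OF LQ] _ x(1)] p' by (metis Dom_in)
        note q' = S.deflation_arr[OF q(1)]
        have "Act M (Comp C p q) y = Act M q (Act M p y)" using p p' q q' y \<theta>(1) by simp
        also have "\<dots> = \<eta> (Dom C q) (Act L q x)" using \<eta>(5)[OF q', of x] q(2) x by simp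
        also have "\<dots> = \<one>\<^bsub>Grp M (Dom C q)\<^esub>" using mod_mor_one[OF s(1), of "Dom C q"] q(3) q' by simp
        finally show "\<exists>p. deflation E' p \<and> Cod C p = X \<and> Act M p y = \<one>\<^bsub>Grp M (Dom C p)\<^esub>"
          using S.deflation_comp[OF q(1) p(1) q(2)] p p' q q' by (intro exI[of _ "Comp C p q"]) simp
      qed
    qed
    then show "Cod (eff C E) i \<in> Ob (eff C E') \<longleftrightarrow> Dom (eff C E) i \<in> Ob (eff C E') \<and> Cod (eff C E) p \<in> Ob (eff C E')"
      by (simp add: ip)
  qed
qed

lemma eff_le_iff:
  assumes E': "exact_structure C E'" "E' \<subseteq> E" and E'': "exact_structure C E''"
  shows "Ob (eff C E') \<subseteq> Ob (eff C E'') \<longleftrightarrow> E' \<subseteq> E''"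
proof
  interpret S: exact_category C E' by unfold_locales (rule E')
  interpret T: exact_category C E'' by unfold_locales (rule E'')
  assume le: "Ob (eff C E') \<subseteq> Ob (eff C E'')"
  show "E' \<subseteq> E''"
  proof (rule subrelI)
    fix f g assume fg: "(f, g) \<in> E'"
    then have g: "deflation E' g" by (auto simp: deflation_def)
    note m = defect_presents[OF S.deflation_arr[OF g], of undefined]
    have "defect C (undefined, g) \<in> Ob (eff C E')" using S.eff_iff g m by blast
    then show "(f, g) \<in> E''" using T.conflation_if_presents_eff[OF S.kcp[OF fg] m] le by blast
  qed
next
  assume "E' \<subseteq> E''"
  then show "Ob (eff C E') \<subseteq> Ob (eff C E'')" by (auto simp: eff_def full_subcategory_def)
qed

text \<open>
  A morphism out of the push-out that vanishes on \<open>i'\<close> is the same thing as a morphism that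
  vanishes on \<open>i\<close>, so that both inflations have the same cokernel object.
\<close>

lemma pushout_conflation:
  assumes E: "(i, p) \<in> E" and po: "is_pushout C i f i' f'"
  obtains p' where "(i', p') \<in> E" "Comp C p' f' = p"
proof -
  note d = is_pushoutD[OF po] and c = conflation_cokernel[OF E]
  note cd = is_cokernelD[OF c]
  obtain p' where p': "p' \<in> Mor C" "Dom C p' = Cod C i'" "Cod C p' = Cod C p"
    "Comp C p' i' = Zero C (Cod C f) (Cod C p)" "Comp C p' f' = p"
    using pushout_desc[OF po, of "Zero C (Cod C f) (Cod C p)" p] d cd by auto
  have "is_cokernel C p' i'"
  proof (rule is_cokernelI)
    fix u assume u: "u \<in> Mor C" "Dom C u = Dom C p'" "Comp C u i' = Zero C (Dom C i') (Cod C u)"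
    have "Comp C (Comp C u f') i = Comp C (Comp C u i') f"
      using u(1,2) p' d by simp
    also have "\<dots> = Zero C (Dom C i) (Cod C u)" unfolding u(3) using u(1) d by simp
    finally obtain m where m: "m \<in> Mor C" "Dom C m = Cod C p" "Cod C m = Cod C u" "Comp C m p = Comp C u f'"
      using cokernel_desc[OF c, of "Comp C u f'"] u p' d cd by auto
    have "Comp C m p' = u"
      by (rule pushout_eq[OF po]) (use m p' u d in simp_all)
    then show "\<exists>k. k \<in> Mor C \<and> Dom C k = Cod C p' \<and> Cod C k = Cod C u \<and> Comp C k p' = u"
      using m p' by auto
  next
    fix k k' assume k: "k \<in> Mor C" "k' \<in> Mor C" "Cod C k = Cod C k'" "Dom C k = Cod C p'" "Dom C k' = Cod C p'"
      "Comp C k p' = Comp C k' p'"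
    have *: "Comp C l p = Comp C (Comp C l p') f'" if "l \<in> Mor C" "Dom C l = Cod C p'" for l
      using that p' d by simp
    have "Comp C k p = Comp C k' p" unfolding *[OF k(1,4)] *[OF k(2,5)] k(6) ..
    then show "k = k'" using cokernel_epi[OF c] k p' by simp
  qed (use p' d in simp_all)
  moreover obtain p0 where "(i', p0) \<in> E"
    using inflation_pushout[OF po] E by (auto simp: inflation_def)
  ultimately show thesis using that p'(5) conflation_iso_cod by blast
qed

end

locale serre_of_exact = exact_category C E for C :: "('o, 'm) preadd_cat" and E +
  fixes S :: "('o, 'm, 'm set) rmod set"
  assumes serre: "serre_subcategory (eff C E) S"
begin

lemma serre_eff: "M \<in> S \<Longrightarrow> M \<in> Ob (eff C E)"
  using serre by (auto simp: serre_subcategory_def)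

lemma serre_short_exact:
  assumes s: "short_exact L \<eta> M \<theta> Q" and ob: "L \<in> Ob (eff C E)" "M \<in> Ob (eff C E)" "Q \<in> Ob (eff C E)"
  shows "M \<in> S \<longleftrightarrow> L \<in> S \<and> Q \<in> S"
  using serre short_exact_kcp[OF assms] unfolding serre_subcategory_def by fastforce

lemma serre_presents_step:
  fixes M :: "('o, 'm, 'm set) rmod"
  assumes g: "deflation E g" and p: "presents C g M c" and pb: "is_pullback C g v p v'" and q: "presents C p L l"
    and wd: "deflation E w"
    and r: "presents C w Q d" and w: "Cod C w = Cod C g" "factors C g w" "factors C v w"
    and sum: "\<And>h. h \<in> Mor C \<Longrightarrow> factors C h w \<Longrightarrow> \<exists>a b. a \<in> Mor C \<and> b \<in> Mor C \<and> Cod C a = Dom C g \<and>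
       Cod C b = Dom C v \<and> Dom C a = Dom C h \<and> Dom C b = Dom C h \<and> h = Add C (Comp C g a) (Comp C v b)"
  shows "M \<in> S \<longleftrightarrow> L \<in> S \<and> Q \<in> S"
proof -
  obtain \<eta> \<theta> where "short_exact L \<eta> M \<theta> Q"
    using pullback_copair_exact[OF p pb q r w sum] by blast
  then show ?thesis
    by (rule serre_short_exact) (use eff_iff deflation_pullback[OF pb g] g wd p q r in blast)+
qed

text \<open>
  Closure under isomorphism, as the case \<open>v = 1\<close> of the previous lemma: the pull-back of \<open>g\<close> along the
  identity is \<open>g\<close>, and the quotient is zero.
\<close>

lemma presents_serre_transfer:
  fixes M :: "('o, 'm, 'm set) rmod"
  assumes g: "deflation E g" and p: "presents C g M c" and q: "presents C g L l" and M: "M \<in> S"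
  shows "L \<in> S"
proof -
  note g' = deflation_arr[OF g]
  have I: "deflation E (Id C (Cod C g))" using id_deflation g' by simp
  have pb: "is_pullback C g (Id C (Cod C g)) g (Id C (Dom C g))"
    by (rule is_pullbackI) (use g' in auto)
  show ?thesis
  proof (rule conjunct1[OF iffD1[OF serre_presents_step[OF g p pb q I defect_presents[of _ undefined]] M]])
    show "factors C g (Id C (Cod C g))" by (rule factorsI[of g]) (use g' in simp_all)
    show "factors C (Id C (Cod C g)) (Id C (Cod C g))"
      by (rule factorsI[of "Id C (Cod C g)"]) (use g' in simp_all)
    fix h assume h: "h \<in> Mor C" "factors C h (Id C (Cod C g))"
    then have "Cod C h = Cod C g" using g' by (auto elim!: factorsE)
    then show "\<exists>a b. a \<in> Mor C \<and> b \<in> Mor C \<and> Cod C a = Dom C g \<and> Cod C b = Dom C (Id C (Cod C g)) \<and>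
       Dom C a = Dom C h \<and> Dom C b = Dom C h \<and> h = Add C (Comp C g a) (Comp C (Id C (Cod C g)) b)"
      using h g' by (intro exI[of _ "Zero C (Dom C h) (Dom C g)"] exI[of _ h]) simp
  qed (use g' in simp_all)
qed

definition defect_in :: "'m \<Rightarrow> bool" where
  "defect_in g \<longleftrightarrow> (\<exists>M c. presents C g M c \<and> M \<in> S)"

lemma defect_in_presents:
  fixes M :: "('o, 'm, 'm set) rmod"
  shows "deflation E g \<Longrightarrow> presents C g M c \<Longrightarrow> defect_in g \<longleftrightarrow> M \<in> S"
  unfolding defect_in_def using presents_serre_transfer by blast

lemma defect_in_step:
  assumes g: "deflation E g" and pb: "is_pullback C g v p v'"
    and wd: "deflation E w" and w: "Cod C w = Cod C g" "factors C g w" "factors C v w"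
    and sum: "\<And>h. h \<in> Mor C \<Longrightarrow> factors C h w \<Longrightarrow> \<exists>a b. a \<in> Mor C \<and> b \<in> Mor C \<and> Cod C a = Dom C g \<and>
       Cod C b = Dom C v \<and> Dom C a = Dom C h \<and> Dom C b = Dom C h \<and> h = Add C (Comp C g a) (Comp C v b)"
  shows "defect_in g \<longleftrightarrow> defect_in p \<and> defect_in w"
proof -
  have p: "deflation E p" by (rule deflation_pullback[OF pb g])
  have m: "presents C x (defect C (undefined, x)) (defect_class x (Id C (Cod C x)))" if "deflation E x" for x
    by (rule defect_presents[OF deflation_arr[OF that]])
  show ?thesis
    unfolding defect_in_presents[OF g m[OF g]] defect_in_presents[OF p m[OF p]] defect_in_presents[OF wd m[OF wd]]
    by (rule serre_presents_step[OF g m[OF g] pb m[OF p] wd m[OF wd] w sum])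
qed

lemma presents_cong:
  assumes m: "presents C g M c" and g2: "g2 \<in> Mor C" "Cod C g2 = Cod C g" "factors C g g2" "factors C g2 g"
  shows "presents C g2 M c"
proof -
  note M = presentsD[OF m]
  have "factors C h g \<longleftrightarrow> factors C h g2" for h
    using factors_trans g2 M(2) by blast
  then show ?thesis using m g2 by (simp add: presents_def)
qed

lemma defect_in_pullback:
  assumes "deflation E g" "defect_in g" "is_pullback C g v p v'"
  shows "defect_in p"
proof -
  note d = is_pullbackD[OF assms(3)]
  obtain w where w: "deflation E w" "Cod C w = Cod C g" "factors C g w" "factors C v w"
    "\<And>h. h \<in> Mor C \<Longrightarrow> factors C h w \<Longrightarrow> \<exists>a b. a \<in> Mor C \<and> b \<in> Mor C \<and> Cod C a = Dom C g \<and> Cod C b = Dom C v \<and>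
       Dom C a = Dom C h \<and> Dom C b = Dom C h \<and> h = Add C (Comp C g a) (Comp C v b)"
    using copair_deflation_ex[OF assms(1) d(2) d(5)[symmetric]] by metis
  from defect_in_step[OF assms(1,3) w] assms(2) show ?thesis by blast
qed

text \<open>
  The defect of \<open>g2\<close> is a quotient of the defect of \<open>g\<close>, since both are quotients of \<open>Hom(-, Cod g)\<close>.
  With \<open>v = g2\<close> in \<open>defect_in_step\<close>, \<open>[g, g2]\<close> has the same image as \<open>g2\<close>.
\<close>

lemma defect_in_factor:
  assumes g: "deflation E g" "defect_in g" and g2: "deflation E g2" "Cod C g2 = Cod C g" "factors C g g2"
  shows "defect_in g2"
proof -
  note a = deflation_arr[OF g(1)] deflation_arr[OF g2(1)]
  obtain p v' where pb: "is_pullback C g g2 p v'" using pullback_ex[OF g(1) a(2) g2(2)] by blast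
  obtain w where w: "deflation E w" "Cod C w = Cod C g" "factors C g w" "factors C g2 w"
    "\<And>h. h \<in> Mor C \<Longrightarrow> factors C h w \<Longrightarrow> \<exists>a b. a \<in> Mor C \<and> b \<in> Mor C \<and> Cod C a = Dom C g \<and> Cod C b = Dom C g2 \<and>
       Dom C a = Dom C h \<and> Dom C b = Dom C h \<and> h = Add C (Comp C g a) (Comp C g2 b)"
    using copair_deflation_ex[OF g(1) a(2) g2(2)] by metis
  note w' = deflation_arr[OF w(1)]
  have "defect_in w" using defect_in_step[OF g(1) pb w] g(2) by blast
  then obtain M c where M: "presents C w M c" "M \<in> S" by (auto simp: defect_in_def)
  have "factors C w w" by (rule factorsI[of "Id C (Dom C w)"]) (use w' in simp_all)
  then obtain x y where xy: "x \<in> Mor C" "y \<in> Mor C" "Cod C x = Dom C g" "Cod C y = Dom C g2"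
       "Dom C x = Dom C w" "Dom C y = Dom C w" "w = Add C (Comp C g x) (Comp C g2 y)"
    using w(5)[OF w'] by blast
  obtain k where k: "k \<in> Mor C" "Dom C k = Dom C g" "Cod C k = Dom C g2" "g = Comp C g2 k"
    using g2(3) by (rule factorsE)
  have "Comp C g2 (Add C (Comp C k x) y) = Add C (Comp C (Comp C g2 k) x) (Comp C g2 y)"
    using k(1-3) xy(1-6) a by simp
  also have "\<dots> = w" unfolding k(4)[symmetric] by (rule xy(7)[symmetric])
  finally have "factors C w g2" by (intro factorsI[of "Add C (Comp C k x) y"]) (use k(1-3) xy(1-6) a in simp_all)
  then have "presents C g2 M c" using presents_cong[OF M(1) a(2)] w g2 by simp
  then show ?thesis using M(2) by (auto simp: defect_in_def)
qed

text \<open>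
  Every deflation factors through the identity of its codomain, hence it suffices to find some
  deflation onto \<open>X\<close> with defect in \<open>S\<close>. The pull-back along \<open>0\<close> of any deflation with defect in
  \<open>S\<close> is one.
\<close>

lemma defect_in_id:
  assumes X: "X \<in> Ob C"
  shows "defect_in (Id C X)"
proof -
  obtain M where M: "M \<in> S" using serre by (auto simp: serre_subcategory_def)
  obtain g c where g: "deflation E g" and m: "presents C g M c" using serre_eff[OF M] eff_iff by blast
  note g' = deflation_arr[OF g]
  have T: "defect_in g" using M m by (auto simp: defect_in_def)
  obtain p v' where pb: "is_pullback C g (Zero C X (Cod C g)) p v'" and p: "deflation E p"
    using pullback_ex[OF g, of "Zero C X (Cod C g)"] g' X by auto
  note d = is_pullbackD[OF pb]
  have cod: "Cod C p = X" using d X g' by simp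
  show ?thesis
    by (rule defect_in_factor[OF p defect_in_pullback[OF g T pb] id_deflation[OF X]])
      (use X cod d in \<open>auto intro: factorsI[of p]\<close>)
qed

text \<open>
  The form in which closure under extensions is applied: \<open>[g, v]\<close> need not be known explicitly, it
  suffices that \<open>h\<close>, with defect in \<open>S\<close>, factors through it.
\<close>

lemma defect_in_extension:
  assumes g: "deflation E g" and pb: "is_pullback C g v p v'" and T: "defect_in p"
    and h: "deflation E h" "defect_in h" "Cod C h = Cod C g"
    and hw: "\<And>w. w \<in> Mor C \<Longrightarrow> Cod C w = Cod C g \<Longrightarrow> factors C g w \<Longrightarrow> factors C v w \<Longrightarrow> factors C h w"
  shows "defect_in g"
proof -
  note d = is_pullbackD[OF pb]
  obtain w where w: "deflation E w" "Cod C w = Cod C g" "factors C g w" "factors C v w"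
    "\<And>h. h \<in> Mor C \<Longrightarrow> factors C h w \<Longrightarrow> \<exists>a b. a \<in> Mor C \<and> b \<in> Mor C \<and> Cod C a = Dom C g \<and> Cod C b = Dom C v \<and>
       Dom C a = Dom C h \<and> Dom C b = Dom C h \<and> h = Add C (Comp C g a) (Comp C v b)"
    using copair_deflation_ex[OF g d(2) d(5)[symmetric]] by metis
  have "defect_in w"
    by (rule defect_in_factor[OF h(1,2) w(1)]) (use w h hw deflation_arr[OF w(1)] in simp_all)
  then show ?thesis using defect_in_step[OF g pb w] T by blast
qed

text \<open>
  Take \<open>v = q\<close>. The submodule lies in \<open>S\<close> because \<open>p\<close> factors through the pull-back of \<open>q \<circ> p\<close>
  along \<open>q\<close>, and the quotient because \<open>q\<close> factors through \<open>[q \<circ> p, q]\<close>.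
\<close>

lemma defect_in_comp:
  assumes p: "deflation E p" "defect_in p" and q: "deflation E q" "defect_in q" and pq: "Cod C p = Dom C q"
  shows "defect_in (Comp C q p)"
proof -
  note a = deflation_arr[OF p(1)] deflation_arr[OF q(1)]
  have qp: "deflation E (Comp C q p)" by (rule deflation_comp[OF p(1) q(1) pq])
  obtain r v' where pb: "is_pullback C (Comp C q p) q r v'" and r: "deflation E r"
    using pullback_ex[OF qp, of q] a pq by auto
  note d = is_pullbackD[OF pb]
  obtain k where k: "k \<in> Mor C" "Dom C k = Dom C p" "Cod C k = Dom C r" "Comp C r k = p"
    using pullback_lift[OF pb, of p "Id C (Dom C p)"] a pq by auto
  have "defect_in r"
    by (rule defect_in_factor[OF p r]) (use d pq k in \<open>auto intro: factorsI[of k]\<close>)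
  then show ?thesis
    by (rule defect_in_extension[OF qp pb _ q]) (use a pq in auto)
qed

definition serre_conflations :: "('m \<times> 'm) set" where
  "serre_conflations = {(f, g) \<in> E. defect_in g}"

lemma serre_deflation_iff: "deflation serre_conflations p \<longleftrightarrow> deflation E p \<and> defect_in p"
  by (auto simp: deflation_def serre_conflations_def)

text \<open>
  The case of Noether's isomorphism. For \<open>i: A \<rightarrow> B\<close> and \<open>j: B \<rightarrow> D\<close>, the push-out of \<open>j\<close> along
  \<open>p: B \<rightarrow> B/A\<close> consists of \<open>r: D \<rightarrow> D/A\<close>, a cokernel of \<open>j \<circ> i\<close>, and an inflation
  \<open>t: B/A \<rightarrow> D/A\<close> with cokernel \<open>s: D/A \<rightarrow> D/B\<close>. Take \<open>v = t\<close> for the defect of \<open>r\<close>: the submodule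
  is a quotient of the defect of \<open>p\<close>, and the image of \<open>[r, t]\<close> contains the pull-back of
  \<open>q = s \<circ> r\<close> along \<open>s\<close>.
\<close>

lemma defect_in_inflation_comp:
  assumes i: "(i, p) \<in> E" "defect_in p" and j: "(j, q) \<in> E" "defect_in q" and ij: "Cod C i = Dom C j"
  obtains r where "(Comp C j i, r) \<in> E" "defect_in r"
proof -
  have p: "deflation E p" and q: "deflation E q" and inf: "inflation E i" "inflation E j"
    using i j by (auto simp: deflation_def inflation_def)
  note kp = is_kernelD[OF conflation_kernel[OF i(1)]] and kq = is_kernelD[OF conflation_kernel[OF j(1)]]
  note cp = conflation_cokernel[OF i(1)]
  obtain t r where po: "is_pushout C j p t r" using pushout_ex[OF inf(2), of p] kp kq ij by auto
  note d = is_pushoutD[OF po]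
  obtain s where s: "(t, s) \<in> E" "Comp C s r = q" using pushout_conflation[OF j(1) po] by metis
  note kt = conflation_kernel[OF s(1)]
  note ks = is_kernelD[OF kt]
  have "is_cokernel C r (Comp C j i)"
  proof (rule is_cokernelI)
    have "Comp C r (Comp C j i) = Comp C (Comp C t p) i" unfolding d(9) using d(1-8) kp ij by simp
    then show "Comp C r (Comp C j i) = Zero C (Dom C (Comp C j i)) (Cod C r)" using d(1-8) kp ij by simp
  next
    fix u assume u: "u \<in> Mor C" "Dom C u = Dom C r" "Comp C u (Comp C j i) = Zero C (Dom C (Comp C j i)) (Cod C u)"
    then obtain w where w: "w \<in> Mor C" "Dom C w = Cod C p" "Cod C w = Cod C u" "Comp C w p = Comp C u j"
      using cokernel_desc[OF cp, of "Comp C u j"] kp d(1-8) ij by auto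
    obtain k where "k \<in> Mor C" "Dom C k = Cod C t" "Cod C k = Cod C w" "Comp C k t = w" "Comp C k r = u"
      by (rule pushout_desc[OF po, of w u]) (use w u d(1-8) kp ij in simp_all)
    then show "\<exists>k. k \<in> Mor C \<and> Dom C k = Cod C r \<and> Cod C k = Cod C u \<and> Comp C k r = u"
      using w d by auto
  next
    fix k k' assume k: "k \<in> Mor C" "k' \<in> Mor C" "Cod C k = Cod C k'" "Dom C k = Cod C r" "Dom C k' = Cod C r"
      "Comp C k r = Comp C k' r"
    have *: "Comp C (Comp C l t) p = Comp C (Comp C l r) j" if "l \<in> Mor C" "Dom C l = Cod C r" for l
      using that d by simp
    have 1: "Comp C (Comp C k t) p = Comp C (Comp C k' t) p" unfolding *[OF k(1,4)] *[OF k(2,5)] k(6) ..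
    have 2: "Comp C k t = Comp C k' t"
      by (rule cokernel_epi[OF cp _ _ _ _ _ 1]) (use k(1-5) d(1-8) kp in simp_all)
    show "k = k'" by (rule pushout_eq[OF po k(1-3) _ _ 2 k(6)]) (use k(1-5) d(1-8) in simp_all)
  qed (use d(1-8) kp ij in simp_all)
  moreover obtain r0 where "(Comp C j i, r0) \<in> E"
    using inflation_comp[OF inf ij] by (auto simp: inflation_def)
  ultimately have r: "(Comp C j i, r) \<in> E" using conflation_iso_cod by blast
  have rd: "deflation E r" using r by (auto simp: deflation_def)
  obtain p' x where pb: "is_pullback C r t p' x" and p': "deflation E p'"
    using pullback_ex[OF rd, of t] d by auto
  note e = is_pullbackD[OF pb]
  obtain k where k: "k \<in> Mor C" "Dom C k = Dom C p" "Cod C k = Dom C p'" "Comp C p' k = p"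
    by (rule pullback_lift[OF pb kp(2) is_pushoutD(1)[OF po]]) (use d kp(3) ij in simp_all)
  have T: "defect_in p'"
    by (rule defect_in_factor[OF p i(2) p']) (use e d k in \<open>auto intro: factorsI[of k]\<close>)
  obtain q' y where pb2: "is_pullback C q s q' y" and q': "deflation E q'"
    using pullback_ex[OF q, of s] s(2) ks d by (metis comp_arr(3))
  note f = is_pullbackD[OF pb2]
  \<comment> \<open>The difference of \<open>q'\<close> and \<open>r \<circ> y\<close> is killed by \<open>s\<close> and thus lifts to the kernel \<open>t\<close> of \<open>s\<close>.\<close>
  have "Comp C s (Add C (neg (Comp C r y)) q') = Zero C (Dom C q') (Cod C s)"
  proof -
    have "Comp C s (Comp C r y) = Comp C q y"
      by (rule comp_reduce[OF s(2)]) (use f d kq ks in simp_all)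
    then show ?thesis using f d ks kq by simp
  qed
  then obtain m where m: "m \<in> Mor C" "Dom C m = Dom C q'" "Cod C m = Dom C t"
    "Comp C t m = Add C (neg (Comp C r y)) q'"
    using kernel_lift[OF kt, of "Add C (neg (Comp C r y)) q'"] f d ks kq by auto
  have sum: "q' = Add C (Comp C r y) (Comp C t m)" unfolding m(4) using f d ks kq by simp
  have "defect_in r"
  proof (rule defect_in_extension[OF rd pb T q' defect_in_pullback[OF q j(2) pb2]])
    show "Cod C q' = Cod C r" using f d ks by simp
    fix w assume w: "w \<in> Mor C" "Cod C w = Cod C r" "factors C r w" "factors C t w"
    obtain a where a: "a \<in> Mor C" "Dom C a = Dom C r" "Cod C a = Dom C w" "r = Comp C w a" using w(3) by (rule factorsE)
    obtain b where b: "b \<in> Mor C" "Dom C b = Dom C t" "Cod C b = Dom C w" "t = Comp C w b" using w(4) by (rule factorsE)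
    have ya: "Cod C y = Dom C a" "Dom C y = Dom C q'" using f d kq a by simp_all
    have "Comp C w (Add C (Comp C a y) (Comp C b m)) = Add C (Comp C (Comp C w a) y) (Comp C (Comp C w b) m)"
      using a(1-3) b(1-3) m(1-3) ya f(1-4) w(1,2) by simp
    also have "\<dots> = q'" unfolding a(4)[symmetric] b(4)[symmetric] by (rule sum[symmetric])
    finally show "factors C q' w"
      by (intro factorsI[of "Add C (Comp C a y) (Comp C b m)"]) (use a(1-3) b(1-3) m(1-3) ya f(1-4) in simp_all)
  qed
  then show thesis using that r by blast
qed

lemma serre_conflations_exact: "exact_structure C serre_conflations"
  unfolding exact_structure_def
proof (intro conjI allI impI ballI)
  fix x assume "x \<in> serre_conflations"
  then show "case x of (i, p) \<Rightarrow> kernel_cokernel_pair C i p" using kcp by (auto simp: serre_conflations_def)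
next
  fix x i' p' assume x: "x \<in> serre_conflations" and ip': "kernel_cokernel_pair C i' p' \<and> isomorphic_pairs C x (i', p')"
  obtain i p where [simp]: "x = (i, p)" by (cases x)
  have ip: "(i, p) \<in> E" "defect_in p" using x by (auto simp: serre_conflations_def)
  have E': "(i', p') \<in> E" using iso_closed ip ip' by auto
  have p: "deflation E p" "deflation E p'" using ip E' by (auto simp: deflation_def)
  obtain b c where b: "b \<in> Hom C (Cod C i) (Cod C i')" and c: "c \<in> Hom C (Cod C p) (Cod C p')" "is_iso C c"
    "Comp C c p = Comp C p' b"
    using ip' by (auto simp: isomorphic_pairs_def)
  note k = is_kernelD[OF conflation_kernel[OF ip(1)]] is_kernelD[OF conflation_kernel[OF E']]
  have b': "b \<in> Mor C" "Dom C b = Dom C p" "Cod C b = Dom C p'" using b k by auto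
  have c': "c \<in> Mor C" "Dom C c = Cod C p" "Cod C c = Cod C p'" using c by auto
  obtain d where d: "d \<in> Mor C" "Dom C d = Cod C p'" "Cod C d = Cod C p" "Comp C c d = Id C (Cod C p')"
    using c(2) c' by (auto simp: is_iso_def)
  obtain p2 v where pb: "is_pullback C p d p2 v" and p2: "deflation E p2" using pullback_ex[OF p(1) d(1,3)] by blast
  note e = is_pullbackD[OF pb]
  \<comment> \<open>The pull-back \<open>p2\<close> of \<open>p\<close> along the inverse \<open>d\<close> of \<open>c\<close> has the codomain of \<open>p'\<close> and
    factors through \<open>p'\<close>.\<close>
  have "p2 = Comp C (Comp C c d) p2" unfolding d(4) using e(3,6) d(2) by simp
  also have "\<dots> = Comp C c (Comp C p v)" using e d(1-3) c' by simp
  also have "\<dots> = Comp C (Comp C p' b) v" unfolding c(3)[symmetric] using e c' by simp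
  also have "\<dots> = Comp C p' (Comp C b v)" using e b' k by simp
  finally have "factors C p2 p'" by (intro factorsI[of "Comp C b v"]) (use e b' in simp_all)
  then have "defect_in p'"
    by (intro defect_in_factor[OF p2 defect_in_pullback[OF p(1) ip(2) pb] p(2)]) (use e d in simp_all)
  then show "(i', p') \<in> serre_conflations" using E' by (simp add: serre_conflations_def)
next
  fix X assume X: "X \<in> Ob C"
  obtain p where p: "(Id C X, p) \<in> E" using id_inflation[OF X] by (auto simp: inflation_def)
  note c = conflation_cokernel[OF p]
  note cd = is_cokernelD[OF c]
  \<comment> \<open>The cokernel \<open>p\<close> of the identity is zero and epic, so its codomain is a zero object.\<close>
  have p0: "p = Zero C X (Cod C p)" using cd X by simp
  have "Comp C (Id C (Cod C p)) p = Comp C (Zero C (Cod C p) (Cod C p)) p"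
    using cd(2,3) X p0[symmetric] by simp
  then have 0: "Id C (Cod C p) = Zero C (Cod C p) (Cod C p)"
    by (rule cokernel_epi[OF c, rotated 5]) (use cd(2) in simp_all)
  have "factors C (Id C (Cod C p)) p"
    by (rule factorsI[of "Zero C (Cod C p) (Dom C p)"]) (use cd(2) 0 in simp_all)
  moreover have "Cod C p \<in> Ob C" "deflation E p" using cd(2) p by (auto simp: deflation_def)
  ultimately have "defect_in p"
    by (intro defect_in_factor[OF id_deflation defect_in_id, of "Cod C p"]) simp_all
  then show "inflation serre_conflations (Id C X)" using p by (auto simp: inflation_def serre_conflations_def)
  show "deflation serre_conflations (Id C X)" using serre_deflation_iff id_deflation defect_in_id X by blast
next
  fix i j assume "inflation serre_conflations i \<and> inflation serre_conflations j \<and> Cod C i = Dom C j"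
  then show "inflation serre_conflations (Comp C j i)"
    using defect_in_inflation_comp unfolding inflation_def serre_conflations_def by (auto) metis
next
  fix p q assume "deflation serre_conflations p \<and> deflation serre_conflations q \<and> Cod C p = Dom C q"
  then show "deflation serre_conflations (Comp C q p)"
    using serre_deflation_iff deflation_comp defect_in_comp by blast
next
  fix i f assume *: "inflation serre_conflations i \<and> f \<in> Mor C \<and> Dom C f = Dom C i"
  then obtain p where p: "(i, p) \<in> E" "defect_in p" by (auto simp: inflation_def serre_conflations_def)
  obtain i' f' where po: "is_pushout C i f i' f'"
    using pushout_ex[of i f] p(1) * unfolding inflation_def by blast
  obtain p' where p': "(i', p') \<in> E" "Comp C p' f' = p" using pushout_conflation[OF p(1) po] by metis
  note d = is_pushoutD[OF po] and k = is_kernelD[OF conflation_kernel[OF p'(1)]]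
    and k' = is_kernelD[OF conflation_kernel[OF p(1)]]
  have f': "Cod C f' = Dom C p'" using k d by simp
  have c: "Cod C p' = Cod C p" "Dom C f' = Dom C p" using p'(2) comp_arr(2,3)[OF d(4) k(2) f'] by simp_all
  have "factors C p p'" using p'(2) f' c d by (intro factorsI[of f']) simp_all
  then have "defect_in p'"
    using defect_in_factor[of p p'] p p' c by (auto simp: deflation_def)
  then show "\<exists>i' f'. is_pushout C i f i' f' \<and> inflation serre_conflations i'"
    using po p' by (auto simp: inflation_def serre_conflations_def)
next
  fix p f assume "deflation serre_conflations p \<and> f \<in> Mor C \<and> Cod C f = Cod C p"
  then show "\<exists>p' f'. is_pullback C p f p' f' \<and> deflation serre_conflations p'"
    unfolding serre_deflation_iff using pullback_ex defect_in_pullback by blast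
qed

lemma eff_serre_conflations: "Ob (eff C serre_conflations) = S"
proof -
  interpret T: exact_category C serre_conflations by unfold_locales (rule serre_conflations_exact)
  show ?thesis
  proof (intro equalityI subsetI)
    fix M assume "M \<in> Ob (eff C serre_conflations)"
    then obtain g c where "deflation serre_conflations g" "presents C g M c" using T.eff_iff by blast
    then show "M \<in> S" using defect_in_presents serre_deflation_iff by blast
  next
    fix M assume M: "M \<in> S"
    then obtain g c where g: "deflation E g" and m: "presents C g M c" using serre_eff eff_iff by blast
    then have "defect_in g" using M by (auto simp: defect_in_def)
    then show "M \<in> Ob (eff C serre_conflations)" using T.eff_iff serre_deflation_iff g m by blast
  qed
qed

end

section \<open>The isomorphism of lattices\<close>

lemma isomorphic_latticesI:
  fixes L :: "'a gorder" and M :: "'b gorder"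
  assumes L: "partial_order L" and M: "lattice M" and \<phi>: "bij_betw \<phi> (carrier L) (carrier M)"
    and le: "\<And>x y. x \<in> carrier L \<Longrightarrow> y \<in> carrier L \<Longrightarrow> x \<sqsubseteq>\<^bsub>L\<^esub> y \<longleftrightarrow> \<phi> x \<sqsubseteq>\<^bsub>M\<^esub> \<phi> y"
  shows "isomorphic_lattices L M"
proof -
  interpret L: partial_order L by (rule L)
  interpret M: lattice M by (rule M)
  have img: "\<phi> ` carrier L = carrier M" using \<phi> by (rule bij_betw_imp_surj_on)
  have mem: "\<phi> x \<in> carrier M" if "x \<in> carrier L" for x using img that by blast
  have up: "Upper M (\<phi> ` A) = \<phi> ` Upper L A" and lo: "Lower M (\<phi> ` A) = \<phi> ` Lower L A" if A: "A \<subseteq> carrier L" for A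
  proof -
    have *: "A \<inter> carrier L = A" "\<phi> ` A \<inter> carrier M = \<phi> ` A" using A mem by auto
    have "\<phi> u \<in> Upper M (\<phi> ` A) \<longleftrightarrow> u \<in> Upper L A" "\<phi> u \<in> Lower M (\<phi> ` A) \<longleftrightarrow> u \<in> Lower L A"
      if u: "u \<in> carrier L" for u
    proof -
      have "x \<sqsubseteq>\<^bsub>L\<^esub> u \<longleftrightarrow> \<phi> x \<sqsubseteq>\<^bsub>M\<^esub> \<phi> u" "u \<sqsubseteq>\<^bsub>L\<^esub> x \<longleftrightarrow> \<phi> u \<sqsubseteq>\<^bsub>M\<^esub> \<phi> x" if "x \<in> A" for x
        using le u that A by blast+
      then show "\<phi> u \<in> Upper M (\<phi> ` A) \<longleftrightarrow> u \<in> Upper L A" "\<phi> u \<in> Lower M (\<phi> ` A) \<longleftrightarrow> u \<in> Lower L A"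
        unfolding Upper_def Lower_def * using u mem[OF u] by auto
    qed
    note mem_iff = this
    have image_eq: "U = \<phi> ` V"
      if "U \<subseteq> \<phi> ` carrier L" "V \<subseteq> carrier L" "\<And>u. u \<in> carrier L \<Longrightarrow> \<phi> u \<in> U \<longleftrightarrow> u \<in> V" for U V
      using that by auto
    show "Upper M (\<phi> ` A) = \<phi> ` Upper L A"
      by (rule image_eq[OF _ _ mem_iff(1)]) (simp_all add: img)
    show "Lower M (\<phi> ` A) = \<phi> ` Lower L A"
      by (rule image_eq[OF _ _ mem_iff(2)]) (simp_all add: img)
  qed
  have least: "least L s (Upper L A) \<longleftrightarrow> least M (\<phi> s) (Upper M (\<phi> ` A))"
    and greatest: "greatest L s (Lower L A) \<longleftrightarrow> greatest M (\<phi> s) (Lower M (\<phi> ` A))"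
    if A: "A \<subseteq> carrier L" and s: "s \<in> carrier L" for A s
  proof -
    have inj: "\<phi> s \<in> \<phi> ` B \<longleftrightarrow> s \<in> B" if "B \<subseteq> carrier L" for B
      using bij_betw_imp_inj_on[OF \<phi>] inj_on_image_mem_iff s that by metis
    have U: "Upper L A \<subseteq> carrier L" "Lower L A \<subseteq> carrier L" by (auto simp: Upper_def Lower_def)
    show "least L s (Upper L A) \<longleftrightarrow> least M (\<phi> s) (Upper M (\<phi> ` A))"
      unfolding least_def up[OF A] inj[OF U(1)] using U s le mem by blast
    show "greatest L s (Lower L A) \<longleftrightarrow> greatest M (\<phi> s) (Lower M (\<phi> ` A))"
      unfolding greatest_def lo[OF A] inj[OF U(2)] using U s le mem by blast
  qed
  have sup: "\<exists>s \<in> carrier L. least L s (Upper L {x, y})" and inf: "\<exists>s \<in> carrier L. greatest L s (Lower L {x, y})"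
    if xy: "x \<in> carrier L" "y \<in> carrier L" for x y
  proof -
    have A: "{x, y} \<subseteq> carrier L" using xy by simp
    obtain t where t: "least M t (Upper M (\<phi> ` {x, y}))" using M.sup_of_two_exists mem xy by fastforce
    then have "t \<in> carrier M" by (auto simp: least_def Upper_def)
    then obtain s where "s \<in> carrier L" "t = \<phi> s" using img by auto
    then show "\<exists>s \<in> carrier L. least L s (Upper L {x, y})" using least[OF A] t by blast
    obtain t where t: "greatest M t (Lower M (\<phi> ` {x, y}))" using M.inf_of_two_exists mem xy by fastforce
    then have "t \<in> carrier M" by (auto simp: greatest_def Lower_def)
    then obtain s where "s \<in> carrier L" "t = \<phi> s" using img by auto
    then show "\<exists>s \<in> carrier L. greatest L s (Lower L {x, y})" using greatest[OF A] t by blast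
  qed
  interpret L: lattice L by unfold_locales (use sup inf in blast)+
  have "\<phi> (x \<squnion>\<^bsub>L\<^esub> y) = \<phi> x \<squnion>\<^bsub>M\<^esub> \<phi> y \<and> \<phi> (x \<sqinter>\<^bsub>L\<^esub> y) = \<phi> x \<sqinter>\<^bsub>M\<^esub> \<phi> y"
    if xy: "x \<in> carrier L" "y \<in> carrier L" for x y
  proof
    have A: "{x, y} \<subseteq> carrier L" using xy by simp
    have j: "least L (x \<squnion>\<^bsub>L\<^esub> y) (Upper L {x, y})" and jc: "x \<squnion>\<^bsub>L\<^esub> y \<in> carrier L"
      and m: "greatest L (x \<sqinter>\<^bsub>L\<^esub> y) (Lower L {x, y})" and mc: "x \<sqinter>\<^bsub>L\<^esub> y \<in> carrier L"
      unfolding join_def sup_def meet_def inf_def using someI_ex sup[OF xy] inf[OF xy]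
      by (metis (mono_tags, lifting) least_def greatest_def Upper_closed Lower_closed subsetD someI_ex)+
    have j': "least M (\<phi> x \<squnion>\<^bsub>M\<^esub> \<phi> y) (Upper M (\<phi> ` {x, y}))"
      and m': "greatest M (\<phi> x \<sqinter>\<^bsub>M\<^esub> \<phi> y) (Lower M (\<phi> ` {x, y}))"
      unfolding join_def sup_def meet_def inf_def image_insert image_empty
      by (rule someI_ex, rule M.sup_of_two_exists M.inf_of_two_exists; use mem xy in blast)+
    show "\<phi> (x \<squnion>\<^bsub>L\<^esub> y) = \<phi> x \<squnion>\<^bsub>M\<^esub> \<phi> y"
      using least[OF A jc] j j' M.least_unique by blast
    show "\<phi> (x \<sqinter>\<^bsub>L\<^esub> y) = \<phi> x \<sqinter>\<^bsub>M\<^esub> \<phi> y"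
      using greatest[OF A mc] m m' M.greatest_unique by blast
  qed
  then show ?thesis
    unfolding isomorphic_lattices_def using L.lattice_axioms M \<phi> by blast
qed

lemma partial_order_subset: "partial_order \<lparr>carrier = A, eq = (=), le = (\<subseteq>)\<rparr>"
  by unfold_locales auto

context exact_category
begin

text \<open>
  An intersection of Serre subcategories is not empty, since each of them contains the zero module
  that is presented by an identity.
\<close>

lemma serre_Inter:
  assumes A: "A \<noteq> {}" "\<And>S. S \<in> A \<Longrightarrow> serre_subcategory (eff C E) S"
  shows "serre_subcategory (eff C E) (\<Inter>A)"
proof -
  obtain Z where Z: "Z \<in> Ob C" using zero_object by (auto simp: is_zero_object_def)
  let ?M = "defect C (undefined, Id C Z)"
  have "?M \<in> S" if "S \<in> A" for S
  proof -
    interpret serre_of_exact C E S by unfold_locales (rule A(2)[OF that])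
    show ?thesis using defect_in_presents[OF id_deflation[OF Z] defect_presents] defect_in_id Z by simp
  qed
  then have "\<Inter>A \<noteq> {}" by blast
  moreover have "\<Inter>A \<subseteq> Ob (eff C E)" using A unfolding serre_subcategory_def by blast
  moreover have "Cod (eff C E) i \<in> \<Inter>A \<longleftrightarrow> Dom (eff C E) i \<in> \<Inter>A \<and> Cod (eff C E) p \<in> \<Inter>A"
    if "kernel_cokernel_pair (eff C E) i p" for i p
  proof -
    have "Cod (eff C E) i \<in> S \<longleftrightarrow> Dom (eff C E) i \<in> S \<and> Cod (eff C E) p \<in> S" if "S \<in> A" for S
      using A(2)[OF that] \<open>kernel_cokernel_pair (eff C E) i p\<close> unfolding serre_subcategory_def by blast
    then show ?thesis by blast
  qed
  ultimately show ?thesis unfolding serre_subcategory_def by blast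
qed

lemma serre_lattice: "lattice (serre_subcategories (eff C E))"
proof -
  let ?L = "serre_subcategories (eff C E)"
  interpret partial_order ?L unfolding serre_subcategories_def by (rule partial_order_subset)
  have "complete_lattice ?L"
  proof (rule complete_lattice_criterion1)
    have "serre_subcategory (eff C E) (Ob (eff C E))" by (rule eff_serre[OF exact subset_refl])
    then show "\<exists>g. greatest ?L g (carrier ?L)"
      by (intro exI[of _ "Ob (eff C E)"]) (auto simp: greatest_def serre_subcategories_def serre_subcategory_def)
    fix A assume A: "A \<subseteq> carrier ?L" "A \<noteq> {}"
    have "serre_subcategory (eff C E) (\<Inter>A)"
      by (rule serre_Inter[OF A(2)]) (use A(1) in \<open>auto simp: serre_subcategories_def\<close>)
    then show "\<exists>i. greatest ?L i (Lower ?L A)"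
      using A by (intro exI[of _ "\<Inter>A"]) (auto simp: greatest_def Lower_def serre_subcategories_def)
  qed
  then interpret complete_lattice ?L .
  show ?thesis by (rule lattice_axioms)
qed

end

theorem theorem1:
  fixes A :: "('o, 'm) preadd_cat" and Emax :: "('m \<times> 'm) set"
  assumes "additive_category A"
    and "idempotent_complete A"
    and "greatest (exact_structures A) Emax (carrier (exact_structures A))"
  shows "isomorphic_lattices (exact_structures A) (serre_subcategories (eff A Emax))"
proof -
  interpret additive_category A by fact
  have max: "exact_structure A Emax" "\<And>E. exact_structure A E \<Longrightarrow> E \<subseteq> Emax"
    using assms(3) by (auto simp: greatest_def exact_structures_def)
  interpret exact_category A Emax by unfold_locales (rule max)
  let ?\<phi> = "\<lambda>E. Ob (eff A E)"
  show ?thesis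
  proof (rule isomorphic_latticesI[of _ _ ?\<phi>])
    show "partial_order (exact_structures A)" unfolding exact_structures_def by (rule partial_order_subset)
    show "lattice (serre_subcategories (eff A Emax))" by (rule serre_lattice)
    show le: "x \<sqsubseteq>\<^bsub>exact_structures A\<^esub> y \<longleftrightarrow> ?\<phi> x \<sqsubseteq>\<^bsub>serre_subcategories (eff A Emax)\<^esub> ?\<phi> y"
      if "x \<in> carrier (exact_structures A)" "y \<in> carrier (exact_structures A)" for x y
      using eff_le_iff[of x y] max(2) that by (simp add: exact_structures_def serre_subcategories_def)
    show "bij_betw ?\<phi> (carrier (exact_structures A)) (carrier (serre_subcategories (eff A Emax)))"
      unfolding bij_betw_def
    proof (intro conjI equalityI subsetI)
      show "inj_on ?\<phi> (carrier (exact_structures A))"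
      proof (rule inj_onI)
        fix x y assume "x \<in> carrier (exact_structures A)" "y \<in> carrier (exact_structures A)" "?\<phi> x = ?\<phi> y"
        then show "x = y"
          using eff_le_iff[of x y] eff_le_iff[of y x] max(2) by (auto simp: exact_structures_def)
      qed
    next
      fix T assume "T \<in> ?\<phi> ` carrier (exact_structures A)"
      then show "T \<in> carrier (serre_subcategories (eff A Emax))"
        using eff_serre max(2) by (auto simp: exact_structures_def serre_subcategories_def)
    next
      fix S assume "S \<in> carrier (serre_subcategories (eff A Emax))"
      then interpret serre_of_exact A Emax S by unfold_locales (simp add: serre_subcategories_def)
      show "S \<in> ?\<phi> ` carrier (exact_structures A)"
        using eff_serre_conflations serre_conflations_exact by (auto simp: exact_structures_def)
    qed
  qed
qed

end
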